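(* Let $m,n$ be integers with $\min(m,n-m)\ge1$ and let $R$ have the noncentral $\mathrm{Beta}(\frac m2,\frac{n-m}2)$ distribution, i.e. $R=\boldsymbol\epsilon'\mathbf A\boldsymbol\epsilon/\boldsymbol\epsilon'\mathbf B\boldsymbol\epsilon$ with $\mathbf A=\begin{pmatrix}\mathbf I_m&\mathbf 0\\ \mathbf 0&\mathbf 0\end{pmatrix}$, $\mathbf B=\mathbf I_n$, $\boldsymbol\epsilon\sim\mathbf N(\boldsymbol\mu,\mathbf I_n)$. Put $\theta=\sum_{i=1}^m\mu_i^2$, $$t_0=\frac12+\frac1{4n}\Big\{(\theta-m)-\sqrt{(\theta-m)^2+4\theta n}\Big\},$$ $$u_0=\sqrt{\frac{n-m}2+2t_0^2\Big\{\frac m{(1-2t_0)^2}+\frac{2\theta}{(1-2t_0)^3}\Big\}},\qquad \eta_2=\frac{\theta}{2(1-2t_0)}.$$ Then the limiting ratio of the true tail probability to its first-order Lugannani–Rice approximation is $$\lim_{r\uparrow1}\frac{\Pr(R>r)}{\widehat{\Pr}_1(R>r)}=\frac{\sqrt{2\pi}\,(1-2t_0)^{m/2}(2t_0)^{(n-m)/2}\,u_0\,e^{-\eta_2}}{B\!\left(\frac m2,\frac{n-m}2\right)\frac{n-m}2}\;{}_1F_1\!\left(\frac n2;\frac m2;\frac\theta2\right),$$ and the first-order saddlepoint density has the same relative error limit, i.e. $\lim_{r\uparrow1}f_R(r)/\hat f_R(r)$ equals the same right-hand side.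
   Context: Here $\boldsymbol\mu=(\mu_1,\dots,\mu_n)'\in\mathbb R^n$, the support of $R$ is $(0,1)$, and $f_R$ is the density of $R$. **Saddlepoint approximations.** For $r\in(0,1)$ write $\mathbf A-r\mathbf B=\mathbf P_r'\boldsymbol\Lambda_r\mathbf P_r$ with $\mathbf P_r$ orthogonal and $\boldsymbol\Lambda_r=\mathrm{diag}(\lambda_1,\dots,\lambda_n)$ the ordered eigenvalues $\lambda_1\le\dots\le\lambda_n$; let $\boldsymbol\nu_r=(\nu_1,\dots,\nu_n)'=\mathbf P_r\boldsymbol\mu$ and $X_r=\boldsymbol\epsilon'(\mathbf A-r\mathbf B)\boldsymbol\epsilon$, with moment generating function $$M_{X_r}(s)=\prod_{i=1}^n(1-2s\lambda_i)^{-1/2}\exp\Big\{s\sum_{i=1}^n\frac{\lambda_i\nu_i^2}{1-2s\lambda_i}\Big\},\qquad \frac1{2\lambda_1}<s<\frac1{2\lambda_n},$$ and $K_{X_r}=\ln M_{X_r}$. The saddlepoint $\hat s=\hat s(r)$ is the unique root of $K_{X_r}'(\hat s)=0$ in this interval. Put $\hat w=\mathrm{sgn}(\hat s)\sqrt{-2K_{X_r}(\hat s)}$, $\hat u=\hat s\sqrt{K_{X_r}''(\hat s)}$. The first-order Lugannani–Rice approximation is $$\widehat{\Pr}_1(R\le r)=\begin{cases}\Phi(\hat w)+\phi(\hat w)\{\hat w^{-1}-\hat u^{-1}\},& \mathcal E[X_r]\ne0,\\[2pt] \frac12+\dfrac{K_{X_r}'''(0)}{6\sqrt{2\pi}K_{X_r}''(0)^{3/2}},&\mathcal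 E[X_r]=0,\end{cases}$$ with $\Phi,\phi$ the standard normal c.d.f. and density, and $\widehat{\Pr}_1(R>r)=1-\widehat{\Pr}_1(R\le r)$. The first-order saddlepoint density is $$\hat f_R(r)=\frac{J_r(\hat s)}{\sqrt{2\pi K_{X_r}''(\hat s)}}M_{X_r}(\hat s),$$ $$J_r(s)=\mathrm{tr}\{(\mathbf I-2s\boldsymbol\Lambda_r)^{-1}\mathbf H_r\}+\boldsymbol\nu_r'(\mathbf I-2s\boldsymbol\Lambda_r)^{-1}\mathbf H_r(\mathbf I-2s\boldsymbol\Lambda_r)^{-1}\boldsymbol\nu_r,\qquad \mathbf H_r=\mathbf P_r\mathbf B\mathbf P_r'.$$ $B(\cdot,\cdot)$ is the Beta function and ${}_1F_1$ the confluent hypergeometric function. *)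

theory Defs
  imports
    "HOL-Probability.Probability"
    "Jordan_Normal_Form.Gauss_Jordan_Elimination"
begin

no_notation Finite_Cartesian_Product.vec_nth (infixl \<open>$\<close> 90)

definition quad_form :: "real mat \<Rightarrow> real vec \<Rightarrow> real" where
  "quad_form S x = x \<bullet> (S *\<^sub>v x)"

(* The law N(mu, I_n) of a random vector with values in R^n. *)
definition std_cov_normal_vec ::
    "'a measure \<Rightarrow> nat \<Rightarrow> real vec \<Rightarrow> ('a \<Rightarrow> real vec) \<Rightarrow> bool" where
  "std_cov_normal_vec M n \<mu> \<epsilon> \<longleftrightarrow>
     \<mu> \<in> carrier_vec n \<and> (\<forall>\<omega>\<in>space M. \<epsilon> \<omega> \<in> carrier_vec n) \<and>
     prob_space.indep_vars M (\<lambda>_. borel) (\<lambda>i \<omega>. \<epsilon> \<omega> $ i) {..<n} \<and>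
     (\<forall>i<n. distributed M lborel (\<lambda>\<omega>. \<epsilon> \<omega> $ i) (normal_density (\<mu> $ i) 1))"

(* S = P' diag(lam) P with P orthogonal and the eigenvalues in increasing order;
   indices start at 0, so the extreme eigenvalues are lam 0 and lam (n - 1). *)
definition ordered_spectral_decomp ::
    "nat \<Rightarrow> real mat \<Rightarrow> real mat \<Rightarrow> (nat \<Rightarrow> real) \<Rightarrow> bool" where
  "ordered_spectral_decomp n S P lam \<longleftrightarrow>
     P \<in> carrier_mat n n \<and> P * transpose_mat P = 1\<^sub>m n \<and> transpose_mat P * P = 1\<^sub>m n \<and>
     S = transpose_mat P * mat_diag n lam * P \<and>
     (\<forall>i j. i \<le> j \<longrightarrow> j < n \<longrightarrow> lam i \<le> lam j)"

definition mgf :: "'a measure \<Rightarrow> ('a \<Rightarrow> real) \<Rightarrow> real \<Rightarrow> real" where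
  "mgf M X s = (\<integral>\<omega>. exp (s * X \<omega>) \<partial>M)"

definition cgf :: "'a measure \<Rightarrow> ('a \<Rightarrow> real) \<Rightarrow> real \<Rightarrow> real" where
  "cgf M X s = ln (mgf M X s)"

definition saddlepoint ::
    "'a measure \<Rightarrow> ('a \<Rightarrow> real) \<Rightarrow> nat \<Rightarrow> (nat \<Rightarrow> real) \<Rightarrow> real" where
  "saddlepoint M X n lam =
     (THE s. 1 / (2 * lam 0) < s \<and> s < 1 / (2 * lam (n - 1)) \<and> deriv (cgf M X) s = 0)"

(* First-order Lugannani-Rice approximation of Pr(X <= 0), where X has
   c.g.f. K and saddlepoint s. *)
definition lugannani_rice1 ::
    "'a measure \<Rightarrow> ('a \<Rightarrow> real) \<Rightarrow> nat \<Rightarrow> (nat \<Rightarrow> real) \<Rightarrow> real" where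
  "lugannani_rice1 M X n lam =
     (let K = cgf M X;
          s = saddlepoint M X n lam;
          w = sgn s * sqrt (- 2 * K s);
          u = s * sqrt ((deriv ^^ 2) K s)
      in if (\<integral>\<omega>. X \<omega> \<partial>M) \<noteq> 0
         then cdf std_normal_distribution w + std_normal_density w * (inverse w - inverse u)
         else 1 / 2 + (deriv ^^ 3) K 0 / (6 * sqrt (2 * pi) * ((deriv ^^ 2) K 0) powr (3 / 2)))"

definition saddlepoint_J ::
    "nat \<Rightarrow> real mat \<Rightarrow> real vec \<Rightarrow> real mat \<Rightarrow> (nat \<Rightarrow> real) \<Rightarrow> real \<Rightarrow> real" where
  "saddlepoint_J n B \<mu> P lam s =
     (let D = the (mat_inverse (1\<^sub>m n - (2 * s) \<cdot>\<^sub>m mat_diag n lam));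
          H = P * B * transpose_mat P;
          \<nu> = P *\<^sub>v \<mu>
      in sum_list (diag_mat (D * H)) + \<nu> \<bullet> ((D * H * D) *\<^sub>v \<nu>))"

definition saddlepoint_density1 ::
    "'a measure \<Rightarrow> ('a \<Rightarrow> real) \<Rightarrow> nat \<Rightarrow> real mat \<Rightarrow> real vec \<Rightarrow> real mat \<Rightarrow> (nat \<Rightarrow> real) \<Rightarrow> real" where
  "saddlepoint_density1 M X n B \<mu> P lam =
     (let s = saddlepoint M X n lam
      in saddlepoint_J n B \<mu> P lam s / sqrt (2 * pi * (deriv ^^ 2) (cgf M X) s) * mgf M X s)"

definition hyp1F1 :: "real \<Rightarrow> real \<Rightarrow> real \<Rightarrow> real" where
  "hyp1F1 a b z = (\<Sum>k. pochhammer a k / (pochhammer b k * fact k) * z ^ k)"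

end

theory Submission
  imports Defs "HOL-Real_Asymp.Real_Asymp"
begin

text \<open>
  Write \<open>U\<close> and \<open>V\<close> for the sums of squares of the first \<open>m\<close> and the last \<open>n - m\<close> components,
  with noncentralities \<open>\<theta>\<close> and \<open>\<delta>\<close>, so that \<open>R = U / (U + V)\<close> and \<open>X r = (1 - r) U - r V\<close>.
  As Poisson mixtures of gamma laws, \<open>U\<close> and \<open>V\<close> give \<open>R\<close> a density
  \<open>x\<^bsup>a-1\<^esup> (1 - x)\<^bsup>b-1\<^esup> S x\<close> with \<open>a = m / 2\<close>, \<open>b = (n - m) / 2\<close> and \<open>S\<close> a power series that is
  continuous on \<open>[0, 1]\<close>; its value \<open>S 1\<close> carries the confluent hypergeometric function, and the tail
  of \<open>R\<close> at \<open>r\<close> is asymptotic to \<open>S 1 (1 - r)\<^bsup>b\<^esup> / b\<close>.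

  On the other side, the saddlepoint \<open>s\<close> of \<open>X r\<close> tends to infinity like \<open>t\<^sub>0 / (1 - r)\<close>: after the
  substitution \<open>t = s (1 - r)\<close> the saddlepoint equation converges to one with root \<open>t\<^sub>0\<close>. Hence
  the saddlepoint value of the moment generating function is of order \<open>(1 - r)\<^bsup>b\<^esup>\<close>, while
  \<open>s\<^sup>2 K'' s\<close> converges to \<open>u\<^sub>0\<^sup>2\<close>. As \<open>w\<close> tends to infinity, Mills' ratio vanishes and only the
  term \<open>\<phi>(w) / u\<close> of the Lugannani-Rice formula survives. The noncentrality \<open>\<delta>\<close> enters both sides
  through the same factor \<open>exp (- \<delta> / 2)\<close>.
\<close>

text \<open>Each ratio is evaluated after dividing numerator and denominator by one power of
  \<open>1 - r\<close>, namely \<open>b\<close> for the tails and \<open>b - 1\<close> for the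
  densities. That the two limits agree is no accident. Integrating
  \<open>(1 - x) powr (b - 1)\<close> costs the exact tail a factor \<open>1 / b\<close>. On the
  saddlepoint side the Jacobian satisfies
  \<open>(1 - r) * s * J \<longlonglongrightarrow> b\<close>, and this limit is the limiting
  saddlepoint equation itself. Three objects have to be pinned down first. The saddlepoint is a
  definite description over the derivative of the logarithm of an integral, so the c.g.f. is
  identified with a closed form on its whole open interval, where convexity gives uniqueness;
  existence is shown for \<open>r\<close> near 1 only, which suffices for a limit. The orthogonal
  matrix is not unique, since eigenvalues repeat, so only facts valid for every admissible
  \<open>P\<close> may enter. A density is determined only almost everywhere, so continuity is what
  fixes its value at \<open>r\<close>. Laws are computed with nonnegative integrals, where double
  series may be exchanged freely; convergence in the reals matters only for the series
  \<open>S\<close>.\<close>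

section \<open>Gamma and beta densities\<close>

text \<open>The scale parameter is fixed to 2, so \<open>gamma_dens (k / 2)\<close> is the chi-square density with \<open>k\<close> degrees of freedom.\<close>

definition gamma_dens :: "real \<Rightarrow> real \<Rightarrow> real" where
  "gamma_dens a x = (if 0 < x then x powr (a - 1) * exp (- x / 2) / (2 powr a * Gamma a) else 0)"

definition beta_dens :: "real \<Rightarrow> real \<Rightarrow> real \<Rightarrow> real" where
  "beta_dens a b x = (if 0 < x \<and> x < 1 then x powr (a - 1) * (1 - x) powr (b - 1) / Beta a b else 0)"

lemma gamma_dens_measurable [measurable]: "gamma_dens a \<in> borel_measurable borel"
  unfolding gamma_dens_def[abs_def] by measurable

lemma beta_dens_measurable [measurable]: "beta_dens a b \<in> borel_measurable borel"
  unfolding beta_dens_def[abs_def] by measurable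

lemma Beta_pos: "0 < a \<Longrightarrow> 0 < b \<Longrightarrow> 0 < Beta a (b::real)"
  by (simp add: Beta_def Gamma_real_pos)

lemma gamma_dens_nonneg: "0 < a \<Longrightarrow> 0 \<le> gamma_dens a x"
  by (simp add: gamma_dens_def Gamma_real_pos less_imp_le)

lemma beta_dens_nonneg: "0 < a \<Longrightarrow> 0 < b \<Longrightarrow> 0 \<le> beta_dens a b x"
  by (simp add: beta_dens_def Beta_pos less_imp_le)

text \<open>Exponential tilting only changes the rate:
  \<open>exp (c * x) * exp (- x / 2) = exp (- k * x)\<close> with
  \<open>k = (1 - 2 * c) / 2\<close>, and the substitution \<open>t = k * x\<close> turns Euler's
  integral for \<open>Gamma a\<close> into this one. The case \<open>c = 0\<close> is the total
  mass.\<close>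

lemma nn_integral_exp_gamma_dens:
  assumes a: "0 < a" and c: "c < 1 / 2"
  shows "(\<integral>\<^sup>+x. ennreal (exp (c * x)) * ennreal (gamma_dens a x) \<partial>lborel) = ennreal ((1 - 2 * c) powr (- a))"
proof -
  define k where "k = (1 - 2 * c) / 2"
  have k: "0 < k" using c by (simp add: k_def)
  have two_k: "2 * k = 1 - 2 * c" by (simp add: k_def)
  have "ennreal (Gamma a) = (\<integral>\<^sup>+t. ennreal (indicator {0..} t * t powr (a - 1) / exp t) \<partial>lborel)"
    using a by (rule Gamma_conv_nn_integral_real)
  also have "\<dots> = ennreal \<bar>k\<bar> * (\<integral>\<^sup>+x. ennreal (indicator {0..} (0 + k * x) * (0 + k * x) powr (a - 1) / exp (0 + k * x)) \<partial>lborel)"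
    using k by (intro nn_integral_real_affine) auto
  also have "(\<integral>\<^sup>+x. ennreal (indicator {0..} (0 + k * x) * (0 + k * x) powr (a - 1) / exp (0 + k * x)) \<partial>lborel)
      = (\<integral>\<^sup>+x. ennreal (k powr (a - 1) * 2 powr a * Gamma a) * (ennreal (exp (c * x)) * ennreal (gamma_dens a x)) \<partial>lborel)"
  proof (rule nn_integral_cong_AE)
    have "AE x in lborel. x \<noteq> (0::real)" by (rule AE_lborel_singleton)
    then show "AE x in lborel. ennreal (indicator {0..} (0 + k * x) * (0 + k * x) powr (a - 1) / exp (0 + k * x)) =
      ennreal (k powr (a - 1) * 2 powr a * Gamma a) * (ennreal (exp (c * x)) * ennreal (gamma_dens a x))"
    proof eventually_elim
      case (elim x)
      have "indicator {0..} (k * x) * (k * x) powr (a - 1) / exp (k * x)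
        = k powr (a - 1) * 2 powr a * Gamma a * (exp (c * x) * gamma_dens a x)"
      proof (cases "0 < x")
        case True
        have "exp (- (k * x)) = exp (c * x) * exp (- x / 2)"
          unfolding exp_add[symmetric] by (simp add: k_def field_simps)
        moreover have "indicator {0..} (k * x) = (1::real)" "(k * x) powr (a - 1) = k powr (a - 1) * x powr (a - 1)"
          using True k by (auto simp: powr_mult)
        moreover have "Gamma a \<noteq> 0" using Gamma_real_pos[OF a] by simp
        ultimately show ?thesis using True
          by (simp add: gamma_dens_def exp_minus field_simps)
      next
        case False
        then have "k * x < 0" using elim k by (simp add: mult_pos_neg)
        then show ?thesis using False by (simp add: gamma_dens_def)
      qed
      then show ?case using a Gamma_real_pos[OF a] gamma_dens_nonneg[OF a, of x]
        by (simp add: ennreal_mult[symmetric])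
    qed
  qed
  also have "\<dots> = ennreal (k powr (a - 1) * 2 powr a * Gamma a) * (\<integral>\<^sup>+x. ennreal (exp (c * x)) * ennreal (gamma_dens a x) \<partial>lborel)"
    by (rule nn_integral_cmult) measurable
  finally have *: "ennreal (Gamma a) = ennreal ((2 * k) powr a * Gamma a) * (\<integral>\<^sup>+x. ennreal (exp (c * x)) * ennreal (gamma_dens a x) \<partial>lborel)"
    (is "_ = _ * ?I")
    using k Gamma_real_pos[OF a]
    by (simp add: mult.assoc[symmetric] ennreal_mult'[symmetric] powr_mult powr_mult_base)
       (simp add: mult_ac)
  have "ennreal ((1 - 2 * c) powr (- a)) = ennreal ((2 * k) powr (- a) / Gamma a) * ennreal (Gamma a)"
    using Gamma_real_pos[OF a] two_k by (simp add: ennreal_mult'[symmetric])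
  also have "\<dots> = ennreal ((2 * k) powr (- a) / Gamma a * ((2 * k) powr a * Gamma a)) * ?I"
    unfolding * using Gamma_real_pos[OF a] k by (subst ennreal_mult) (auto simp: mult.assoc)
  also have "(2 * k) powr (- a) / Gamma a * ((2 * k) powr a * Gamma a) = 1"
    using Gamma_real_pos[OF a] k by (simp add: powr_minus)
  finally show ?thesis by simp
qed

lemma nn_integral_gamma_dens: "0 < a \<Longrightarrow> (\<integral>\<^sup>+x. ennreal (gamma_dens a x) \<partial>lborel) = 1"
  using nn_integral_exp_gamma_dens[of a 0] by simp

text \<open>Pointwise form of the independence of total and proportion for two gamma variables. The
  leading factor \<open>s\<close> is the Jacobian of
  \<open>(s, x) \<mapsto> (s * x, s * (1 - x))\<close>.\<close>

lemma gamma_dens_mult_scaled: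
  assumes "0 < a" "0 < b" "0 < s"
  shows "s * gamma_dens a (s * x) * gamma_dens b (s * (1 - x)) = gamma_dens (a + b) s * beta_dens a b x"
proof (cases "0 < x \<and> x < 1")
  case True
  have "exp (- (s * x) / 2) * exp (- (s * (1 - x)) / 2) = exp (- s / 2)"
    unfolding exp_add[symmetric] by (simp add: field_simps)
  moreover have "s * s powr (a - 1) * s powr (b - 1) = s powr (a + b - 1)"
    using assms by (simp add: powr_mult_base powr_add[symmetric] algebra_simps)
  moreover have nz: "Gamma (a + b) \<noteq> 0"
    using assms Gamma_real_pos[of "a + b"] by linarith
  moreover have "(s * x) powr (a - 1) = s powr (a - 1) * x powr (a - 1)"
    "(s * (1 - x)) powr (b - 1) = s powr (b - 1) * (1 - x) powr (b - 1)"
    "2 powr (a + b) = 2 powr a * (2::real) powr b"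
    using True assms by (auto simp: powr_mult powr_add)
  moreover have "s * gamma_dens a (s * x) * gamma_dens b (s * (1 - x)) =
      (s * s powr (a - 1) * s powr (b - 1)) * (exp (- (s * x) / 2) * exp (- (s * (1 - x)) / 2)) *
      (x powr (a - 1) * (1 - x) powr (b - 1)) / (2 powr a * 2 powr b * Gamma a * Gamma b)"
    using True assms calculation(4,5) by (simp add: gamma_dens_def mult_ac)
  ultimately show ?thesis using True assms
    by (simp add: gamma_dens_def beta_dens_def Beta_def nz)
next
  case False
  then show ?thesis using assms
    by (auto simp: gamma_dens_def beta_dens_def zero_less_mult_iff)
qed

text \<open>The planar change of variables is split into a shift \<open>v = s - u\<close>, an
  exchange of integrals and a scaling \<open>u = s * x\<close>, so that only one-dimensional affine
  substitutions occur. Laws of sums come from an \<open>F\<close> that sees \<open>s\<close> only,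
  laws of ratios from an \<open>F\<close> that sees \<open>x\<close> only.\<close>

lemma gamma_dens_pair:
  fixes F :: "real \<times> real \<Rightarrow> ennreal"
  assumes F [measurable]: "F \<in> borel_measurable (borel \<Otimes>\<^sub>M borel)" and a: "0 < a" and b: "0 < b"
  shows "(\<integral>\<^sup>+u. \<integral>\<^sup>+v. F (u, v) * (ennreal (gamma_dens a u) * ennreal (gamma_dens b v)) \<partial>lborel \<partial>lborel)
    = (\<integral>\<^sup>+s. \<integral>\<^sup>+x. F (s * x, s * (1 - x)) * (ennreal (gamma_dens (a + b) s) * ennreal (beta_dens a b x)) \<partial>lborel \<partial>lborel)"
proof -
  have "(\<integral>\<^sup>+u. \<integral>\<^sup>+v. F (u, v) * (ennreal (gamma_dens a u) * ennreal (gamma_dens b v)) \<partial>lborel \<partial>lborel)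
    = (\<integral>\<^sup>+u. \<integral>\<^sup>+s. F (u, - u + 1 * s) * (ennreal (gamma_dens a u) * ennreal (gamma_dens b (- u + 1 * s))) \<partial>lborel \<partial>lborel)"
    by (rule nn_integral_cong, subst nn_integral_real_affine[where c=1 and t="- u" for u]) auto
  also have "\<dots> = (\<integral>\<^sup>+s. \<integral>\<^sup>+u. F (u, s - u) * (ennreal (gamma_dens a u) * ennreal (gamma_dens b (s - u))) \<partial>lborel \<partial>lborel)"
    by (subst lborel_pair.Fubini') (auto simp: split_beta')
  also have "\<dots> = (\<integral>\<^sup>+s. \<integral>\<^sup>+x. F (s * x, s * (1 - x)) * (ennreal (gamma_dens (a + b) s) * ennreal (beta_dens a b x)) \<partial>lborel \<partial>lborel)"
  proof (rule nn_integral_cong)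
    fix s :: real
    show "(\<integral>\<^sup>+u. F (u, s - u) * (ennreal (gamma_dens a u) * ennreal (gamma_dens b (s - u))) \<partial>lborel)
      = (\<integral>\<^sup>+x. F (s * x, s * (1 - x)) * (ennreal (gamma_dens (a + b) s) * ennreal (beta_dens a b x)) \<partial>lborel)"
    proof (cases "0 < s")
      case True
      have "(\<integral>\<^sup>+u. F (u, s - u) * (ennreal (gamma_dens a u) * ennreal (gamma_dens b (s - u))) \<partial>lborel)
        = ennreal \<bar>s\<bar> * (\<integral>\<^sup>+x. F (0 + s * x, s - (0 + s * x)) * (ennreal (gamma_dens a (0 + s * x)) * ennreal (gamma_dens b (s - (0 + s * x)))) \<partial>lborel)"
        using True by (intro nn_integral_real_affine) auto
      also have "\<dots> = (\<integral>\<^sup>+x. F (s * x, s * (1 - x)) * (ennreal s * ennreal (gamma_dens a (s * x)) * ennreal (gamma_dens b (s * (1 - x)))) \<partial>lborel)"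
        using True by (subst nn_integral_cmult[symmetric]) (auto simp: algebra_simps)
      also have "\<dots> = (\<integral>\<^sup>+x. F (s * x, s * (1 - x)) * (ennreal (gamma_dens (a + b) s) * ennreal (beta_dens a b x)) \<partial>lborel)"
      proof (rule nn_integral_cong)
        fix x
        have "ennreal s * ennreal (gamma_dens a (s * x)) * ennreal (gamma_dens b (s * (1 - x)))
          = ennreal (s * gamma_dens a (s * x) * gamma_dens b (s * (1 - x)))"
          using True a b by (simp add: ennreal_mult gamma_dens_nonneg)
        also have "\<dots> = ennreal (gamma_dens (a + b) s) * ennreal (beta_dens a b x)"
          unfolding gamma_dens_mult_scaled[OF a b True]
          using a b by (simp add: ennreal_mult gamma_dens_nonneg beta_dens_nonneg)
        finally show "F (s * x, s * (1 - x)) * (ennreal s * ennreal (gamma_dens a (s * x)) * ennreal (gamma_dens b (s * (1 - x))))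
          = F (s * x, s * (1 - x)) * (ennreal (gamma_dens (a + b) s) * ennreal (beta_dens a b x))" by simp
      qed
      finally show ?thesis .
    next
      case False
      \<comment> \<open>If \<open>s \<le> 0\<close>, then \<open>u\<close> and \<open>s - u\<close>
        cannot both be positive.\<close>
      then have "gamma_dens a u = 0 \<or> gamma_dens b (s - u) = 0" "gamma_dens (a + b) s = 0" for u
        by (auto simp: gamma_dens_def)
      then have "ennreal (gamma_dens a u) * ennreal (gamma_dens b (s - u)) = 0" "ennreal (gamma_dens (a + b) s) = 0" for u
        by (metis ennreal_0 mult_zero_left mult_zero_right)+
      then show ?thesis by (simp only: mult_zero_left mult_zero_right nn_integral_const)
    qed
  qed
  finally show ?thesis .
qed

text \<open>The pair identity with \<open>F = 1\<close>: the gamma factors have mass 1 on both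
  sides, so the beta factor must have mass 1 as well.\<close>

lemma nn_integral_beta_dens:
  assumes a: "0 < a" and b: "0 < b"
  shows "(\<integral>\<^sup>+x. ennreal (beta_dens a b x) \<partial>lborel) = 1"
proof -
  have "1 = (\<integral>\<^sup>+u. \<integral>\<^sup>+v. 1 * (ennreal (gamma_dens a u) * ennreal (gamma_dens b v)) \<partial>lborel \<partial>lborel)"
    using a b by (simp add: nn_integral_cmult nn_integral_gamma_dens)
  also have "\<dots> = (\<integral>\<^sup>+s. \<integral>\<^sup>+x. 1 * (ennreal (gamma_dens (a + b) s) * ennreal (beta_dens a b x)) \<partial>lborel \<partial>lborel)"
    by (rule gamma_dens_pair[where F="\<lambda>_. 1"]) (use a b in auto)
  also have "\<dots> = (\<integral>\<^sup>+x. ennreal (beta_dens a b x) \<partial>lborel)"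
    using a b by (simp add: nn_integral_cmult nn_integral_multc nn_integral_gamma_dens)
  finally show ?thesis by simp
qed

section \<open>Noncentral chi-square distributions\<close>

text \<open>Poisson probabilities with mean \<open>\<theta> / 2\<close>, because
  \<open>\<theta>\<close> stands for the sum of the squared means. For \<open>\<theta> = 0\<close>
  the convention \<open>0 ^ 0 = 1\<close> leaves a unit mass at 0, which is the central
  case.\<close>

definition pois_weight :: "real \<Rightarrow> nat \<Rightarrow> real" where
  "pois_weight \<theta> j = exp (- \<theta> / 2) * (\<theta> / 2) ^ j / fact j"

text \<open>\<open>ncchi2 (k / 2) \<theta>\<close> is the noncentral chi-square density with \<open>k\<close> degrees of freedom.\<close>

definition ncchi2 :: "real \<Rightarrow> real \<Rightarrow> real \<Rightarrow> ennreal" where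
  "ncchi2 a \<theta> x = (\<Sum>j. ennreal (pois_weight \<theta> j) * ennreal (gamma_dens (a + real j) x))"

lemma pois_weight_nonneg: "0 \<le> \<theta> \<Longrightarrow> 0 \<le> pois_weight \<theta> j"
  by (simp add: pois_weight_def)

lemma ncchi2_measurable [measurable]: "ncchi2 a \<theta> \<in> borel_measurable borel"
  unfolding ncchi2_def[abs_def] by measurable

text \<open>The binomial theorem, read as the convolution of two Poisson laws; this is why
  noncentralities add.\<close>

lemma pois_weight_add:
  "pois_weight (\<theta> + \<delta>) N = (\<Sum>j\<le>N. pois_weight \<theta> j * pois_weight \<delta> (N - j))"
proof -
  have "((\<theta> + \<delta>) / 2) ^ N = (\<Sum>j\<le>N. of_nat (N choose j) * (\<theta> / 2) ^ j * (\<delta> / 2) ^ (N - j))"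
    by (simp add: add_divide_distrib binomial_ring)
  then have "pois_weight (\<theta> + \<delta>) N = (\<Sum>j\<le>N. exp (- (\<theta> + \<delta>) / 2) * (of_nat (N choose j) * (\<theta> / 2) ^ j * (\<delta> / 2) ^ (N - j)) / fact N)"
    by (simp add: pois_weight_def sum_distrib_left sum_divide_distrib)
  also have "\<dots> = (\<Sum>j\<le>N. pois_weight \<theta> j * pois_weight \<delta> (N - j))"
  proof (rule sum.cong)
    fix j assume "j \<in> {..N}"
    then have "real (N choose j) = fact N / (fact j * fact (N - j))"
      by (simp add: binomial_fact)
    moreover have "exp (- (\<theta> + \<delta>) / 2) = exp (- \<theta> / 2) * exp (- \<delta> / 2)"
      unfolding exp_add[symmetric] by (simp add: field_simps)
    ultimately show "exp (- (\<theta> + \<delta>) / 2) * (of_nat (N choose j) * (\<theta> / 2) ^ j * (\<delta> / 2) ^ (N - j)) / fact N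
        = pois_weight \<theta> j * pois_weight \<delta> (N - j)"
      by (simp add: pois_weight_def field_simps)
  qed simp
  finally show ?thesis .
qed

section \<open>Rearranging double series of nonnegative terms, and laws of independent pairs\<close>

lemma suminf_swap_ennreal:
  fixes f :: "nat \<Rightarrow> nat \<Rightarrow> ennreal"
  shows "(\<Sum>i. \<Sum>j. f i j) = (\<Sum>j. \<Sum>i. f i j)"
proof -
  have "(\<Sum>i. \<Sum>j. f i j) = (\<integral>\<^sup>+i. (\<Sum>j. f i j) \<partial>count_space UNIV)"
    by (simp add: nn_integral_count_space_nat)
  also have "\<dots> = (\<Sum>j. \<integral>\<^sup>+i. f i j \<partial>count_space UNIV)"
    by (rule nn_integral_suminf) simp
  finally show ?thesis by (simp add: nn_integral_count_space_nat)
qed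

text \<open>Row \<open>j\<close> is shifted right by \<open>j\<close> and padded with zeros;
  exchanging the two sums then collects the antidiagonals.\<close>

lemma suminf_diagonal_ennreal:
  fixes f :: "nat \<Rightarrow> nat \<Rightarrow> ennreal"
  shows "(\<Sum>j. \<Sum>k. f j k) = (\<Sum>N. \<Sum>j\<le>N. f j (N - j))"
proof -
  have "(\<Sum>k. f j k) = (\<Sum>N. if j \<le> N then f j (N - j) else 0)" for j
  proof -
    have "(\<Sum>N. if j \<le> N then f j (N - j) else 0)
        = (\<Sum>N. if j \<le> N + j then f j (N + j - j) else 0) + (\<Sum>N<j. if j \<le> N then f j (N - j) else 0)"
      by (rule suminf_offset) simp
    then show ?thesis by simp
  qed
  then have "(\<Sum>j. \<Sum>k. f j k) = (\<Sum>j. \<Sum>N. if j \<le> N then f j (N - j) else 0)" by simp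
  also have "\<dots> = (\<Sum>N. \<Sum>j. if j \<le> N then f j (N - j) else 0)"
    by (rule suminf_swap_ennreal)
  also have "\<dots> = (\<Sum>N. \<Sum>j\<le>N. f j (N - j))"
  proof (rule arg_cong[where f=suminf], rule ext)
    fix N
    have "(\<Sum>j. if j \<le> N then f j (N - j) else 0) = (\<Sum>j\<le>N. if j \<le> N then f j (N - j) else 0)"
      by (rule suminf_finite) auto
    then show "(\<Sum>j. if j \<le> N then f j (N - j) else 0) = (\<Sum>j\<le>N. f j (N - j))" by simp
  qed
  finally show ?thesis .
qed

text \<open>Reduces every statement about two noncentral variables to central gamma pairs, to which
  \<open>gamma_dens_pair\<close> applies term by term.\<close>

lemma ncchi2_pair:
  fixes F :: "real \<times> real \<Rightarrow> ennreal"
  assumes F [measurable]: "F \<in> borel_measurable (borel \<Otimes>\<^sub>M borel)"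
  shows "(\<integral>\<^sup>+u. \<integral>\<^sup>+v. F (u, v) * (ncchi2 a \<theta> u * ncchi2 b \<delta> v) \<partial>lborel \<partial>lborel)
    = (\<Sum>j. \<Sum>k. ennreal (pois_weight \<theta> j) * ennreal (pois_weight \<delta> k) *
        (\<integral>\<^sup>+u. \<integral>\<^sup>+v. F (u, v) * (ennreal (gamma_dens (a + real j) u) * ennreal (gamma_dens (b + real k) v)) \<partial>lborel \<partial>lborel))"
proof -
  have "F (u, v) * (ncchi2 a \<theta> u * ncchi2 b \<delta> v) =
     (\<Sum>j. \<Sum>k. ennreal (pois_weight \<theta> j) * ennreal (pois_weight \<delta> k) *
       (F (u, v) * (ennreal (gamma_dens (a + real j) u) * ennreal (gamma_dens (b + real k) v))))" for u v
  proof -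
    have "F (u, v) * (ncchi2 a \<theta> u * ncchi2 b \<delta> v) = (\<Sum>j. F (u, v) * ((ennreal (pois_weight \<theta> j) * ennreal (gamma_dens (a + real j) u)) * ncchi2 b \<delta> v))"
      by (simp add: ncchi2_def[of a])
    also have "\<dots> = (\<Sum>j. \<Sum>k. F (u, v) * ((ennreal (pois_weight \<theta> j) * ennreal (gamma_dens (a + real j) u))
        * (ennreal (pois_weight \<delta> k) * ennreal (gamma_dens (b + real k) v))))"
      unfolding ncchi2_def[of b] by simp
    finally show ?thesis by (simp only: mult_ac)
  qed
  then show ?thesis
    by (simp add: nn_integral_suminf nn_integral_cmult)
qed

lemma (in prob_space) indep_nn_integral_pair:
  assumes X: "distributed M lborel X f" and Y: "distributed M lborel Y g"
    and ind: "indep_var borel X borel Y"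
    and F: "F \<in> borel_measurable (borel \<Otimes>\<^sub>M borel)"
  shows "(\<integral>\<^sup>+\<omega>. F (X \<omega>, Y \<omega>) \<partial>M) = (\<integral>\<^sup>+u. \<integral>\<^sup>+v. F (u, v) * (f u * g v) \<partial>lborel \<partial>lborel)"
proof -
  have [measurable]: "f \<in> borel_measurable borel" "g \<in> borel_measurable borel"
    using distributed_borel_measurable[OF X] distributed_borel_measurable[OF Y] by simp_all
  have F' [measurable]: "F \<in> borel_measurable (lborel \<Otimes>\<^sub>M lborel)"
    using F by (simp cong: measurable_cong_sets)
  have "indep_var lborel X lborel Y"
    using ind by (simp add: indep_var_eq cong: measurable_cong_sets)
  then have D: "distributed M (lborel \<Otimes>\<^sub>M lborel) (\<lambda>x. (X x, Y x)) (\<lambda>(x, y). f x * g y)"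
    by (intro distributed_joint_indep X Y lborel.sigma_finite_measure_axioms)
  have "(\<integral>\<^sup>+\<omega>. F (X \<omega>, Y \<omega>) \<partial>M) = (\<integral>\<^sup>+z. (case z of (x, y) \<Rightarrow> f x * g y) * F z \<partial>(lborel \<Otimes>\<^sub>M lborel))"
    by (rule distributed_nn_integral[OF D F', symmetric])
  also have "\<dots> = (\<integral>\<^sup>+u. \<integral>\<^sup>+v. F (u, v) * (f u * g v) \<partial>lborel \<partial>lborel)"
    by (subst lborel.nn_integral_fst[symmetric]) (auto simp: mult.commute)
  finally show ?thesis .
qed

lemma (in prob_space) distributed_lborelI:
  fixes X :: "'a \<Rightarrow> real"
  assumes [measurable]: "X \<in> borel_measurable M" "f \<in> borel_measurable borel"
    and eq: "\<And>E. E \<in> sets borel \<Longrightarrow> (\<integral>\<^sup>+\<omega>. indicator E (X \<omega>) \<partial>M) = (\<integral>\<^sup>+x. f x * indicator E x \<partial>lborel)"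
  shows "distributed M lborel X f"
  unfolding distributed_def
proof (intro conjI measure_eqI)
  fix E assume "E \<in> sets (distr M lborel X)"
  then have E [measurable]: "E \<in> sets borel" by simp
  have "emeasure (distr M lborel X) E = (\<integral>\<^sup>+\<omega>. indicator E (X \<omega>) \<partial>M)"
    by (subst nn_integral_indicator[symmetric], simp, subst nn_integral_distr) (auto simp: measurable_lborel1)
  also have "\<dots> = emeasure (density lborel f) E"
    by (simp add: eq emeasure_density)
  finally show "emeasure (distr M lborel X) E = emeasure (density lborel f) E" .
qed (auto simp: measurable_lborel1)

text \<open>For the pair \<open>(j, k)\<close> the sum has the gamma law of shape
  \<open>a + b + j + k\<close>, which depends on \<open>j + k\<close> only. Summing along
  antidiagonals therefore leaves the convolution of the Poisson weights.\<close>

lemma (in prob_space) ncchi2_add: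
  assumes X: "distributed M lborel X (ncchi2 a \<theta>)" and Y: "distributed M lborel Y (ncchi2 b \<delta>)"
    and ind: "indep_var borel X borel Y"
    and pos: "0 < a" "0 < b" "0 \<le> \<theta>" "0 \<le> \<delta>"
  shows "distributed M lborel (\<lambda>\<omega>. X \<omega> + Y \<omega>) (ncchi2 (a + b) (\<theta> + \<delta>))"
proof (rule distributed_lborelI)
  have [measurable]: "X \<in> borel_measurable M" "Y \<in> borel_measurable M"
    using distributed_measurable[OF X] distributed_measurable[OF Y] by simp_all
  show "(\<lambda>\<omega>. X \<omega> + Y \<omega>) \<in> borel_measurable M" by measurable
next
  fix E :: "real set" assume E [measurable]: "E \<in> sets borel"
  define H where "H N = (\<integral>\<^sup>+s. indicator E s * ennreal (gamma_dens (a + b + real N) s) \<partial>lborel)" for N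
  have inner: "(\<integral>\<^sup>+u. \<integral>\<^sup>+v. indicator E (u + v) * (ennreal (gamma_dens (a + real j) u) * ennreal (gamma_dens (b + real k) v)) \<partial>lborel \<partial>lborel)
      = H (j + k)" for j k
  proof -
    have "(\<integral>\<^sup>+u. \<integral>\<^sup>+v. (\<lambda>(u, v). indicator E (u + v)) (u, v) * (ennreal (gamma_dens (a + real j) u) * ennreal (gamma_dens (b + real k) v)) \<partial>lborel \<partial>lborel)
      = (\<integral>\<^sup>+s. \<integral>\<^sup>+x. (\<lambda>(u, v). indicator E (u + v)) (s * x, s * (1 - x)) * (ennreal (gamma_dens (a + real j + (b + real k)) s) * ennreal (beta_dens (a + real j) (b + real k) x)) \<partial>lborel \<partial>lborel)"
      by (rule gamma_dens_pair) (use pos in auto)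
    also have "\<dots> = (\<integral>\<^sup>+s. indicator E s * ennreal (gamma_dens (a + b + real (j + k)) s) * (\<integral>\<^sup>+x. ennreal (beta_dens (a + real j) (b + real k) x) \<partial>lborel) \<partial>lborel)"
      by (subst nn_integral_cmult[symmetric]) (auto simp: algebra_simps)
    also have "\<dots> = H (j + k)"
      using pos by (simp add: nn_integral_beta_dens H_def)
    finally show ?thesis by simp
  qed
  have "(\<integral>\<^sup>+\<omega>. indicator E (X \<omega> + Y \<omega>) \<partial>M) = (\<integral>\<^sup>+\<omega>. (\<lambda>(u, v). indicator E (u + v)) (X \<omega>, Y \<omega>) \<partial>M)" by simp
  also have "\<dots> = (\<integral>\<^sup>+u. \<integral>\<^sup>+v. (\<lambda>(u, v). indicator E (u + v)) (u, v) * (ncchi2 a \<theta> u * ncchi2 b \<delta> v) \<partial>lborel \<partial>lborel)"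
    by (rule indep_nn_integral_pair[OF X Y ind]) measurable
  also have "\<dots> = (\<Sum>j. \<Sum>k. ennreal (pois_weight \<theta> j) * ennreal (pois_weight \<delta> k) * H (j + k))"
    by (subst ncchi2_pair) (auto simp: inner)
  also have "\<dots> = (\<Sum>N. \<Sum>j\<le>N. ennreal (pois_weight \<theta> j) * ennreal (pois_weight \<delta> (N - j)) * H (j + (N - j)))"
    by (rule suminf_diagonal_ennreal)
  also have "\<dots> = (\<Sum>N. ennreal (pois_weight (\<theta> + \<delta>) N) * H N)"
  proof (rule arg_cong[where f=suminf], rule ext)
    fix N
    have "(\<Sum>j\<le>N. ennreal (pois_weight \<theta> j) * ennreal (pois_weight \<delta> (N - j)) * H (j + (N - j)))
      = (\<Sum>j\<le>N. ennreal (pois_weight \<theta> j * pois_weight \<delta> (N - j)) * H N)"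
      by (rule sum.cong) (auto simp: ennreal_mult pois_weight_nonneg pos)
    also have "\<dots> = ennreal (pois_weight (\<theta> + \<delta>) N) * H N"
      by (simp add: pois_weight_add sum_distrib_right[symmetric] sum_ennreal pois_weight_nonneg pos)
    finally show "(\<Sum>j\<le>N. ennreal (pois_weight \<theta> j) * ennreal (pois_weight \<delta> (N - j)) * H (j + (N - j)))
      = ennreal (pois_weight (\<theta> + \<delta>) N) * H N" .
  qed
  also have "\<dots> = (\<integral>\<^sup>+x. ncchi2 (a + b) (\<theta> + \<delta>) x * indicator E x \<partial>lborel)"
  proof -
    have "ncchi2 (a + b) (\<theta> + \<delta>) x * indicator E x
       = (\<Sum>N. ennreal (pois_weight (\<theta> + \<delta>) N) * (indicator E x * ennreal (gamma_dens (a + b + real N) x)))" for x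
      by (simp add: ncchi2_def mult_ac)
    then show ?thesis by (simp add: H_def nn_integral_suminf nn_integral_cmult)
  qed
  finally show "(\<integral>\<^sup>+\<omega>. indicator E (X \<omega> + Y \<omega>) \<partial>M) = (\<integral>\<^sup>+x. ncchi2 (a + b) (\<theta> + \<delta>) x * indicator E x \<partial>lborel)" .
qed simp

text \<open>One degree of freedom, the base case. Here \<open>m\<close> is the mean, and with
  \<open>y = sqrt x\<close> the two normal densities at \<open>y\<close> and \<open>- y\<close>
  combine to a multiple of \<open>cosh (m * y)\<close>. Its Taylor terms are the Poisson-gamma terms
  because \<open>(2 j)! = 4 ^ j * pochhammer (1 / 2) j * j!\<close>.\<close>

lemma ncchi2_half:
  "ncchi2 (1 / 2) (m\<^sup>2) x = ennreal (if 0 < x then (normal_density m 1 (sqrt x) + normal_density m 1 (- sqrt x)) / (2 * sqrt x) else 0)"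
proof (cases "0 < x")
  case False
  then show ?thesis by (simp add: ncchi2_def gamma_dens_def)
next
  case True
  define y where "y = sqrt x"
  have y: "0 < y" "x = y\<^sup>2" using True by (auto simp: y_def)
  have "(\<lambda>n. if even n then (m * y) ^ n /\<^sub>R fact n else 0) sums cosh (m * y)"
    by (rule cosh_converges)
  \<comment> \<open>The odd Taylor coefficients vanish, so the series may be reindexed along the
    even numbers.\<close>
  moreover have "strict_mono (\<lambda>j::nat. 2 * j)" by (auto simp: strict_mono_def)
  moreover have "(if even n then (m * y) ^ n /\<^sub>R fact n else 0) = 0" if "n \<notin> range (\<lambda>j::nat. 2 * j)" for n
    using that by (auto elim!: evenE)
  ultimately have "(\<lambda>j. if even (2 * j) then (m * y) ^ (2 * j) /\<^sub>R fact (2 * j) else 0) sums cosh (m * y)"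
    by (subst sums_mono_reindex) auto
  then have "(\<lambda>j. (exp (- (m\<^sup>2 + x) / 2) / (sqrt (2 * pi) * y)) * ((m * y) ^ (2 * j) / fact (2 * j))) sums ((exp (- (m\<^sup>2 + x) / 2) / (sqrt (2 * pi) * y)) * cosh (m * y))"
    by (intro sums_mult) (simp add: field_simps)
  moreover have "(exp (- (m\<^sup>2 + x) / 2) / (sqrt (2 * pi) * y)) * ((m * y) ^ (2 * j) / fact (2 * j))
      = pois_weight (m\<^sup>2) j * gamma_dens (1 / 2 + real j) x" for j
  proof -
    have G: "Gamma (1 / 2 + real j) = pochhammer (1 / 2) j * sqrt pi"
    proof -
      have "(1 / 2 :: real) \<notin> \<int>\<^sub>\<le>\<^sub>0" using nonpos_Ints_nonpos[of "1/2::real"] by auto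
      from pochhammer_Gamma[OF this, of j] show ?thesis by (simp add: Gamma_one_half_real)
    qed
    have fd: "fact (2 * j) = (4::real) ^ j * pochhammer (1 / 2) j * fact j"
      using fact_double[where 'a=real, of j] by (simp add: power_mult)
    have p: "pochhammer (1 / 2 :: real) j > 0" by (rule pochhammer_pos) simp
    have x1: "x powr (1 / 2 + real j - 1) = x ^ j / y"
    proof -
      have "x powr (1 / 2 + real j - 1) = x powr (real j) * x powr (- (1 / 2))"
        by (simp add: powr_add[symmetric])
      then show ?thesis using True by (simp add: powr_realpow powr_minus powr_half_sqrt y_def field_simps)
    qed
    have x2: "2 powr (1 / 2 + real j) = sqrt 2 * (2::real) ^ j"
      by (simp add: powr_add powr_realpow powr_half_sqrt)
    have e: "exp (- (m\<^sup>2 + x) / 2) = exp (- m\<^sup>2 / 2) * exp (- x / 2)"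
      unfolding exp_add[symmetric] by (simp add: field_simps)
    have f: "(4::real) ^ j = 2 ^ j * 2 ^ j" by (simp add: power_mult_distrib[symmetric])
    have mp: "(m * y) ^ (2 * j) = (m\<^sup>2) ^ j * x ^ j"
      by (simp add: power_mult power_mult_distrib y(2))
    show ?thesis unfolding pois_weight_def gamma_dens_def G fd x1 x2 e f mp
      using True p y(1) by (simp add: real_sqrt_mult power_divide field_simps)
  qed
  ultimately have s: "(\<lambda>j. pois_weight (m\<^sup>2) j * gamma_dens (1 / 2 + real j) x) sums ((exp (- (m\<^sup>2 + x) / 2) / (sqrt (2 * pi) * y)) * cosh (m * y))"
    by simp
  have "ncchi2 (1 / 2) (m\<^sup>2) x = (\<Sum>j. ennreal (pois_weight (m\<^sup>2) j * gamma_dens (1 / 2 + real j) x))"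
    by (simp add: ncchi2_def ennreal_mult pois_weight_nonneg gamma_dens_nonneg)
  also have "\<dots> = ennreal ((exp (- (m\<^sup>2 + x) / 2) / (sqrt (2 * pi) * y)) * cosh (m * y))"
    using s by (intro suminf_ennreal_eq) (auto simp: pois_weight_nonneg gamma_dens_nonneg)
  also have "(exp (- (m\<^sup>2 + x) / 2) / (sqrt (2 * pi) * y)) * cosh (m * y)
      = (normal_density m 1 y + normal_density m 1 (- y)) / (2 * y)"
  proof -
    have "exp (- (m\<^sup>2 + x) / 2) * exp (m * y) = exp (- (y - m)\<^sup>2 / 2)"
      "exp (- (m\<^sup>2 + x) / 2) * exp (- (m * y)) = exp (- (- y - m)\<^sup>2 / 2)"
      unfolding exp_add[symmetric] by (simp_all add: y(2) power2_eq_square field_simps)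
    then show ?thesis using y(1)
      by (simp add: normal_density_def cosh_field_def field_simps)
  qed
  finally show ?thesis using True by (simp add: y_def)
qed

text \<open>Proved through the distribution function: substituting the square on
  \<open>{0..s}\<close> and reflecting the part at \<open>- x\<close> rebuilds the normal integral
  over \<open>{-s..s}\<close>.\<close>

lemma (in prob_space) normal_square_ncchi2:
  assumes X: "distributed M lborel X (normal_density m 1)"
  shows "distributed M lborel (\<lambda>\<omega>. (X \<omega>)\<^sup>2) (ncchi2 (1 / 2) (m\<^sup>2))"
proof -
  have [measurable]: "X \<in> borel_measurable M"
    using distributed_measurable[OF X] by simp
  define f where "f x = (if 0 < x then (normal_density m 1 (sqrt x) + normal_density m 1 (- sqrt x)) / (2 * sqrt x) else 0)" for x
  have [measurable]: "f \<in> borel_measurable borel" unfolding f_def[abs_def] by measurable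
  have f0: "0 \<le> f x" for x by (simp add: f_def)
  have cdf: "(\<integral>\<^sup>+x. ennreal (f x) * indicator {..c} x \<partial>lborel) = emeasure M {\<omega> \<in> space M. (X \<omega>)\<^sup>2 \<le> c}" for c
  proof (cases "0 < c")
    case False
    \<comment> \<open>For \<open>c \<le> 0\<close> the event forces \<open>X = 0\<close>, which has
      probability 0 under a normal law.\<close>
    have "{\<omega> \<in> space M. (X \<omega>)\<^sup>2 \<le> c} \<subseteq> X -` {0} \<inter> space M"
    proof
      fix \<omega> assume "\<omega> \<in> {\<omega> \<in> space M. (X \<omega>)\<^sup>2 \<le> c}"
      then have "(X \<omega>)\<^sup>2 \<le> c" "\<omega> \<in> space M" by auto
      moreover from this have "(X \<omega>)\<^sup>2 \<le> 0" using False by linarith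
      ultimately show "\<omega> \<in> X -` {0} \<inter> space M" by simp
    qed
    then have "emeasure M {\<omega> \<in> space M. (X \<omega>)\<^sup>2 \<le> c} \<le> emeasure M (X -` {0} \<inter> space M)"
      by (rule emeasure_mono) measurable
    also have "\<dots> = (\<integral>\<^sup>+x. ennreal (normal_density m 1 x) * indicator {0} x \<partial>lborel)"
      by (rule distributed_emeasure[OF X]) simp
    also have "\<dots> = 0" by simp
    finally have "emeasure M {\<omega> \<in> space M. (X \<omega>)\<^sup>2 \<le> c} = 0" by simp
    moreover have "ennreal (f x) * indicator {..c} x = 0" for x
      using False by (auto simp: f_def indicator_def)
    ultimately show ?thesis by (simp only: nn_integral_const mult_zero_left)
  next
    case True
    define s where "s = sqrt c"
    have s: "0 < s" "c = s\<^sup>2" using True by (auto simp: s_def)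
    let ?n = "normal_density m 1"
    have "(\<integral>\<^sup>+x. ennreal (f x) * indicator {..c} x \<partial>lborel) = (\<integral>\<^sup>+x. ennreal (f x) * indicator {0\<^sup>2..s\<^sup>2} x \<partial>lborel)"
      by (rule nn_integral_cong) (auto simp: f_def indicator_def s)
    also have "\<dots> = (\<integral>\<^sup>+x. ennreal (f (x\<^sup>2)) * ennreal (2 * x) * indicator {0..s} x \<partial>lborel)"
      by (rule nn_integral_substitution_aux[where g="\<lambda>x. x\<^sup>2" and g'="\<lambda>x. 2 * x"])
         (use s in \<open>auto intro!: derivative_eq_intros continuous_intros\<close>)
    also have "\<dots> = (\<integral>\<^sup>+x. ennreal (?n x) * indicator {0..s} x + ennreal (?n (- x)) * indicator {0..s} x \<partial>lborel)"
    \<comment> \<open>The point 0 is a genuine exception: the left side vanishes there, the right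
      side does not.\<close>
    proof (rule nn_integral_cong_AE)
      have "AE x in lborel. x \<noteq> (0::real)" by (rule AE_lborel_singleton)
      then show "AE x in lborel. ennreal (f (x\<^sup>2)) * ennreal (2 * x) * indicator {0..s} x
        = ennreal (?n x) * indicator {0..s} x + ennreal (?n (- x)) * indicator {0..s} x"
        by eventually_elim
           (auto simp: f_def indicator_def ennreal_mult'[symmetric] ennreal_plus[symmetric] simp del: ennreal_plus)
    qed
    also have "\<dots> = (\<integral>\<^sup>+x. ennreal (?n x) * indicator {0..s} x \<partial>lborel) + (\<integral>\<^sup>+x. ennreal (?n (- x)) * indicator {0..s} x \<partial>lborel)"
      by (rule nn_integral_add) measurable
    also have "(\<integral>\<^sup>+x. ennreal (?n (- x)) * indicator {0..s} x \<partial>lborel) = (\<integral>\<^sup>+x. ennreal (?n x) * indicator {-s..0} x \<partial>lborel)"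
    proof -
      have "(\<integral>\<^sup>+x. ennreal (?n x) * indicator {-s..0} x \<partial>lborel)
         = ennreal \<bar>-1\<bar> * (\<integral>\<^sup>+x. ennreal (?n (0 + (-1) * x)) * indicator {-s..0} (0 + (-1) * x) \<partial>lborel)"
        by (rule nn_integral_real_affine) auto
      also have "\<dots> = (\<integral>\<^sup>+x. ennreal (?n (- x)) * indicator {0..s} x \<partial>lborel)"
        by (auto intro!: nn_integral_cong simp: indicator_def)
      finally show ?thesis by simp
    qed
    also have "(\<integral>\<^sup>+x. ennreal (?n x) * indicator {0..s} x \<partial>lborel) + (\<integral>\<^sup>+x. ennreal (?n x) * indicator {-s..0} x \<partial>lborel)
        = (\<integral>\<^sup>+x. ennreal (?n x) * indicator {0..s} x + ennreal (?n x) * indicator {-s..0} x \<partial>lborel)"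
      by (rule nn_integral_add[symmetric]) measurable
    also have "\<dots> = (\<integral>\<^sup>+x. ennreal (?n x) * indicator {-s..s} x \<partial>lborel)"
    proof (rule nn_integral_cong_AE)
      have "AE x in lborel. x \<noteq> (0::real)" by (rule AE_lborel_singleton)
      then show "AE x in lborel. ennreal (?n x) * indicator {0..s} x + ennreal (?n x) * indicator {-s..0} x = ennreal (?n x) * indicator {-s..s} x"
        by eventually_elim (use s in \<open>auto simp: indicator_def\<close>)
    qed
    also have "\<dots> = emeasure M (X -` {-s..s} \<inter> space M)"
      by (rule distributed_emeasure[OF X, symmetric]) simp
    also have "X -` {-s..s} \<inter> space M = {\<omega> \<in> space M. (X \<omega>)\<^sup>2 \<le> c}"
      using s by (auto simp: abs_le_square_iff[symmetric])
    finally show ?thesis .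
  qed
  have "distributed M lborel (\<lambda>\<omega>. (X \<omega>)\<^sup>2) f"
  proof (rule distributedI_borel_atMost[where g="\<lambda>c. prob {\<omega> \<in> space M. (X \<omega>)\<^sup>2 \<le> c}"])
    fix c
    have "(\<integral>\<^sup>+x. ennreal (f x * indicator {..c} x) \<partial>lborel) = (\<integral>\<^sup>+x. ennreal (f x) * indicator {..c} x \<partial>lborel)"
      by (rule nn_integral_cong) (auto simp: indicator_def)
    then show "(\<integral>\<^sup>+x. ennreal (f x * indicator {..c} x) \<partial>lborel) = ennreal (prob {\<omega> \<in> space M. (X \<omega>)\<^sup>2 \<le> c})"
      using cdf[of c] by (simp only: emeasure_eq_measure)
  qed (auto simp: f0 emeasure_eq_measure)
  moreover have "ncchi2 (1 / 2) (m\<^sup>2) = (\<lambda>x. ennreal (f x))"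
    by (rule ext) (simp add: ncchi2_half f_def)
  ultimately show ?thesis by simp
qed

text \<open>Induction starts at a singleton, since an empty sum is constantly 0 and has no
  density.\<close>

lemma (in prob_space) sum_normal_square_ncchi2:
  assumes "finite I" "I \<noteq> {}" "indep_vars (\<lambda>_. borel) X I"
    and "\<And>i. i \<in> I \<Longrightarrow> distributed M lborel (X i) (normal_density (m i) 1)"
  shows "distributed M lborel (\<lambda>\<omega>. \<Sum>i\<in>I. (X i \<omega>)\<^sup>2) (ncchi2 (real (card I) / 2) (\<Sum>i\<in>I. (m i)\<^sup>2))"
  using assms
proof (induct I rule: finite_ne_induct)
  case (singleton i)
  then show ?case using normal_square_ncchi2[of "X i" "m i"] by simp
next
  case (insert i I)
  have ind: "indep_vars (\<lambda>_. borel) (\<lambda>i \<omega>. (X i \<omega>)\<^sup>2) (insert i I)"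
    by (rule indep_vars_compose2[OF insert.prems(1), where Y="\<lambda>_ x. x\<^sup>2"]) auto
  have "distributed M lborel (\<lambda>\<omega>. (X i \<omega>)\<^sup>2 + (\<Sum>i\<in>I. (X i \<omega>)\<^sup>2)) (ncchi2 (1 / 2 + real (card I) / 2) ((m i)\<^sup>2 + (\<Sum>i\<in>I. (m i)\<^sup>2)))"
    using insert
    by (intro ncchi2_add normal_square_ncchi2 insert indep_vars_sum[OF _ _ ind])
       (auto intro: indep_vars_subset sum_nonneg simp: card_gt_0_iff)
  then show ?case using insert by (simp add: add_divide_distrib)
qed

lemma (in prob_space) indep_var_sums:
  fixes X :: "'i \<Rightarrow> 'a \<Rightarrow> real"
  assumes ind: "indep_vars (\<lambda>_. borel) X I" and AB: "A \<inter> B = {}" "A \<subseteq> I" "B \<subseteq> I"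
  shows "indep_var borel (\<lambda>\<omega>. \<Sum>i\<in>A. X i \<omega>) borel (\<lambda>\<omega>. \<Sum>i\<in>B. X i \<omega>)"
proof -
  have "indep_var
    borel ((\<lambda>f. \<Sum>i\<in>A. f i) \<circ> (\<lambda>\<omega>. restrict (\<lambda>i. X i \<omega>) A))
    borel ((\<lambda>f. \<Sum>i\<in>B. f i) \<circ> (\<lambda>\<omega>. restrict (\<lambda>i. X i \<omega>) B))"
    by (intro indep_var_compose[OF indep_var_restrict[OF ind AB]]) auto
  also have "((\<lambda>f. \<Sum>i\<in>A. f i) \<circ> (\<lambda>\<omega>. restrict (\<lambda>i. X i \<omega>) A)) = (\<lambda>\<omega>. \<Sum>i\<in>A. X i \<omega>)"
    by (auto cong: rev_conj_cong)
  also have "((\<lambda>f. \<Sum>i\<in>B. f i) \<circ> (\<lambda>\<omega>. restrict (\<lambda>i. X i \<omega>) B)) = (\<lambda>\<omega>. \<Sum>i\<in>B. X i \<omega>)"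
    by (auto cong: rev_conj_cong)
  finally show ?thesis .
qed

section \<open>The noncentral beta density and its tail at 1\<close>

definition ncbeta_coeff :: "real \<Rightarrow> real \<Rightarrow> real \<Rightarrow> real \<Rightarrow> nat \<times> nat \<Rightarrow> real" where
  "ncbeta_coeff a b \<theta> \<delta> = (\<lambda>(j, k). pois_weight \<theta> j * pois_weight \<delta> k / Beta (a + real j) (b + real k))"

text \<open>The double series is enumerated by \<open>prod_decode\<close> as one series, the shape
  required by the Weierstrass test. The powers \<open>x powr (a - 1)\<close> and
  \<open>(1 - x) powr (b - 1)\<close> stay outside, as they may blow up at the end points.\<close>

definition ncbeta_series :: "real \<Rightarrow> real \<Rightarrow> real \<Rightarrow> real \<Rightarrow> real \<Rightarrow> real" where
  "ncbeta_series a b \<theta> \<delta> x =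
     (\<Sum>i. ncbeta_coeff a b \<theta> \<delta> (prod_decode i) * (x ^ fst (prod_decode i) * (1 - x) ^ snd (prod_decode i)))"

definition ncbeta_dens :: "real \<Rightarrow> real \<Rightarrow> real \<Rightarrow> real \<Rightarrow> real \<Rightarrow> real" where
  "ncbeta_dens a b \<theta> \<delta> x =
     (if 0 < x \<and> x < 1 then x powr (a - 1) * (1 - x) powr (b - 1) * ncbeta_series a b \<theta> \<delta> x else 0)"

section \<open>Convergence and continuity of the noncentral beta series\<close>

lemma powr_ge_quarter:
  assumes "1 / 4 \<le> x" "x \<le> 1"
  shows "(1 / 4) powr \<bar>p\<bar> \<le> x powr (p::real)"
proof (cases "0 \<le> p")
  case True
  then show ?thesis using assms by (simp add: powr_mono2)
next
  case False
  have "(1 / 4) powr \<bar>p\<bar> \<le> (1 / 4 :: real) powr 0" by (rule powr_mono') auto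
  also have "\<dots> \<le> x powr p"
    using powr_mono'[of p 0 x] assms False by simp
  finally show ?thesis .
qed

text \<open>Only the middle half \<open>{1/4..3/4}\<close> of the interval is kept, where
  \<open>t\<close> and \<open>1 - t\<close> are both at least 1/4. An exponentially small lower
  bound is good enough, because the Poisson weights decay factorially.\<close>

lemma Beta_lower_bound:
  assumes "0 < a" "0 < b"
  shows "(1 / 2) * (1 / 4) powr (\<bar>a - 1\<bar> + \<bar>b - 1\<bar>) \<le> Beta a (b::real)"
proof -
  let ?h = "\<lambda>t. t powr (a - 1) * (1 - t) powr (b - 1)"
  let ?c = "(1 / 4) powr (\<bar>a - 1\<bar> + \<bar>b - 1\<bar>) :: real"
  have int: "?h integrable_on {0..1}" "integral {0..1} ?h = Beta a b"
    using has_integral_Beta_real[OF assms] by (auto simp: has_integral_iff)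
  have int': "?h integrable_on {1/4..3/4}"
    by (rule integrable_on_subinterval[OF int(1)]) auto
  have "(1 / 2) * ?c = integral {1/4..3/4::real} (\<lambda>t. ?c)" by simp
  also have "\<dots> \<le> integral {1/4..3/4} ?h"
  proof (rule integral_le)
    fix t :: real assume "t \<in> {1/4..3/4}"
    then have "(1 / 4) powr \<bar>a - 1\<bar> * (1 / 4) powr \<bar>b - 1\<bar> \<le> ?h t"
      by (intro mult_mono powr_ge_quarter) auto
    then show "?c \<le> ?h t" by (simp add: powr_add)
  qed (use int' in auto)
  also have "\<dots> \<le> integral {0..1} ?h"
    by (rule integral_subset_le) (use int int' in auto)
  finally show ?thesis using int(2) by simp
qed

lemma ncbeta_coeff_nonneg:
  "0 < a \<Longrightarrow> 0 < b \<Longrightarrow> 0 \<le> \<theta> \<Longrightarrow> 0 \<le> \<delta> \<Longrightarrow> 0 \<le> ncbeta_coeff a b \<theta> \<delta> z"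
  by (cases z) (simp add: ncbeta_coeff_def pois_weight_nonneg Beta_pos less_imp_le)

text \<open>By \<open>|a + j - 1| \<le> |a - 1| + j\<close>, and likewise for \<open>b\<close>, the
  reciprocal beta value grows at most like \<open>4 ^ (j + k)\<close>. The majorant factors into two
  exponential series.\<close>

lemma ncbeta_coeff_bound:
  assumes "0 < a" "0 < b" "0 \<le> \<theta>" "0 \<le> \<delta>"
  shows "ncbeta_coeff a b \<theta> \<delta> (j, k) \<le>
    2 * 4 powr (\<bar>a - 1\<bar> + \<bar>b - 1\<bar>) * ((pois_weight \<theta> j * 4 ^ j) * (pois_weight \<delta> k * 4 ^ k))"
proof -
  let ?B = "Beta (a + real j) (b + real k)"
  have B: "0 < ?B" using assms by (intro Beta_pos) auto
  have "(1 / 4) powr (\<bar>a - 1\<bar> + \<bar>b - 1\<bar> + real j + real k) \<le> (1 / 4 :: real) powr (\<bar>a + real j - 1\<bar> + \<bar>b + real k - 1\<bar>)"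
    by (rule powr_mono') auto
  also have "\<dots> \<le> 2 * ?B"
    using Beta_lower_bound[of "a + real j" "b + real k"] assms by simp
  finally have "1 \<le> 2 * ?B * 4 powr (\<bar>a - 1\<bar> + \<bar>b - 1\<bar> + real j + real k)"
    by (simp add: powr_divide field_simps)
  also have "\<dots> = 2 * ?B * 4 powr (\<bar>a - 1\<bar> + \<bar>b - 1\<bar>) * 4 ^ j * 4 ^ k"
    by (simp add: powr_add powr_realpow)
  finally have "1 / ?B \<le> 2 * 4 powr (\<bar>a - 1\<bar> + \<bar>b - 1\<bar>) * 4 ^ j * 4 ^ k"
    using B by (simp add: field_simps)
  then have "pois_weight \<theta> j * pois_weight \<delta> k * (1 / ?B) \<le> pois_weight \<theta> j * pois_weight \<delta> k * (2 * 4 powr (\<bar>a - 1\<bar> + \<bar>b - 1\<bar>) * 4 ^ j * 4 ^ k)"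
    using assms by (intro mult_left_mono) (auto simp: pois_weight_nonneg)
  then show ?thesis by (simp add: ncbeta_coeff_def mult_ac)
qed

lemma summable_pois_weight_pow: "summable (\<lambda>j. pois_weight \<theta> j * c ^ j)"
proof -
  have "summable (\<lambda>j. exp (- \<theta> / 2) * (inverse (fact j) * (\<theta> / 2 * c) ^ j))"
    by (intro summable_mult summable_exp)
  then show ?thesis by (simp add: pois_weight_def power_mult_distrib field_simps)
qed

lemma suminf_prod_decode: "(\<Sum>i. f (prod_decode i)) = (\<Sum>j. \<Sum>k. f (j, k) :: ennreal)"
  by (rule suminf_ennreal_2dimen) simp

lemma summable_ncbeta_coeff:
  assumes "0 < a" "0 < b" "0 \<le> \<theta>" "0 \<le> \<delta>"
  shows "summable (\<lambda>i. ncbeta_coeff a b \<theta> \<delta> (prod_decode i))"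
proof (rule summable_suminf_not_top)
  let ?C = "2 * 4 powr (\<bar>a - 1\<bar> + \<bar>b - 1\<bar>) :: real"
  have "(\<Sum>i. ennreal (ncbeta_coeff a b \<theta> \<delta> (prod_decode i))) = (\<Sum>j. \<Sum>k. ennreal (ncbeta_coeff a b \<theta> \<delta> (j, k)))"
    by (rule suminf_prod_decode)
  also have "\<dots> \<le> (\<Sum>j. \<Sum>k. ennreal ?C * (ennreal (pois_weight \<theta> j * 4 ^ j) * ennreal (pois_weight \<delta> k * 4 ^ k)))"
    using ncbeta_coeff_bound[OF assms] assms
    by (intro suminf_le summableI allI) (auto simp: ennreal_mult[symmetric] pois_weight_nonneg intro!: ennreal_leI)
  also have "\<dots> = ennreal ?C * ((\<Sum>j. ennreal (pois_weight \<theta> j * 4 ^ j)) * (\<Sum>k. ennreal (pois_weight \<delta> k * 4 ^ k)))"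
    by simp
  also have "\<dots> < \<top>"
    using assms summable_pois_weight_pow[of \<theta> 4] summable_pois_weight_pow[of \<delta> 4]
    by (auto simp: suminf_ennreal2 pois_weight_nonneg ennreal_mult_less_top)
  finally show "(\<Sum>i. ennreal (ncbeta_coeff a b \<theta> \<delta> (prod_decode i))) \<noteq> \<top>" by simp
qed (use assms in \<open>auto intro: ncbeta_coeff_nonneg\<close>)

lemma ncbeta_term_bound:
  assumes "0 < a" "0 < b" "0 \<le> \<theta>" "0 \<le> \<delta>" "0 \<le> x" "x \<le> 1"
  shows "\<bar>ncbeta_coeff a b \<theta> \<delta> z * (x ^ j * (1 - x) ^ k)\<bar> \<le> ncbeta_coeff a b \<theta> \<delta> z"
proof -
  have "x ^ j * (1 - x) ^ k \<le> 1 * 1"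
    using assms by (intro mult_mono power_le_one) auto
  moreover have "0 \<le> x ^ j * (1 - x) ^ k" using assms by auto
  ultimately show ?thesis
    using ncbeta_coeff_nonneg[of a b \<theta> \<delta> z] assms by (auto simp: abs_mult intro!: mult_left_le)
qed

text \<open>The coefficients themselves are the majorants, as
  \<open>x ^ j * (1 - x) ^ k \<le> 1\<close>. Including the end point 1 is the purpose: it
  identifies the limit of the series as \<open>x\<close> tends to 1 with its value there.\<close>

lemma continuous_ncbeta_series:
  assumes "0 < a" "0 < b" "0 \<le> \<theta>" "0 \<le> \<delta>"
  shows "continuous_on {0..1} (ncbeta_series a b \<theta> \<delta>)"
proof -
  have "uniform_limit {0..1} (\<lambda>n x. \<Sum>i<n. ncbeta_coeff a b \<theta> \<delta> (prod_decode i) * (x ^ fst (prod_decode i) * (1 - x) ^ snd (prod_decode i)))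
      (\<lambda>x. \<Sum>i. ncbeta_coeff a b \<theta> \<delta> (prod_decode i) * (x ^ fst (prod_decode i) * (1 - x) ^ snd (prod_decode i))) sequentially"
    by (rule Weierstrass_m_test[OF _ summable_ncbeta_coeff[OF assms]])
       (use assms in \<open>auto intro!: ncbeta_term_bound\<close>)
  then show ?thesis unfolding ncbeta_series_def[abs_def]
    by (rule uniform_limit_theorem[rotated]) (auto intro!: continuous_intros always_eventually)
qed

text \<open>Bridge between the enumerated real series and the iterated nonnegative series that the
  integral computations produce.\<close>

lemma ennreal_ncbeta_series:
  assumes "0 < a" "0 < b" "0 \<le> \<theta>" "0 \<le> \<delta>" "0 \<le> x" "x \<le> 1"
  shows "ennreal (ncbeta_series a b \<theta> \<delta> x) = (\<Sum>j. \<Sum>k. ennreal (ncbeta_coeff a b \<theta> \<delta> (j, k) * (x ^ j * (1 - x) ^ k)))"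
proof -
  have "summable (\<lambda>i. ncbeta_coeff a b \<theta> \<delta> (prod_decode i) * (x ^ fst (prod_decode i) * (1 - x) ^ snd (prod_decode i)))"
    by (rule summable_comparison_test'[OF summable_ncbeta_coeff[OF assms(1-4)]])
       (use assms in \<open>auto intro!: ncbeta_term_bound\<close>)
  then have "ennreal (ncbeta_series a b \<theta> \<delta> x) = (\<Sum>i. ennreal (ncbeta_coeff a b \<theta> \<delta> (prod_decode i) * (x ^ fst (prod_decode i) * (1 - x) ^ snd (prod_decode i))))"
    unfolding ncbeta_series_def using assms
    by (intro suminf_ennreal2[symmetric] mult_nonneg_nonneg ncbeta_coeff_nonneg) auto
  also have "\<dots> = (\<Sum>j. \<Sum>k. ennreal (ncbeta_coeff a b \<theta> \<delta> (j, k) * (x ^ j * (1 - x) ^ k)))"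
    using suminf_prod_decode[of "\<lambda>(j, k). ennreal (ncbeta_coeff a b \<theta> \<delta> (j, k) * (x ^ j * (1 - x) ^ k))"]
    by (simp add: split_beta)
  finally show ?thesis .
qed

lemma ncbeta_series_nonneg:
  assumes "0 < a" "0 < b" "0 \<le> \<theta>" "0 \<le> \<delta>" "0 \<le> x" "x \<le> 1"
  shows "0 \<le> ncbeta_series a b \<theta> \<delta> x"
  unfolding ncbeta_series_def
proof (rule suminf_nonneg)
  show "summable (\<lambda>i. ncbeta_coeff a b \<theta> \<delta> (prod_decode i) * (x ^ fst (prod_decode i) * (1 - x) ^ snd (prod_decode i)))"
    by (rule summable_comparison_test'[OF summable_ncbeta_coeff[OF assms(1-4)]])
       (use assms in \<open>auto intro!: ncbeta_term_bound\<close>)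
qed (use assms in \<open>auto intro!: mult_nonneg_nonneg ncbeta_coeff_nonneg\<close>)

text \<open>At \<open>x = 1\<close> only the terms with \<open>k = 0\<close> survive, by
  \<open>0 ^ 0 = 1\<close>. The quotient \<open>Beta a b / Beta (a + j) b\<close> equals
  \<open>pochhammer (a + b) j / pochhammer a j\<close>, which is the coefficient pattern of the
  confluent hypergeometric function.\<close>

lemma ncbeta_series_1:
  assumes "0 < a" "0 < b" "0 \<le> \<theta>" "0 \<le> \<delta>"
  shows "ncbeta_series a b \<theta> \<delta> 1 = exp (- \<theta> / 2) * exp (- \<delta> / 2) / Beta a b * hyp1F1 (a + b) a (\<theta> / 2)"
proof -
  let ?c = "\<lambda>j. ncbeta_coeff a b \<theta> \<delta> (j, 0)"
  let ?K = "exp (- \<theta> / 2) * exp (- \<delta> / 2) / Beta a b"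
  let ?t = "\<lambda>j. pochhammer (a + b) j / (pochhammer a j * fact j) * (\<theta> / 2) ^ j"
  have nn: "0 \<le> ?c j" for j using assms by (intro ncbeta_coeff_nonneg)
  have "ennreal (ncbeta_series a b \<theta> \<delta> 1) = (\<Sum>j. \<Sum>k. ennreal (ncbeta_coeff a b \<theta> \<delta> (j, k) * (1 ^ j * (1 - 1) ^ k)))"
    using assms by (intro ennreal_ncbeta_series) auto
  also have "\<dots> = (\<Sum>j. ennreal (?c j))"
  proof (rule arg_cong[where f=suminf], rule ext)
    fix j
    have "(\<Sum>k. ennreal (ncbeta_coeff a b \<theta> \<delta> (j, k) * (1 ^ j * (1 - 1) ^ k)))
       = (\<Sum>k\<in>{0}. ennreal (ncbeta_coeff a b \<theta> \<delta> (j, k) * (1 ^ j * (1 - 1) ^ k)))"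
      by (rule suminf_finite) (auto simp: power_0_left)
    then show "(\<Sum>k. ennreal (ncbeta_coeff a b \<theta> \<delta> (j, k) * (1 ^ j * (1 - 1) ^ k))) = ennreal (?c j)" by simp
  qed
  finally have e: "ennreal (ncbeta_series a b \<theta> \<delta> 1) = (\<Sum>j. ennreal (?c j))" .
  have sm: "summable ?c"
    by (rule summable_suminf_not_top) (auto simp: nn e[symmetric])
  have c: "?c j = ?K * ?t j" for j
  proof -
    have ni: "a \<notin> \<int>\<^sub>\<le>\<^sub>0" "a + b \<notin> \<int>\<^sub>\<le>\<^sub>0" using assms nonpos_Ints_nonpos[of a] nonpos_Ints_nonpos[of "a + b"] by auto
    have g: "Gamma a \<noteq> 0" "Gamma b \<noteq> 0" "Gamma (a + b) \<noteq> 0"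
      by (metis assms(1,2) add_pos_pos less_irrefl Gamma_real_pos)+
    have "Gamma (a + real j) = pochhammer a j * Gamma a" "Gamma (a + b + real j) = pochhammer (a + b) j * Gamma (a + b)"
      using pochhammer_Gamma[OF ni(1), of j] pochhammer_Gamma[OF ni(2), of j] g by auto
    then show ?thesis using g pochhammer_pos[of a j] pochhammer_pos[of "a + b" j] assms
      by (simp add: ncbeta_coeff_def pois_weight_def Beta_def add_ac field_simps)
  qed
  have "?K \<noteq> 0" using Beta_pos[of a b] assms by simp
  then have st: "summable ?t" using sm unfolding c by (simp only: summable_cmult_iff) simp
  have "ncbeta_series a b \<theta> \<delta> 1 = suminf ?c"
  proof (rule ennreal_inj[THEN iffD1])
    show "ennreal (ncbeta_series a b \<theta> \<delta> 1) = ennreal (suminf ?c)"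
      unfolding e by (rule suminf_ennreal2[OF nn sm])
    show "0 \<le> ncbeta_series a b \<theta> \<delta> 1" using assms by (intro ncbeta_series_nonneg) auto
    show "0 \<le> suminf ?c" by (rule suminf_nonneg[OF sm nn])
  qed
  also have "\<dots> = ?K * hyp1F1 (a + b) a (\<theta> / 2)"
    unfolding c hyp1F1_def by (rule suminf_mult[OF st])
  finally show ?thesis .
qed

lemma ennreal_ncbeta_dens:
  assumes "0 < a" "0 < b" "0 \<le> \<theta>" "0 \<le> \<delta>"
  shows "ennreal (ncbeta_dens a b \<theta> \<delta> x) =
    (\<Sum>j. \<Sum>k. ennreal (pois_weight \<theta> j) * ennreal (pois_weight \<delta> k) * ennreal (beta_dens (a + real j) (b + real k) x))"
proof (cases "0 < x \<and> x < 1")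
  case True
  have t: "ennreal (pois_weight \<theta> j) * ennreal (pois_weight \<delta> k) * ennreal (beta_dens (a + real j) (b + real k) x)
     = ennreal (x powr (a - 1) * (1 - x) powr (b - 1)) * ennreal (ncbeta_coeff a b \<theta> \<delta> (j, k) * (x ^ j * (1 - x) ^ k))" for j k
  proof -
    have p: "x powr (a + real j - 1) = x powr (a - 1) * x ^ j" "(1 - x) powr (b + real k - 1) = (1 - x) powr (b - 1) * (1 - x) ^ k"
      using True powr_add[of x "a - 1" "real j"] powr_add[of "1 - x" "b - 1" "real k"] by (simp_all add: powr_realpow algebra_simps)
    have "pois_weight \<theta> j * pois_weight \<delta> k * beta_dens (a + real j) (b + real k) x
      = x powr (a - 1) * (1 - x) powr (b - 1) * (ncbeta_coeff a b \<theta> \<delta> (j, k) * (x ^ j * (1 - x) ^ k))"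
      using True by (simp add: beta_dens_def ncbeta_coeff_def p)
    then show ?thesis using assms True
      by (simp add: ennreal_mult[symmetric] pois_weight_nonneg beta_dens_nonneg ncbeta_coeff_nonneg)
  qed
  have "ennreal (ncbeta_dens a b \<theta> \<delta> x) = ennreal (x powr (a - 1) * (1 - x) powr (b - 1)) * ennreal (ncbeta_series a b \<theta> \<delta> x)"
    using True by (simp add: ncbeta_dens_def ennreal_mult')
  then show ?thesis using assms True by (simp add: t ennreal_ncbeta_series)
next
  case False
  then have "beta_dens a' b' x = 0" for a' b' by (auto simp: beta_dens_def)
  then show ?thesis using False by (auto simp: ncbeta_dens_def)
qed

lemma ncbeta_dens_nonneg:
  assumes "0 < a" "0 < b" "0 \<le> \<theta>" "0 \<le> \<delta>"
  shows "0 \<le> ncbeta_dens a b \<theta> \<delta> x"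
  using ncbeta_series_nonneg[OF assms, of x] by (simp add: ncbeta_dens_def)

lemma ncbeta_dens_measurable [measurable]: "ncbeta_dens a b \<theta> \<delta> \<in> borel_measurable borel"
  unfolding ncbeta_dens_def[abs_def] ncbeta_series_def by measurable

text \<open>In the coordinates \<open>(s, x)\<close> the ratio is \<open>x\<close> wherever the
  gamma factor is nonzero, so that factor integrates to 1 and a Poisson mixture of beta laws
  remains.\<close>

lemma (in prob_space) ratio_distributed:
  assumes X: "distributed M lborel X (ncchi2 a \<theta>)" and Y: "distributed M lborel Y (ncchi2 b \<delta>)"
    and ind: "indep_var borel X borel Y"
    and pos: "0 < a" "0 < b" "0 \<le> \<theta>" "0 \<le> \<delta>"
  shows "distributed M lborel (\<lambda>\<omega>. X \<omega> / (X \<omega> + Y \<omega>)) (\<lambda>x. ennreal (ncbeta_dens a b \<theta> \<delta> x))"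
proof (rule distributed_lborelI)
  have [measurable]: "X \<in> borel_measurable M" "Y \<in> borel_measurable M"
    using distributed_measurable[OF X] distributed_measurable[OF Y] by simp_all
  show "(\<lambda>\<omega>. X \<omega> / (X \<omega> + Y \<omega>)) \<in> borel_measurable M" by measurable
next
  fix E :: "real set" assume E [measurable]: "E \<in> sets borel"
  have inner: "(\<integral>\<^sup>+u. \<integral>\<^sup>+v. indicator E (u / (u + v)) * (ennreal (gamma_dens (a + real j) u) * ennreal (gamma_dens (b + real k) v)) \<partial>lborel \<partial>lborel)
      = (\<integral>\<^sup>+x. indicator E x * ennreal (beta_dens (a + real j) (b + real k) x) \<partial>lborel)" for j k
  proof -
    have "(\<integral>\<^sup>+u. \<integral>\<^sup>+v. (\<lambda>(u, v). indicator E (u / (u + v))) (u, v) * (ennreal (gamma_dens (a + real j) u) * ennreal (gamma_dens (b + real k) v)) \<partial>lborel \<partial>lborel)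
      = (\<integral>\<^sup>+s. \<integral>\<^sup>+x. (\<lambda>(u, v). indicator E (u / (u + v))) (s * x, s * (1 - x)) * (ennreal (gamma_dens (a + real j + (b + real k)) s) * ennreal (beta_dens (a + real j) (b + real k) x)) \<partial>lborel \<partial>lborel)"
      by (rule gamma_dens_pair) (use pos in auto)
    also have "\<dots> = (\<integral>\<^sup>+s. ennreal (gamma_dens (a + real j + (b + real k)) s) * (\<integral>\<^sup>+x. indicator E x * ennreal (beta_dens (a + real j) (b + real k) x) \<partial>lborel) \<partial>lborel)"
    proof (rule nn_integral_cong)
      fix s :: real
      show "(\<integral>\<^sup>+x. (\<lambda>(u, v). indicator E (u / (u + v))) (s * x, s * (1 - x)) * (ennreal (gamma_dens (a + real j + (b + real k)) s) * ennreal (beta_dens (a + real j) (b + real k) x)) \<partial>lborel)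
         = ennreal (gamma_dens (a + real j + (b + real k)) s) * (\<integral>\<^sup>+x. indicator E x * ennreal (beta_dens (a + real j) (b + real k) x) \<partial>lborel)"
      proof (cases "0 < s")
        case True
        then have "s * x / (s * x + s * (1 - x)) = x" for x by (simp add: field_simps)
        then show ?thesis by (subst nn_integral_cmult[symmetric]) (auto simp: mult_ac)
      next
        case False
        then show ?thesis by (simp add: gamma_dens_def)
      qed
    qed
    also have "\<dots> = (\<integral>\<^sup>+x. indicator E x * ennreal (beta_dens (a + real j) (b + real k) x) \<partial>lborel)"
      using pos by (simp add: nn_integral_multc nn_integral_gamma_dens)
    finally show ?thesis by simp
  qed
  have "(\<integral>\<^sup>+\<omega>. indicator E (X \<omega> / (X \<omega> + Y \<omega>)) \<partial>M) = (\<integral>\<^sup>+\<omega>. (\<lambda>(u, v). indicator E (u / (u + v))) (X \<omega>, Y \<omega>) \<partial>M)" by simp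
  also have "\<dots> = (\<integral>\<^sup>+u. \<integral>\<^sup>+v. (\<lambda>(u, v). indicator E (u / (u + v))) (u, v) * (ncchi2 a \<theta> u * ncchi2 b \<delta> v) \<partial>lborel \<partial>lborel)"
    by (rule indep_nn_integral_pair[OF X Y ind]) measurable
  also have "\<dots> = (\<Sum>j. \<Sum>k. ennreal (pois_weight \<theta> j) * ennreal (pois_weight \<delta> k) *
      (\<integral>\<^sup>+x. indicator E x * ennreal (beta_dens (a + real j) (b + real k) x) \<partial>lborel))"
    by (subst ncchi2_pair) (auto simp: inner)
  also have "\<dots> = (\<integral>\<^sup>+x. ennreal (ncbeta_dens a b \<theta> \<delta> x) * indicator E x \<partial>lborel)"
  proof -
    have "ennreal (ncbeta_dens a b \<theta> \<delta> x) * indicator E x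
       = (\<Sum>j. \<Sum>k. ennreal (pois_weight \<theta> j) * ennreal (pois_weight \<delta> k) * (indicator E x * ennreal (beta_dens (a + real j) (b + real k) x)))" for x
      by (simp add: ennreal_ncbeta_dens[OF pos] mult_ac)
    then show ?thesis by (simp only:) (simp add: nn_integral_suminf nn_integral_cmult)
  qed
  finally show "(\<integral>\<^sup>+\<omega>. indicator E (X \<omega> / (X \<omega> + Y \<omega>)) \<partial>M) = (\<integral>\<^sup>+x. ennreal (ncbeta_dens a b \<theta> \<delta> x) * indicator E x \<partial>lborel)" .
qed simp

section \<open>Tail asymptotics at the right end point\<close>

lemma nn_integral_powr_tail:
  assumes b: "0 < (b::real)" and r: "r < 1"
  shows "(\<integral>\<^sup>+x. ennreal ((1 - x) powr (b - 1)) * indicator {r<..<1} x \<partial>lborel) = ennreal ((1 - r) powr b / b)"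
proof -
  have "((\<lambda>x. x powr (b - 1)) has_integral ((1 - r) powr (b - 1 + 1) / (b - 1 + 1))) {0..1 - r}"
    by (rule has_integral_powr_from_0) (use assms in auto)
  then have "(\<integral>\<^sup>+x. ennreal (x powr (b - 1)) * indicator {0..1 - r} x \<partial>lborel) = ennreal ((1 - r) powr (b - 1 + 1) / (b - 1 + 1))"
    by (intro nn_integral_has_integral_lebesgue') auto
  moreover have "(\<integral>\<^sup>+x. ennreal ((1 - x) powr (b - 1)) * indicator {r<..<1} x \<partial>lborel)
     = ennreal \<bar>-1\<bar> * (\<integral>\<^sup>+x. ennreal ((1 - (1 + (-1) * x)) powr (b - 1)) * indicator {r<..<1} (1 + (-1) * x) \<partial>lborel)"
    by (rule nn_integral_real_affine) auto
  moreover have "(\<integral>\<^sup>+x. ennreal ((1 - (1 + (-1) * x)) powr (b - 1)) * indicator {r<..<1} (1 + (-1) * x) \<partial>lborel)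
     = (\<integral>\<^sup>+x. ennreal (x powr (b - 1)) * indicator {0..1 - r} x \<partial>lborel)"
  proof (rule nn_integral_cong_AE)
    have "AE x in lborel. x \<noteq> (0::real)" "AE x in lborel. x \<noteq> 1 - r" by (rule AE_lborel_singleton)+
    then show "AE x in lborel. ennreal ((1 - (1 + (-1) * x)) powr (b - 1)) * indicator {r<..<1} (1 + (-1) * x)
        = ennreal (x powr (b - 1)) * indicator {0..1 - r} x"
      by eventually_elim (auto simp: indicator_def)
  qed
  ultimately show ?thesis by simp
qed

text \<open>Near 1 the factor \<open>q\<close> lies between \<open>c - d\<close> and
  \<open>c + d\<close>, so the tail is squeezed between multiples of the explicit integral
  \<open>(1 - r) powr b / b\<close>. No differentiation of the tail is involved.\<close>

lemma (in prob_space) tail_limit: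
  assumes R: "distributed M lborel R (\<lambda>x. ennreal (f x))"
    and f: "\<And>x. 0 < x \<Longrightarrow> x < 1 \<Longrightarrow> f x = (1 - x) powr (b - 1) * q x" "\<And>x. 1 \<le> x \<Longrightarrow> f x = 0"
    and q: "(q \<longlongrightarrow> c) (at_left 1)" and c: "0 \<le> c" and b: "0 < b"
  shows "((\<lambda>r. measure M {\<omega> \<in> space M. R \<omega> > r} / (1 - r) powr b) \<longlongrightarrow> c / b) (at_left 1)"
proof (rule tendstoI)
  fix e :: real assume e: "0 < e"
  \<comment> \<open>Chosen so that the final error \<open>d / b\<close> is
    \<open>e / 2\<close>.\<close>
  define d where "d = e * b / 2"
  have d: "0 < d" using e b by (simp add: d_def)
  have "eventually (\<lambda>x. dist (q x) c < d) (at_left 1)" using q d by (rule tendstoD)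
  then obtain \<rho> where \<rho>: "\<rho> < 1" "\<And>x. \<rho> < x \<Longrightarrow> x < 1 \<Longrightarrow> \<bar>q x - c\<bar> < d"
    using eventually_at_left[of 0 "1::real"] by (auto simp: dist_real_def)
  have ev: "eventually (\<lambda>r. max 0 \<rho> < r \<and> r < 1) (at_left (1::real))"
    using eventually_at_left_field[of "\<lambda>r. max 0 \<rho> < r \<and> r < 1" "1::real"] \<rho>(1) by (auto intro!: exI[of _ "max 0 \<rho>"])
  then show "eventually (\<lambda>r. dist (measure M {\<omega> \<in> space M. R \<omega> > r} / (1 - r) powr b) (c / b) < e) (at_left 1)"
  proof eventually_elim
    case (elim r)
    have r: "0 < r" "\<rho> < r" "r < 1" using elim by auto
    let ?P = "measure M {\<omega> \<in> space M. R \<omega> > r}"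
    let ?I = "(1 - r) powr b / b"
    have "{\<omega> \<in> space M. R \<omega> > r} = R -` {r<..} \<inter> space M" by auto
    then have "ennreal ?P = (\<integral>\<^sup>+x. ennreal (f x) * indicator {r<..} x \<partial>lborel)"
      using distributed_emeasure[OF R, of "{r<..}"] by (simp add: emeasure_eq_measure)
    also have "\<dots> = (\<integral>\<^sup>+x. ennreal ((1 - x) powr (b - 1) * q x) * indicator {r<..<1} x \<partial>lborel)"
      by (rule nn_integral_cong) (use r f in \<open>auto simp: indicator_def\<close>)
    finally have P: "ennreal ?P = (\<integral>\<^sup>+x. ennreal ((1 - x) powr (b - 1) * q x) * indicator {r<..<1} x \<partial>lborel)" .
    have c1: "(\<integral>\<^sup>+x. ennreal k * (ennreal ((1 - x) powr (b - 1)) * indicator {r<..<1} x) \<partial>lborel) = ennreal (k * ?I)" for k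
    proof -
      have "(\<integral>\<^sup>+x. ennreal k * (ennreal ((1 - x) powr (b - 1)) * indicator {r<..<1} x) \<partial>lborel) = ennreal k * ennreal ?I"
        unfolding nn_integral_powr_tail[OF b r(3), symmetric] by (rule nn_integral_cmult) measurable
      moreover have "0 \<le> ?I" using b by simp
      ultimately show ?thesis by (simp only: ennreal_mult'')
    qed
    have "ennreal ?P \<le> (\<integral>\<^sup>+x. ennreal (c + d) * (ennreal ((1 - x) powr (b - 1)) * indicator {r<..<1} x) \<partial>lborel)"
      unfolding P
    proof (rule nn_integral_mono)
      fix x
      show "ennreal ((1 - x) powr (b - 1) * q x) * indicator {r<..<1} x \<le> ennreal (c + d) * (ennreal ((1 - x) powr (b - 1)) * indicator {r<..<1} x)"
        using \<rho>(2)[of x] r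
        by (auto simp: indicator_def ennreal_mult''[symmetric] mult.commute[of "c + d"] intro!: ennreal_leI mult_left_mono)
    qed
    moreover have "(\<integral>\<^sup>+x. ennreal (c - d) * (ennreal ((1 - x) powr (b - 1)) * indicator {r<..<1} x) \<partial>lborel) \<le> ennreal ?P"
      unfolding P
    proof (rule nn_integral_mono)
      fix x
      show "ennreal (c - d) * (ennreal ((1 - x) powr (b - 1)) * indicator {r<..<1} x) \<le> ennreal ((1 - x) powr (b - 1) * q x) * indicator {r<..<1} x"
        using \<rho>(2)[of x] r
        by (auto simp: indicator_def ennreal_mult''[symmetric] mult.commute[of "c - d"] intro!: ennreal_leI mult_left_mono)
    qed
    ultimately have u: "ennreal ?P \<le> ennreal ((c + d) * ?I)" and l: "ennreal ((c - d) * ?I) \<le> ennreal ?P"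
      unfolding c1 by auto
    have I: "0 < ?I" using b r by simp
    \<comment> \<open>This holds even if \<open>c - d\<close> is negative: \<open>ennreal\<close>
      then truncates the lower bound to 0, and the comparison needs only
      \<open>0 \<le> ?P\<close>.\<close>
    have l': "(c - d) * ?I \<le> ?P" using l by (simp add: ennreal_le_iff)
    have u': "?P \<le> (c + d) * ?I"
    proof -
      have "0 \<le> (c + d) * ?I" using I c d by (intro mult_nonneg_nonneg) auto
      then show ?thesis using u by (simp add: ennreal_le_iff)
    qed
    have "\<bar>?P - c * ?I\<bar> \<le> d * ?I" using l' u' unfolding distrib_right left_diff_distrib by linarith
    then have "\<bar>?P - c * ?I\<bar> / (1 - r) powr b \<le> d / b"
      using r b by (simp add: field_simps)
    moreover have "\<bar>?P / (1 - r) powr b - c / b\<bar> = \<bar>?P - c * ?I\<bar> / (1 - r) powr b"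
    proof -
      have "?P / (1 - r) powr b - c / b = (?P - c * ?I) / (1 - r) powr b"
        using r b by (simp add: field_simps)
      then show ?thesis by simp
    qed
    moreover have "d / b < e" using e b by (simp add: d_def)
    ultimately show ?case by (simp add: dist_real_def)
  qed
qed

section \<open>The saddlepoint equation\<close>

text \<open>The c.g.f. of \<open>(1 - r) U - r V\<close>. Since \<open>a\<close> and
  \<open>b\<close> are half the degrees of freedom, \<open>1 - 2 * s * (1 - r)\<close> and
  \<open>1 + 2 * s * r\<close> are the factors \<open>1 - 2 s \<lambda>\<close> for the two
  eigenvalues \<open>1 - r\<close> and \<open>- r\<close>.\<close>

definition qf_cgf :: "real \<Rightarrow> real \<Rightarrow> real \<Rightarrow> real \<Rightarrow> real \<Rightarrow> real \<Rightarrow> real" where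
  "qf_cgf a b \<theta> \<delta> r s = - a * ln (1 - 2 * s * (1 - r)) - b * ln (1 + 2 * s * r)
     + \<theta> * (s * (1 - r)) / (1 - 2 * s * (1 - r)) - \<delta> * (s * r) / (1 + 2 * s * r)"

definition qf_cgf1 :: "real \<Rightarrow> real \<Rightarrow> real \<Rightarrow> real \<Rightarrow> real \<Rightarrow> real \<Rightarrow> real" where
  "qf_cgf1 a b \<theta> \<delta> r s = 2 * a * (1 - r) / (1 - 2 * s * (1 - r)) - 2 * b * r / (1 + 2 * s * r)
     + \<theta> * (1 - r) / (1 - 2 * s * (1 - r))\<^sup>2 - \<delta> * r / (1 + 2 * s * r)\<^sup>2"

definition qf_cgf2 :: "real \<Rightarrow> real \<Rightarrow> real \<Rightarrow> real \<Rightarrow> real \<Rightarrow> real \<Rightarrow> real" where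
  "qf_cgf2 a b \<theta> \<delta> r s = 4 * a * (1 - r)\<^sup>2 / (1 - 2 * s * (1 - r))\<^sup>2 + 4 * b * r\<^sup>2 / (1 + 2 * s * r)\<^sup>2
     + 4 * \<theta> * (1 - r)\<^sup>2 / (1 - 2 * s * (1 - r)) ^ 3 + 4 * \<delta> * r\<^sup>2 / (1 + 2 * s * r) ^ 3"

text \<open>The lower end is spelled \<open>1 / (2 * - r)\<close> to match the interval in
  \<open>saddlepoint\<close> once \<open>lam 0 = - r\<close> is known.\<close>

definition cgf_dom :: "real \<Rightarrow> real set" where
  "cgf_dom r = {1 / (2 * - r) <..< 1 / (2 * (1 - r))}"

lemma cgf_dom_iff:
  assumes "0 < r" "r < 1"
  shows "s \<in> cgf_dom r \<longleftrightarrow> 0 < 1 - 2 * s * (1 - r) \<and> 0 < 1 + 2 * s * r"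
  using assms by (auto simp: cgf_dom_def field_simps)

lemma qf_cgf_deriv:
  assumes "0 < r" "r < 1" "s \<in> cgf_dom r"
  shows "(qf_cgf a b \<theta> \<delta> r has_real_derivative qf_cgf1 a b \<theta> \<delta> r s) (at s)"
proof -
  define P Q where "P = 1 - 2 * s * (1 - r)" and "Q = 1 + 2 * s * r"
  have PQ: "0 < P" "0 < Q" using assms by (auto simp: cgf_dom_iff P_def Q_def)
  \<comment> \<open>Eliminating \<open>s\<close> from the numerators turns the remaining goal into a
    rational identity in \<open>P\<close>, \<open>Q\<close> and \<open>r\<close>.\<close>
  have e: "(s * (1 - r)) = (1 - P) / 2" "s * r = (Q - 1) / 2" by (simp_all add: P_def Q_def)
  show ?thesis unfolding qf_cgf_def[abs_def]
    apply (rule derivative_eq_intros refl | (use PQ in \<open>simp add: P_def Q_def; fail\<close>))+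
    unfolding qf_cgf1_def P_def[symmetric] Q_def[symmetric] e
    using PQ by (simp add: divide_simps power2_eq_square) (simp add: algebra_simps)
qed

lemma qf_cgf1_deriv:
  assumes "0 < r" "r < 1" "s \<in> cgf_dom r"
  shows "(qf_cgf1 a b \<theta> \<delta> r has_real_derivative qf_cgf2 a b \<theta> \<delta> r s) (at s)"
proof -
  define P Q where "P = 1 - 2 * s * (1 - r)" and "Q = 1 + 2 * s * r"
  have PQ: "0 < P" "0 < Q" using assms by (auto simp: cgf_dom_iff P_def Q_def)
  show ?thesis unfolding qf_cgf1_def[abs_def]
    apply (rule derivative_eq_intros refl | (use PQ in \<open>simp add: P_def Q_def; fail\<close>))+
    unfolding qf_cgf2_def P_def[symmetric] Q_def[symmetric]
    using PQ by (simp add: divide_simps power2_eq_square power3_eq_cube) (simp add: algebra_simps)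
qed

lemma qf_cgf2_pos:
  assumes "0 < r" "r < 1" "s \<in> cgf_dom r" "0 < a" "0 \<le> b" "0 \<le> \<theta>" "0 \<le> \<delta>"
  shows "0 < qf_cgf2 a b \<theta> \<delta> r s"
proof -
  have "0 < 1 - 2 * s * (1 - r)" "0 < 1 + 2 * s * r" using assms by (auto simp: cgf_dom_iff)
  then show ?thesis using assms unfolding qf_cgf2_def
    by (intro add_pos_nonneg divide_pos_pos divide_nonneg_nonneg mult_nonneg_nonneg mult_pos_pos) auto
qed

text \<open>The moment generating function is controlled on the open interval only, but derivatives
  are local. For the second derivative the first must be known at all points of the interval, not
  only at \<open>s\<close>.\<close>

lemma
  assumes K: "\<And>s. s \<in> cgf_dom r \<Longrightarrow> K s = qf_cgf a b \<theta> \<delta> r s" and r: "0 < r" "r < 1" and s: "s \<in> cgf_dom r"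
  shows deriv_qf_cgf: "deriv K s = qf_cgf1 a b \<theta> \<delta> r s"
    and deriv2_qf_cgf: "(deriv ^^ 2) K s = qf_cgf2 a b \<theta> \<delta> r s"
proof -
  have op: "open (cgf_dom r)" by (simp add: cgf_dom_def)
  have 1: "deriv K s = qf_cgf1 a b \<theta> \<delta> r s" if "s \<in> cgf_dom r" for s
    by (rule DERIV_imp_deriv, rule has_field_derivative_transform_within_open[OF qf_cgf_deriv[OF r that] op that])
       (simp add: K)
  show "deriv K s = qf_cgf1 a b \<theta> \<delta> r s" by (rule 1) fact
  have "deriv (deriv K) s = qf_cgf2 a b \<theta> \<delta> r s"
    by (rule DERIV_imp_deriv, rule has_field_derivative_transform_within_open[OF qf_cgf1_deriv[OF r s] op s])
       (simp add: 1)
  then show "(deriv ^^ 2) K s = qf_cgf2 a b \<theta> \<delta> r s" by (simp add: numeral_2_eq_2)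
qed

text \<open>Strict convexity: \<open>qf_cgf2\<close> is positive, so \<open>qf_cgf1\<close> is
  strictly increasing on the interval.\<close>

lemma qf_cgf1_root_unique:
  assumes r: "0 < r" "r < 1" and p: "0 < a" "0 \<le> b" "0 \<le> \<theta>" "0 \<le> \<delta>"
    and "s \<in> cgf_dom r" "s' \<in> cgf_dom r" "qf_cgf1 a b \<theta> \<delta> r s = 0" "qf_cgf1 a b \<theta> \<delta> r s' = 0"
  shows "s = s'"
proof -
  have False if "x < y" "x \<in> cgf_dom r" "y \<in> cgf_dom r" "qf_cgf1 a b \<theta> \<delta> r x = 0" "qf_cgf1 a b \<theta> \<delta> r y = 0" for x y
  proof -
    have "qf_cgf1 a b \<theta> \<delta> r x < qf_cgf1 a b \<theta> \<delta> r y"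
    proof (rule DERIV_pos_imp_increasing[OF that(1)])
      fix z assume "x \<le> z" "z \<le> y"
      then have z: "z \<in> cgf_dom r" using that by (auto simp: cgf_dom_def)
      show "\<exists>d. (qf_cgf1 a b \<theta> \<delta> r has_real_derivative d) (at z) \<and> 0 < d"
        using qf_cgf1_deriv[OF r z] qf_cgf2_pos[OF r z p] by blast
    qed
    then show False using that by simp
  qed
  then show ?thesis using assms by (metis linorder_neqE_linordered_idom)
qed

section \<open>The limiting saddlepoint equation and its root\<close>

text \<open>The rescaled saddlepoint equation in the variable \<open>t = s (1 - r)\<close>.\<close>

definition saddle_eq :: "real \<Rightarrow> real \<Rightarrow> real \<Rightarrow> real \<Rightarrow> real \<Rightarrow> real \<Rightarrow> real" where
  "saddle_eq a b \<theta> \<delta> r t = 2 * a / (1 - 2 * t) - 2 * b * r / (1 - r + 2 * t * r)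
     + \<theta> / (1 - 2 * t)\<^sup>2 - \<delta> * r * (1 - r) / (1 - r + 2 * t * r)\<^sup>2"

text \<open>The factor \<open>1 - r\<close> is positive, so signs and roots carry over between the
  two forms.\<close>

lemma qf_cgf1_scaled:
  assumes "0 < r" "r < 1" "0 < t" "t < 1 / 2"
  shows "qf_cgf1 a b \<theta> \<delta> r (t / (1 - r)) = (1 - r) * saddle_eq a b \<theta> \<delta> r t"
proof -
  define e D where "e = 1 - r" and "D = e + 2 * t * r"
  have e: "0 < e" "0 < D" using assms by (auto simp: e_def D_def intro!: add_pos_pos)
  have 1: "2 * (t / e) * e = 2 * t" "1 + 2 * (t / e) * r = D / e" using e by (auto simp: field_simps D_def)
  show ?thesis
    unfolding qf_cgf1_def saddle_eq_def e_def[symmetric] D_def[symmetric] 1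
    using e assms by (simp add: divide_simps power2_eq_square) (simp add: algebra_simps)
qed

lemma saddle_eq_limit:
  assumes "0 < t" "t < 1 / 2"
  shows "((\<lambda>r. saddle_eq a b \<theta> \<delta> r t) \<longlongrightarrow> 2 * a / (1 - 2 * t) - b / t + \<theta> / (1 - 2 * t)\<^sup>2) (at_left 1)"
proof -
  have "((\<lambda>r. saddle_eq a b \<theta> \<delta> r t) \<longlongrightarrow> 2 * a / (1 - 2 * t) - 2 * b * 1 / (1 - 1 + 2 * t * 1)
     + \<theta> / (1 - 2 * t)\<^sup>2 - \<delta> * 1 * (1 - 1) / (1 - 1 + 2 * t * 1)\<^sup>2) (at_left 1)"
    unfolding saddle_eq_def by (intro tendsto_intros) (use assms in auto)
  then show ?thesis by simp
qed

text \<open>The constant \<open>t0\<close> of the theorem, written with \<open>m = 2 * a\<close> and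
  \<open>n = 2 * (a + b)\<close>.\<close>

definition saddle_limit :: "real \<Rightarrow> real \<Rightarrow> real \<Rightarrow> real" where
  "saddle_limit a b \<theta> = 1 / 2 + 1 / (8 * (a + b)) * ((\<theta> - 2 * a) - sqrt ((\<theta> - 2 * a)\<^sup>2 + 8 * \<theta> * (a + b)))"

text \<open>In \<open>y = 1 - 2 * t\<close>, clearing denominators in the limiting equation gives
  \<open>2 * (a + b) * y\<^sup>2 - (2 * a - \<theta>) * y - \<theta> = 0\<close>, and
  \<open>saddle_limit\<close> corresponds to its larger root. The bounds on \<open>t\<close> amount
  to \<open>0 < y < 1\<close>.\<close>

lemma saddle_limit_props:
  assumes "0 < a" "0 < b" "0 \<le> \<theta>"
  defines "t \<equiv> saddle_limit a b \<theta>"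
  shows "0 < t" "t < 1 / 2" "2 * a / (1 - 2 * t) - b / t + \<theta> / (1 - 2 * t)\<^sup>2 = 0"
proof -
  define q where "q = sqrt ((\<theta> - 2 * a)\<^sup>2 + 8 * \<theta> * (a + b))"
  define y where "y = 1 - 2 * t"
  have q2: "q\<^sup>2 = (\<theta> - 2 * a)\<^sup>2 + 8 * \<theta> * (a + b)" and q0: "0 \<le> q"
    using assms by (auto simp: q_def)
  have yq: "4 * (a + b) * y = (2 * a - \<theta>) + q"
    unfolding y_def t_def saddle_limit_def q_def[symmetric] using assms by (simp add: field_simps)
  have ypos: "0 < y"
  \<comment> \<open>The strict inequality \<open>|\<theta> - 2 * a| < q\<close> of the other case
    degenerates to an equality here; instead \<open>q = 2 * a\<close> is computed directly.\<close>
  proof (cases "\<theta> = 0")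
    case True
    then have "q = 2 * a" using assms by (simp add: q_def real_sqrt_mult)
    then have "0 < 4 * (a + b) * y" using yq True assms by simp
    then show ?thesis using assms by (simp add: zero_less_mult_iff)
  next
    case False
    then have "(\<theta> - 2 * a)\<^sup>2 < q\<^sup>2" unfolding q2 using assms by simp
    then have "\<bar>\<theta> - 2 * a\<bar> < q" using q0 by (metis power2_abs power2_less_imp_less)
    then have "0 < 4 * (a + b) * y" using yq by simp
    then show ?thesis using assms by (simp add: zero_less_mult_iff)
  qed
  have y1: "y < 1"
  proof -
    \<comment> \<open>By \<open>yq\<close>, the bound \<open>y < 1\<close> is equivalent to
      \<open>q < 4 * (a + b) - 2 * a + \<theta>\<close>; both sides are nonnegative, so squares are
      compared.\<close>
    have "q\<^sup>2 < (4 * (a + b) - 2 * a + \<theta>)\<^sup>2"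
    proof -
      have "(4 * (a + b) - 2 * a + \<theta>)\<^sup>2 - q\<^sup>2 = 16 * (a + b) * b"
        unfolding q2 by (simp add: power2_eq_square algebra_simps)
      then show ?thesis using assms by (smt (verit) mult_pos_pos)
    qed
    then have "q < 4 * (a + b) - 2 * a + \<theta>"
      by (rule power2_less_imp_less) (use assms in auto)
    then have "4 * (a + b) * y < 4 * (a + b) * 1" using yq by simp
    then show ?thesis using assms by (simp add: mult_less_cancel_left)
  qed
  have quad: "2 * (a + b) * y\<^sup>2 - (2 * a - \<theta>) * y - \<theta> = 0"
  proof -
    have "q\<^sup>2 = (4 * (a + b) * y - (2 * a - \<theta>))\<^sup>2" using yq by simp
    then have "8 * (a + b) * (2 * (a + b) * y\<^sup>2 - (2 * a - \<theta>) * y - \<theta>) = 0"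
      unfolding q2 by (simp add: power2_eq_square algebra_simps)
    then show ?thesis using assms by simp
  qed
  show t: "0 < t" "t < 1 / 2" using ypos y1 by (auto simp: y_def)
  have ty: "t = (1 - y) / 2" by (simp add: y_def)
  have "2 * a / y - b / t + \<theta> / y\<^sup>2 = (2 * a * y * (1 - y) - 2 * b * y\<^sup>2 + \<theta> * (1 - y)) / (y\<^sup>2 * (1 - y))"
    unfolding ty using ypos y1 by (simp add: divide_simps power2_eq_square) (simp add: algebra_simps)
  also have "2 * a * y * (1 - y) - 2 * b * y\<^sup>2 + \<theta> * (1 - y) = 0"
    using quad by (simp add: power2_eq_square algebra_simps)
  finally show "2 * a / (1 - 2 * t) - b / t + \<theta> / (1 - 2 * t)\<^sup>2 = 0" by (simp add: y_def)
qed

text \<open>Gives the limiting equation opposite signs on the two sides of its root.\<close>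

lemma saddle_limit_eq_mono:
  assumes "0 < a" "0 < b" "0 \<le> \<theta>" "0 < t" "t < t'" "t' < (1::real) / 2"
  shows "2 * a / (1 - 2 * t) - b / t + \<theta> / (1 - 2 * t)\<^sup>2 < 2 * a / (1 - 2 * t') - b / t' + \<theta> / (1 - 2 * t')\<^sup>2"
proof -
  have "2 * a / (1 - 2 * t) < 2 * a / (1 - 2 * t')" using assms by (intro divide_strict_left_mono) auto
  moreover have "b / t' < b / t" using assms by (intro divide_strict_left_mono) auto
  moreover have "\<theta> / (1 - 2 * t)\<^sup>2 \<le> \<theta> / (1 - 2 * t')\<^sup>2"
    using assms by (intro divide_left_mono power_mono) auto
  ultimately show ?thesis by simp
qed

text \<open>The limiting root is bracketed by \<open>t1 < t2\<close>, where the limiting equation is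
  strictly negative and strictly positive. Convergence at these two points alone preserves the signs
  for \<open>r\<close> near 1, and the intermediate value theorem gives a root between them; no
  uniform convergence is required.\<close>

lemma saddlepoint_near_limit:
  assumes p: "0 < a" "0 < b" "0 \<le> \<theta>" "0 \<le> \<delta>" and \<eta>: "0 < \<eta>"
  shows "eventually (\<lambda>r. \<exists>s\<in>cgf_dom r. qf_cgf1 a b \<theta> \<delta> r s = 0 \<and> \<bar>s * (1 - r) - saddle_limit a b \<theta>\<bar> < \<eta>) (at_left 1)"
proof -
  let ?t = "saddle_limit a b \<theta>"
  note t = saddle_limit_props[OF p(1-3)]
  \<comment> \<open>Keeps \<open>t1\<close> and \<open>t2\<close> inside the interval from 0 to 1/2
    and closer than \<open>\<eta>\<close> to the limit.\<close>
  define d where "d = min (\<eta> / 2) (min (?t / 2) ((1 / 2 - ?t) / 2))"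
  have d: "0 < d" "d < \<eta>" "d < ?t" "d < 1 / 2 - ?t" using \<eta> t(1,2) by (auto simp: d_def min_def)
  define t1 t2 where "t1 = ?t - d" and "t2 = ?t + d"
  have t12: "0 < t1" "t1 < ?t" "?t < t2" "t2 < 1 / 2" using d by (auto simp: t1_def t2_def)
  have "2 * a / (1 - 2 * t1) - b / t1 + \<theta> / (1 - 2 * t1)\<^sup>2 < 0"
    using saddle_limit_eq_mono[of a b \<theta> t1 ?t] t12 t p by simp
  then have e1: "eventually (\<lambda>r. saddle_eq a b \<theta> \<delta> r t1 < 0) (at_left 1)"
    using order_tendstoD(2)[OF saddle_eq_limit[of t1]] t12 by auto
  have "0 < 2 * a / (1 - 2 * t2) - b / t2 + \<theta> / (1 - 2 * t2)\<^sup>2"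
    using saddle_limit_eq_mono[of a b \<theta> ?t t2] t12 t p by simp
  then have e2: "eventually (\<lambda>r. 0 < saddle_eq a b \<theta> \<delta> r t2) (at_left 1)"
    using order_tendstoD(1)[OF saddle_eq_limit[of t2]] t12 by auto
  have e3: "eventually (\<lambda>r. 0 < r \<and> r < (1::real)) (at_left 1)"
    using eventually_at_left_1[of "\<lambda>r. 0 < r \<and> r < 1"] by simp
  from e1 e2 e3 show ?thesis
  proof eventually_elim
    case (elim r)
    then have r: "0 < r" "r < 1" by auto
    have dom: "s \<in> cgf_dom r" if "t1 / (1 - r) \<le> s" "s \<le> t2 / (1 - r)" for s
    proof -
      have "0 < t1 / (1 - r)" using t12 r by simp
      then have s: "0 < s" using that(1) by (rule less_le_trans)
      have "1 / (2 * - r) < 0" using r by simp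
      then have "1 / (2 * - r) < s" using s by (rule less_trans)
      moreover have "s < 1 / (2 * (1 - r))"
      proof (rule le_less_trans[OF that(2)])
        show "t2 / (1 - r) < 1 / (2 * (1 - r))"
          using divide_strict_right_mono[of t2 "1 / 2" "1 - r"] t12 r by simp
      qed
      ultimately show ?thesis by (simp add: cgf_dom_def)
    qed
    have "qf_cgf1 a b \<theta> \<delta> r (t1 / (1 - r)) \<le> 0" "0 \<le> qf_cgf1 a b \<theta> \<delta> r (t2 / (1 - r))"
      using qf_cgf1_scaled[of r t1] qf_cgf1_scaled[of r t2] t12 r elim
      by (auto simp: mult_le_0_iff zero_le_mult_iff)
    moreover have "t1 / (1 - r) \<le> t2 / (1 - r)" using t12 r by (intro divide_right_mono) auto
    moreover have "isCont (qf_cgf1 a b \<theta> \<delta> r) s" if "t1 / (1 - r) \<le> s" "s \<le> t2 / (1 - r)" for s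
      by (rule DERIV_isCont[OF qf_cgf1_deriv[OF r dom[OF that]]])
    ultimately obtain s where s: "t1 / (1 - r) \<le> s" "s \<le> t2 / (1 - r)" "qf_cgf1 a b \<theta> \<delta> r s = 0"
      using IVT[of "qf_cgf1 a b \<theta> \<delta> r" "t1 / (1 - r)" 0 "t2 / (1 - r)"] by auto
    then have "t1 \<le> s * (1 - r)" "s * (1 - r) \<le> t2" using r by (auto simp: field_simps)
    then have "\<bar>s * (1 - r) - ?t\<bar> < \<eta>" using d by (auto simp: t1_def t2_def)
    then show ?case using s dom by blast
  qed
qed

text \<open>Mills' bound: for \<open>x > w\<close> the integrand is at most \<open>x / w\<close>
  times itself, and \<open>x\<close> times the normal density has minus the density as
  antiderivative.\<close>

lemma normal_upper_tail_bound:
  assumes "0 < w"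
  shows "0 \<le> 1 - cdf std_normal_distribution w" "1 - cdf std_normal_distribution w \<le> std_normal_density w / w"
proof -
  interpret N: real_distribution std_normal_distribution by (rule real_dist_normal_dist)
  show "0 \<le> 1 - cdf std_normal_distribution w" using N.cdf_bounded_prob by simp
  have "measure std_normal_distribution (UNIV - {..w}) = 1 - cdf std_normal_distribution w"
    using N.prob_compl[of "{..w}"] by (simp add: cdf_def)
  moreover have "UNIV - {..w} = {w<..}" by auto
  ultimately have "ennreal (1 - cdf std_normal_distribution w) = emeasure std_normal_distribution {w<..}"
    by (simp add: N.emeasure_eq_measure)
  also have "\<dots> = (\<integral>\<^sup>+x. ennreal (std_normal_density x) * indicator {w<..} x \<partial>lborel)"
    by (simp add: emeasure_density)
  also have "\<dots> \<le> (\<integral>\<^sup>+x. ennreal (x / w * std_normal_density x) * indicator {w..} x \<partial>lborel)"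
  proof (rule nn_integral_mono)
    fix x
    have "std_normal_density x \<le> x / w * std_normal_density x" if "w < x"
      using that assms mult_right_mono[of 1 "x / w" "std_normal_density x"] by simp
    then show "ennreal (std_normal_density x) * indicator {w<..} x \<le> ennreal (x / w * std_normal_density x) * indicator {w..} x"
      by (auto simp: indicator_def intro!: ennreal_leI)
  qed
  also have "\<dots> = ennreal (0 - (- std_normal_density w / w))"
  proof (rule nn_integral_FTC_atLeast[where F="\<lambda>x. - std_normal_density x / w"])
    fix x assume "w \<le> x"
    show "((\<lambda>x. - std_normal_density x / w) has_real_derivative x / w * std_normal_density x) (at x)"
      unfolding std_normal_density_def[abs_def] using assms
      by (auto intro!: derivative_eq_intros simp: field_simps)
    show "0 \<le> x / w * std_normal_density x" using \<open>w \<le> x\<close> assms by simp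
  next
    have "(std_normal_density \<longlongrightarrow> 0) at_top"
      unfolding std_normal_density_def[abs_def] by real_asymp
    then show "((\<lambda>x. - std_normal_density x / w) \<longlongrightarrow> 0) at_top"
      using assms by (auto intro!: tendsto_eq_intros)
  qed simp
  finally show "1 - cdf std_normal_distribution w \<le> std_normal_density w / w"
    using assms by (subst (asm) ennreal_le_iff) auto
qed

section \<open>Limits of the saddlepoint quantities\<close>

text \<open>The limit of the saddlepoint m.g.f. divided by \<open>(1 - r) powr b\<close>. The term
  \<open>- \<delta> / 2\<close> is what \<open>- \<delta> * (s * r) / (1 + 2 * s * r)\<close>
  becomes as \<open>s\<close> tends to infinity.\<close>

definition saddle_mgf :: "real \<Rightarrow> real \<Rightarrow> real \<Rightarrow> real \<Rightarrow> real \<Rightarrow> real" where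
  "saddle_mgf a b \<theta> \<delta> t = (1 - 2 * t) powr (- a) * (2 * t) powr (- b) * exp (\<theta> * t / (1 - 2 * t) - \<delta> / 2)"

definition saddle_u :: "real \<Rightarrow> real \<Rightarrow> real \<Rightarrow> real \<Rightarrow> real" where
  "saddle_u a b \<theta> t = sqrt (b + 2 * t\<^sup>2 * (2 * a / (1 - 2 * t)\<^sup>2 + 2 * \<theta> / (1 - 2 * t) ^ 3))"

text \<open>The function \<open>s\<close> is required to solve the saddlepoint equation only
  eventually, because a root has been found only for \<open>r\<close> near 1.\<close>

locale saddle_family =
  fixes a b \<theta> \<delta> :: real and s :: "real \<Rightarrow> real"
  assumes ab: "0 < a" "0 < b" and nc: "0 \<le> \<theta>" "0 \<le> \<delta>"
    and root: "eventually (\<lambda>r. s r \<in> cgf_dom r \<and> qf_cgf1 a b \<theta> \<delta> r (s r) = 0) (at_left 1)"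
begin

abbreviation "t0 \<equiv> saddle_limit a b \<theta>"

lemmas t0_props = saddle_limit_props[OF ab nc(1)]

lemma near_1: "eventually (\<lambda>r. 0 < r \<and> r < (1::real)) (at_left 1)"
  using eventually_at_left_1[of "\<lambda>r. 0 < r \<and> r < 1"] by simp

lemma scaled_saddle_limit: "((\<lambda>r. s r * (1 - r)) \<longlongrightarrow> t0) (at_left 1)"
proof (rule tendstoI)
  fix \<eta> :: real assume "0 < \<eta>"
  from saddlepoint_near_limit[OF ab nc this] root near_1
  show "eventually (\<lambda>r. dist (s r * (1 - r)) t0 < \<eta>) (at_left 1)"
  proof eventually_elim
    case (elim r)
    from elim(1) obtain s' where s': "s' \<in> cgf_dom r" "qf_cgf1 a b \<theta> \<delta> r s' = 0" "\<bar>s' * (1 - r) - t0\<bar> < \<eta>"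
      by blast
    \<comment> \<open>By uniqueness, the root found near the limit is the given one.\<close>
    have "s' = s r"
      by (rule qf_cgf1_root_unique[of r a b \<theta> \<delta>, OF _ _ ab(1) less_imp_le[OF ab(2)] nc s'(1) _ s'(2)])
         (use elim(2,3) in blast)+
    then show ?case using s' by (simp add: dist_real_def)
  qed
qed

lemma scaled_saddle_range: "eventually (\<lambda>r. 0 < s r * (1 - r) \<and> s r * (1 - r) < 1 / 2) (at_left 1)"
  using order_tendstoD(1)[OF scaled_saddle_limit t0_props(1)] order_tendstoD(2)[OF scaled_saddle_limit t0_props(2)]
  by eventually_elim simp

lemma saddle_pos: "eventually (\<lambda>r. 0 < s r) (at_left 1)"
  using scaled_saddle_range near_1 by eventually_elim (auto simp: zero_less_mult_iff)

lemma one_minus_limit: "((\<lambda>r. 1 - r) \<longlongrightarrow> (0::real)) (at_left 1)"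
  by (auto intro!: tendsto_eq_intros)

lemma denom_limit: "((\<lambda>r. 1 - r + 2 * (s r * (1 - r)) * r) \<longlongrightarrow> 2 * t0) (at_left 1)"
  by (rule tendsto_eq_intros scaled_saddle_limit refl | simp)+

text \<open>With \<open>t = s * (1 - r)\<close> the factor \<open>1 + 2 * s * r\<close> equals
  \<open>D / (1 - r)\<close>, where \<open>D\<close> tends to \<open>2 * t0\<close>. Its power
  \<open>- b\<close> is the only source of \<open>(1 - r) powr b\<close>; everything else
  converges.\<close>

lemma mgf_limit: "((\<lambda>r. exp (qf_cgf a b \<theta> \<delta> r (s r)) / (1 - r) powr b) \<longlongrightarrow> saddle_mgf a b \<theta> \<delta> t0) (at_left 1)"
proof -
  let ?t = "\<lambda>r. s r * (1 - r)"
  let ?D = "\<lambda>r. 1 - r + 2 * (s r * (1 - r)) * r"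
  let ?G = "\<lambda>r. (1 - 2 * ?t r) powr (- a) * ?D r powr (- b) * exp (\<theta> * ?t r / (1 - 2 * ?t r) - \<delta> * (?t r * r) / ?D r)"
  have "(?G \<longlongrightarrow> (1 - 2 * t0) powr (- a) * (2 * t0) powr (- b) * exp (\<theta> * t0 / (1 - 2 * t0) - \<delta> * (t0 * 1) / (2 * t0))) (at_left 1)"
    by (intro tendsto_intros scaled_saddle_limit denom_limit) (use t0_props in auto)
  then have lim: "(?G \<longlongrightarrow> saddle_mgf a b \<theta> \<delta> t0) (at_left 1)"
    using t0_props by (simp add: saddle_mgf_def)
  have "eventually (\<lambda>r. ?G r = exp (qf_cgf a b \<theta> \<delta> r (s r)) / (1 - r) powr b) (at_left 1)"
    using scaled_saddle_range near_1
  proof eventually_elim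
    case (elim r)
    define e D where "e = 1 - r" and "D = ?D r"
    have e: "0 < e" using elim by (simp add: e_def)
    have D: "0 < D" using elim by (auto simp: D_def intro!: add_pos_pos mult_pos_pos)
    have 1: "1 + 2 * s r * r = D / e" using e by (simp add: D_def e_def field_simps)
    have 2: "s r * r = (s r * e * r) / e" using e by simp
    have 3: "0 < 1 - 2 * (s r * e)" using elim by (simp add: e_def)
    have "exp (qf_cgf a b \<theta> \<delta> r (s r)) = exp (- a * ln (1 - 2 * (s r * e)) + - b * ln (D / e)
      + (\<theta> * (s r * e) / (1 - 2 * (s r * e)) - \<delta> * (s r * r) / (D / e)))"
      unfolding qf_cgf_def 1 e_def[symmetric] by (simp add: mult.assoc)
    also have "\<dots> = (1 - 2 * (s r * e)) powr (- a) * (D / e) powr (- b) * exp (\<theta> * (s r * e) / (1 - 2 * (s r * e)) - \<delta> * (s r * r) / (D / e))"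
      unfolding exp_add using 3 D e by (simp add: powr_def)
    also have "(D / e) powr (- b) = D powr (- b) * e powr b"
      using D e by (simp add: powr_divide powr_minus field_simps)
    also have "\<delta> * (s r * r) / (D / e) = \<delta> * (s r * e * r) / D"
      using D e by (simp add: field_simps)
    finally have "exp (qf_cgf a b \<theta> \<delta> r (s r)) / e powr b = (1 - 2 * (s r * e)) powr (- a) * D powr (- b) * exp (\<theta> * (s r * e) / (1 - 2 * (s r * e)) - \<delta> * (s r * e * r) / D)"
      using e by simp
    then show ?case by (simp add: e_def D_def)
  qed
  with lim show ?thesis by (rule Lim_transform_eventually)
qed

text \<open>Absorbing \<open>s\<^sup>2\<close> into the second derivative turns
  \<open>s * (1 - r)\<close> into \<open>t\<close> and \<open>s * r / (1 + 2 * s * r)\<close> into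
  \<open>t * r / D\<close>, with limit 1/2. Hence the \<open>b\<close> term tends to
  \<open>b\<close>, while the \<open>\<delta>\<close> term keeps a factor \<open>1 - r\<close> and
  vanishes.\<close>

lemma curvature_limit:
  "((\<lambda>r. s r * sqrt (qf_cgf2 a b \<theta> \<delta> r (s r))) \<longlongrightarrow> saddle_u a b \<theta> t0) (at_left 1)"
proof -
  let ?t = "\<lambda>r. s r * (1 - r)"
  let ?D = "\<lambda>r. 1 - r + 2 * (s r * (1 - r)) * r"
  let ?G = "\<lambda>r. 4 * a * (?t r)\<^sup>2 / (1 - 2 * ?t r)\<^sup>2 + 4 * b * (?t r * r)\<^sup>2 / (?D r)\<^sup>2
     + 4 * \<theta> * (?t r)\<^sup>2 / (1 - 2 * ?t r) ^ 3 + 4 * \<delta> * (?t r * r)\<^sup>2 * (1 - r) / ?D r ^ 3"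
  have "((\<lambda>r. sqrt (?G r)) \<longlongrightarrow> sqrt (4 * a * t0\<^sup>2 / (1 - 2 * t0)\<^sup>2 + 4 * b * (t0 * 1)\<^sup>2 / (2 * t0)\<^sup>2
     + 4 * \<theta> * t0\<^sup>2 / (1 - 2 * t0) ^ 3 + 4 * \<delta> * (t0 * 1)\<^sup>2 * 0 / (2 * t0) ^ 3)) (at_left 1)"
    by (intro tendsto_intros scaled_saddle_limit denom_limit one_minus_limit) (use t0_props in auto)
  also have "4 * a * t0\<^sup>2 / (1 - 2 * t0)\<^sup>2 + 4 * b * (t0 * 1)\<^sup>2 / (2 * t0)\<^sup>2
     + 4 * \<theta> * t0\<^sup>2 / (1 - 2 * t0) ^ 3 + 4 * \<delta> * (t0 * 1)\<^sup>2 * 0 / (2 * t0) ^ 3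
     = b + 2 * t0\<^sup>2 * (2 * a / (1 - 2 * t0)\<^sup>2 + 2 * \<theta> / (1 - 2 * t0) ^ 3)"
    using t0_props(1) by (simp add: power_mult_distrib distrib_left mult_ac)
  finally have lim: "((\<lambda>r. sqrt (?G r)) \<longlongrightarrow> saddle_u a b \<theta> t0) (at_left 1)"
    by (simp add: saddle_u_def)
  have "eventually (\<lambda>r. sqrt (?G r) = s r * sqrt (qf_cgf2 a b \<theta> \<delta> r (s r))) (at_left 1)"
    using scaled_saddle_range near_1 saddle_pos
  proof eventually_elim
    case (elim r)
    define e D where "e = 1 - r" and "D = e + 2 * (s r * e) * r"
    have e: "0 < e" using elim by (simp add: e_def)
    have D: "0 < D" using elim by (auto simp: D_def e_def intro!: add_pos_pos mult_pos_pos)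
    have 1: "1 + 2 * s r * r = D / e" using e by (simp add: D_def e_def field_simps)
    have "(s r)\<^sup>2 * qf_cgf2 a b \<theta> \<delta> r (s r) = ?G r"
      unfolding qf_cgf2_def 1 e_def[symmetric] D_def[symmetric]
      using e D by (simp add: power_divide power_mult_distrib distrib_left mult.assoc) (simp add: power2_eq_square power3_eq_cube mult_ac)
    then have "sqrt (?G r) = sqrt ((s r)\<^sup>2) * sqrt (qf_cgf2 a b \<theta> \<delta> r (s r))"
      by (simp only: real_sqrt_mult[symmetric])
    then show ?case using elim by simp
  qed
  with lim show ?thesis by (rule Lim_transform_eventually)
qed

lemma saddle_u_pos: "0 < saddle_u a b \<theta> t0"
  using t0_props ab nc unfolding saddle_u_def
  by (auto intro!: add_pos_nonneg mult_nonneg_nonneg add_nonneg_nonneg divide_nonneg_nonneg)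

lemma saddle_mgf_pos: "0 < saddle_mgf a b \<theta> \<delta> t0"
  using t0_props by (simp add: saddle_mgf_def)

text \<open>The parenthesis is \<open>J\<close> for \<open>H\<close> the identity. In the limit only
  the terms in \<open>a\<close> and \<open>\<theta>\<close> remain, and the equation satisfied by
  \<open>t0\<close> says that they add up to \<open>b / t0\<close>.\<close>

lemma jacobian_limit:
  "((\<lambda>r. (1 - r) * s r * (2 * a / (1 - 2 * s r * (1 - r)) + 2 * b / (1 + 2 * s r * r)
      + \<theta> / (1 - 2 * s r * (1 - r))\<^sup>2 + \<delta> / (1 + 2 * s r * r)\<^sup>2)) \<longlongrightarrow> b) (at_left 1)"
proof -
  let ?t = "\<lambda>r. s r * (1 - r)"
  let ?D = "\<lambda>r. 1 - r + 2 * (s r * (1 - r)) * r"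
  let ?G = "\<lambda>r. ?t r * (2 * a / (1 - 2 * ?t r) + 2 * b * (1 - r) / ?D r
     + \<theta> / (1 - 2 * ?t r)\<^sup>2 + \<delta> * (1 - r)\<^sup>2 / (?D r)\<^sup>2)"
  have "(?G \<longlongrightarrow> t0 * (2 * a / (1 - 2 * t0) + 2 * b * 0 / (2 * t0) + \<theta> / (1 - 2 * t0)\<^sup>2 + \<delta> * 0\<^sup>2 / (2 * t0)\<^sup>2)) (at_left 1)"
    by (intro tendsto_intros scaled_saddle_limit denom_limit one_minus_limit) (use t0_props in auto)
  also have "t0 * (2 * a / (1 - 2 * t0) + 2 * b * 0 / (2 * t0) + \<theta> / (1 - 2 * t0)\<^sup>2 + \<delta> * 0\<^sup>2 / (2 * t0)\<^sup>2) = b"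
  proof -
    have "2 * a / (1 - 2 * t0) + \<theta> / (1 - 2 * t0)\<^sup>2 = b / t0" using t0_props(3) by linarith
    then show ?thesis using t0_props(1) by simp
  qed
  finally have lim: "(?G \<longlongrightarrow> b) (at_left 1)" .
  have "eventually (\<lambda>r. ?G r = (1 - r) * s r * (2 * a / (1 - 2 * s r * (1 - r)) + 2 * b / (1 + 2 * s r * r)
      + \<theta> / (1 - 2 * s r * (1 - r))\<^sup>2 + \<delta> / (1 + 2 * s r * r)\<^sup>2)) (at_left 1)"
    using scaled_saddle_range near_1
  proof eventually_elim
    case (elim r)
    define e D where "e = 1 - r" and "D = e + 2 * (s r * e) * r"
    have e: "0 < e" using elim by (simp add: e_def)
    have D: "0 < D" using elim by (auto simp: D_def e_def intro!: add_pos_pos mult_pos_pos)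
    have 1: "1 + 2 * s r * r = D / e" using e by (simp add: D_def e_def field_simps)
    show ?case unfolding 1 e_def[symmetric] D_def[symmetric]
      using e D by (simp add: power_divide mult_ac)
  qed
  with lim show ?thesis by (rule Lim_transform_eventually)
qed

lemma exp_cgf_limit_0: "((\<lambda>r. exp (qf_cgf a b \<theta> \<delta> r (s r))) \<longlongrightarrow> 0) (at_left 1)"
proof -
  have "((\<lambda>r. (1 - r) powr b) \<longlongrightarrow> 0) (at_left 1)"
    using ab near_1 by (intro tendsto_zero_powrI[OF one_minus_limit tendsto_const]) (auto elim!: eventually_mono)
  from tendsto_mult[OF mgf_limit this]
  have "((\<lambda>r. exp (qf_cgf a b \<theta> \<delta> r (s r)) / (1 - r) powr b * (1 - r) powr b) \<longlongrightarrow> 0) (at_left 1)" by simp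
  then show ?thesis
    by (rule Lim_transform_eventually) (use near_1 in \<open>auto elim!: eventually_mono\<close>)
qed

text \<open>Since \<open>w\<^sup>2 = - 2 K\<close>, the normal density at \<open>w\<close> is
  exactly \<open>exp K / sqrt (2 * pi)\<close>. Factoring it out leaves Mills' ratio minus
  \<open>1 / w\<close> plus \<open>1 / u\<close>, of which only \<open>1 / u\<close> has a nonzero
  limit.\<close>

lemma lugannani_rice_limit:
  defines "w \<equiv> \<lambda>r. sgn (s r) * sqrt (- 2 * qf_cgf a b \<theta> \<delta> r (s r))"
    and "u \<equiv> \<lambda>r. s r * sqrt (qf_cgf2 a b \<theta> \<delta> r (s r))"
  shows "((\<lambda>r. (1 - (cdf std_normal_distribution (w r) + std_normal_density (w r) * (inverse (w r) - inverse (u r)))) / (1 - r) powr b)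
     \<longlongrightarrow> saddle_mgf a b \<theta> \<delta> t0 / (sqrt (2 * pi) * saddle_u a b \<theta> t0)) (at_left 1)"
proof -
  let ?E = "\<lambda>r. exp (qf_cgf a b \<theta> \<delta> r (s r))"
  let ?m = "\<lambda>r. (1 - cdf std_normal_distribution (w r)) / std_normal_density (w r)"
  have w_top: "filterlim w at_top (at_left 1)"
    unfolding filterlim_at_top
  proof
    fix Z :: real
    \<comment> \<open>In terms of the exponent this says \<open>Z\<^sup>2 < - 2 K\<close>, which
      bounds \<open>w\<close> below by \<open>Z\<close>.\<close>
    have "eventually (\<lambda>r. ?E r < exp (- Z\<^sup>2 / 2)) (at_left 1)"
      by (rule order_tendstoD(2)[OF exp_cgf_limit_0]) simp
    with saddle_pos show "eventually (\<lambda>r. Z \<le> w r) (at_left 1)"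
    proof eventually_elim
      case (elim r)
      then have "Z\<^sup>2 \<le> - 2 * qf_cgf a b \<theta> \<delta> r (s r)" by simp
      then have "\<bar>Z\<bar> \<le> sqrt (- 2 * qf_cgf a b \<theta> \<delta> r (s r))"
        by (metis real_sqrt_abs real_sqrt_le_iff)
      then show ?case using elim by (simp add: w_def)
    qed
  qed
  then have w_pos: "eventually (\<lambda>r. 0 < w r) (at_left 1)"
    by (simp add: filterlim_at_top_dense)
  have iw: "((\<lambda>r. inverse (w r)) \<longlongrightarrow> 0) (at_left 1)"
    using w_top by (rule tendsto_inverse_0_at_top)
  have "(?m \<longlongrightarrow> 0) (at_left 1)"
  proof (rule tendsto_sandwich[OF _ _ tendsto_const iw])
    show "eventually (\<lambda>r. 0 \<le> ?m r) (at_left 1)"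
      using w_pos by eventually_elim (auto intro!: divide_nonneg_nonneg normal_upper_tail_bound)
    show "eventually (\<lambda>r. ?m r \<le> inverse (w r)) (at_left 1)"
      using w_pos
    proof eventually_elim
      case (elim r)
      have "0 < std_normal_density (w r)" by (rule normal_density_pos) simp
      then show ?case using normal_upper_tail_bound(2)[OF elim] by (simp add: field_simps)
    qed
  qed
  moreover have "(u \<longlongrightarrow> saddle_u a b \<theta> t0) (at_left 1)"
    unfolding u_def by (rule curvature_limit)
  ultimately have "((\<lambda>r. (?E r / (1 - r) powr b) / sqrt (2 * pi) * (?m r - inverse (w r) + inverse (u r)))
      \<longlongrightarrow> saddle_mgf a b \<theta> \<delta> t0 / sqrt (2 * pi) * (0 - 0 + inverse (saddle_u a b \<theta> t0))) (at_left 1)"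
    using saddle_u_pos by (intro tendsto_intros mgf_limit iw) auto
  then have lim: "((\<lambda>r. (?E r / (1 - r) powr b) / sqrt (2 * pi) * (?m r - inverse (w r) + inverse (u r)))
      \<longlongrightarrow> saddle_mgf a b \<theta> \<delta> t0 / (sqrt (2 * pi) * saddle_u a b \<theta> t0)) (at_left 1)"
    by (simp add: field_simps)
  \<comment> \<open>This makes \<open>K\<close> negative, so that the square root in
    \<open>w\<close> has a positive argument and \<open>w\<^sup>2 = - 2 K\<close> is
    legitimate.\<close>
  have neg: "eventually (\<lambda>r. ?E r < 1) (at_left 1)"
    by (rule order_tendstoD(2)[OF exp_cgf_limit_0]) simp
  have "eventually (\<lambda>r. (?E r / (1 - r) powr b) / sqrt (2 * pi) * (?m r - inverse (w r) + inverse (u r))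
     = (1 - (cdf std_normal_distribution (w r) + std_normal_density (w r) * (inverse (w r) - inverse (u r)))) / (1 - r) powr b) (at_left 1)"
    using neg saddle_pos
  proof eventually_elim
    case (elim r)
    have "(w r)\<^sup>2 = - 2 * qf_cgf a b \<theta> \<delta> r (s r)" using elim by (simp add: w_def)
    then have phi: "std_normal_density (w r) = ?E r / sqrt (2 * pi)"
      by (simp add: std_normal_density_def)
    have pos: "0 < std_normal_density (w r)" by (rule normal_density_pos) simp
    have "1 - (cdf std_normal_distribution (w r) + std_normal_density (w r) * (inverse (w r) - inverse (u r)))
       = std_normal_density (w r) * (?m r - inverse (w r) + inverse (u r))"
    proof -
      have "std_normal_density (w r) * ?m r = 1 - cdf std_normal_distribution (w r)" using pos by simp
      then show ?thesis unfolding distrib_left right_diff_distrib by simp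
    qed
    then show ?case by (simp add: phi)
  qed
  with lim show ?thesis by (rule Lim_transform_eventually)
qed

end

section \<open>Spectral decompositions and moment generating functions\<close>

lemma mat_diag_mult_vec_index:
  assumes "x \<in> carrier_vec n" "i < n"
  shows "(mat_diag n d *\<^sub>v x) $ i = d i * x $ i"
proof -
  have "(mat_diag n d *\<^sub>v x) $ i = (\<Sum>j<n. (if i = j then d j else 0) * x $ j)"
    using assms by (simp add: mat_diag_def scalar_prod_def atLeast0LessThan)
  also have "\<dots> = (\<Sum>j<n. if i = j then d j * x $ j else 0)"
    by (rule sum.cong) auto
  also have "\<dots> = d i * x $ i" using assms by simp
  finally show ?thesis .
qed

lemma quad_form_mat_diag:
  assumes "x \<in> carrier_vec n"
  shows "quad_form (mat_diag n d) x = (\<Sum>i<n. d i * (x $ i)\<^sup>2)"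
proof -
  have "dim_vec (mat_diag n d *\<^sub>v x) = n" by (simp add: mat_diag_def)
  then have "quad_form (mat_diag n d) x = (\<Sum>i<n. x $ i * (mat_diag n d *\<^sub>v x) $ i)"
    by (simp add: quad_form_def scalar_prod_def atLeast0LessThan)
  also have "\<dots> = (\<Sum>i<n. d i * (x $ i)\<^sup>2)"
    using assms by (intro sum.cong) (auto simp: mat_diag_mult_vec_index power2_eq_square)
  finally show ?thesis .
qed

text \<open>Multiplying the decomposition by \<open>P\<close> gives
  \<open>P * mat_diag n d = mat_diag n lam * P\<close>, so a nonzero entry at \<open>(i, j)\<close>
  forces \<open>lam i = d j\<close>. Together with orthonormal rows and columns this is all that is
  needed of a \<open>P\<close> that repeated eigenvalues leave undetermined.\<close>

lemma spectral_decomp_entries: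
  assumes dec: "ordered_spectral_decomp n (mat_diag n d) P lam"
  shows "\<And>i j. i < n \<Longrightarrow> j < n \<Longrightarrow> lam i * P $$ (i, j) = d j * P $$ (i, j)"
    and "\<And>i k. i < n \<Longrightarrow> k < n \<Longrightarrow> (\<Sum>j<n. P $$ (i, j) * P $$ (k, j)) = (if i = k then 1 else 0)"
    and "\<And>j k. j < n \<Longrightarrow> k < n \<Longrightarrow> (\<Sum>i<n. P $$ (i, j) * P $$ (i, k)) = (if j = k then 1 else 0)"
proof -
  have P: "P \<in> carrier_mat n n" and PPt: "P * transpose_mat P = 1\<^sub>m n" and PtP: "transpose_mat P * P = 1\<^sub>m n"
    and S: "mat_diag n d = transpose_mat P * mat_diag n lam * P"
    using dec by (auto simp: ordered_spectral_decomp_def)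
  have Pt: "transpose_mat P \<in> carrier_mat n n" using P by simp
  have D: "mat_diag n lam \<in> carrier_mat n n" by simp
  have DP: "mat_diag n lam * P \<in> carrier_mat n n" by (rule mult_carrier_mat[OF D P])
  have "P * mat_diag n d = P * (transpose_mat P * (mat_diag n lam * P))"
    unfolding S using assoc_mult_mat[OF Pt D P] by simp
  also have "\<dots> = P * transpose_mat P * (mat_diag n lam * P)"
    using assoc_mult_mat[OF P Pt DP] by simp
  also have "\<dots> = mat_diag n lam * P" unfolding PPt by (rule left_mult_one_mat[OF DP])
  finally have eq: "P * mat_diag n d = mat_diag n lam * P" .
  show "lam i * P $$ (i, j) = d j * P $$ (i, j)" if "i < n" "j < n" for i j
    using arg_cong[OF eq, of "\<lambda>A. A $$ (i, j)"] that
    by (auto simp: mat_diag_mult_left[OF P] mat_diag_mult_right[OF P])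
  show "(\<Sum>j<n. P $$ (i, j) * P $$ (k, j)) = (if i = k then 1 else 0)" if "i < n" "k < n" for i k
    using arg_cong[OF PPt, of "\<lambda>A. A $$ (i, k)"] that P
    by (simp add: scalar_prod_def atLeast0LessThan)
  show "(\<Sum>i<n. P $$ (i, j) * P $$ (i, k)) = (if j = k then 1 else 0)" if "j < n" "k < n" for j k
    using arg_cong[OF PtP, of "\<lambda>A. A $$ (j, k)"] that P
    by (simp add: scalar_prod_def atLeast0LessThan)
qed

text \<open>An orthogonal matrix has neither a zero row nor a zero column, so each
  \<open>lam i\<close> meets some \<open>d j\<close> and conversely.\<close>

lemma spectral_decomp_range:
  assumes dec: "ordered_spectral_decomp n (mat_diag n d) P lam"
  shows "lam ` {..<n} = d ` {..<n}"
proof -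
  note E = spectral_decomp_entries[OF dec]
  have row: "\<exists>j<n. P $$ (i, j) \<noteq> 0" if "i < n" for i
  proof (rule ccontr)
    assume "\<not> (\<exists>j<n. P $$ (i, j) \<noteq> 0)"
    then have "(\<Sum>j<n. P $$ (i, j) * P $$ (i, j)) = 0" by simp
    then show False using E(2)[OF that that] by simp
  qed
  have col: "\<exists>i<n. P $$ (i, j) \<noteq> 0" if "j < n" for j
  proof (rule ccontr)
    assume "\<not> (\<exists>i<n. P $$ (i, j) \<noteq> 0)"
    then have "(\<Sum>i<n. P $$ (i, j) * P $$ (i, j)) = 0" by simp
    then show False using E(3)[OF that that] by simp
  qed
  have lam_eq: "lam i = d j" if "i < n" "j < n" "P $$ (i, j) \<noteq> 0" for i j
    using E(1)[OF that(1,2)] that(3) by simp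
  show ?thesis
  proof (intro equalityI subsetI)
    fix x assume "x \<in> lam ` {..<n}"
    then obtain i where i: "i < n" "x = lam i" by blast
    then obtain j where "j < n" "P $$ (i, j) \<noteq> 0" using row by blast
    then show "x \<in> d ` {..<n}" using lam_eq[of i j] i by blast
  next
    fix x assume "x \<in> d ` {..<n}"
    then obtain j where j: "j < n" "x = d j" by blast
    then obtain i where "i < n" "P $$ (i, j) \<noteq> 0" using col by blast
    then show "x \<in> lam ` {..<n}" using lam_eq[of i j] j by (metis image_eqI lessThan_iff)
  qed
qed

lemma spectral_decomp_extreme:
  assumes dec: "ordered_spectral_decomp n (mat_diag n d) P lam" and n: "0 < n"
  shows "lam 0 = Min (d ` {..<n})" "lam (n - 1) = Max (d ` {..<n})"
proof -
  have ord: "lam i \<le> lam j" if "i \<le> j" "j < n" for i j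
    using dec that by (auto simp: ordered_spectral_decomp_def)
  have "Min (lam ` {..<n}) = lam 0"
    by (rule Min_eqI) (use n ord in auto)
  moreover have "Max (lam ` {..<n}) = lam (n - 1)"
    by (rule Max_eqI) (use n ord[of _ "n - 1"] in auto)
  ultimately show "lam 0 = Min (d ` {..<n})" "lam (n - 1) = Max (d ` {..<n})"
    by (simp_all add: spectral_decomp_range[OF dec])
qed

text \<open>\<open>mat_inverse\<close> returns an optional result of an elimination procedure. The
  explicit inverse shows that the result exists, and uniqueness of inverses identifies it.\<close>

lemma mat_inverse_mat_diag:
  fixes g :: "nat \<Rightarrow> real"
  assumes "\<And>i. i < n \<Longrightarrow> g i \<noteq> 0"
  shows "the (mat_inverse (mat_diag n g)) = mat_diag n (\<lambda>i. 1 / g i)"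
proof -
  let ?A = "mat_diag n g" and ?B = "mat_diag n (\<lambda>i. 1 / g i)"
  have A: "?A \<in> carrier_mat n n" and B: "?B \<in> carrier_mat n n" by simp_all
  have one: "mat_diag n (\<lambda>i. g i * (1 / g i)) = 1\<^sub>m n" "mat_diag n (\<lambda>i. 1 / g i * g i) = 1\<^sub>m n"
    using assms by (auto simp: mat_diag_def intro!: eq_matI)
  have AB: "?A * ?B = 1\<^sub>m n" "?B * ?A = 1\<^sub>m n"
    using one by (simp_all only: mat_diag_diag)
  have "?A \<in> Units (ring_mat TYPE(real) n ())"
    using AB A B by (auto simp: Units_def ring_mat_def simp del: mat_diag_diag)
  then obtain C where C: "mat_inverse ?A = Some C"
    using mat_inverse(1)[OF A, of "()"] by (cases "mat_inverse ?A") auto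
  then have CA: "C * ?A = 1\<^sub>m n" "C \<in> carrier_mat n n" using mat_inverse(2)[OF A] by auto
  have "C = C * (?A * ?B)" using CA(2) by (simp add: AB(1) del: mat_diag_diag)
  also have "\<dots> = C * ?A * ?B" using assoc_mult_mat[OF CA(2) A B] by (simp del: mat_diag_diag)
  also have "\<dots> = ?B" unfolding CA(1) by (rule left_mult_one_mat[OF B])
  finally show ?thesis using C by simp
qed

text \<open>Shows that \<open>J\<close> does not depend on the choice of \<open>P\<close>. With
  \<open>B\<close> the identity, \<open>H\<close> is the identity too, and \<open>g (lam i)\<close>
  may be replaced by \<open>g (d j)\<close> next to an entry of \<open>P\<close>; orthonormality of
  the columns then removes \<open>P\<close> altogether.\<close>

lemma saddlepoint_J_mat_diag:
  assumes dec: "ordered_spectral_decomp n (mat_diag n d) P lam" and \<mu>: "\<mu> \<in> carrier_vec n"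
    and nz: "\<And>i. i < n \<Longrightarrow> 1 - 2 * s * d i \<noteq> 0"
  shows "saddlepoint_J n (1\<^sub>m n) \<mu> P lam s
    = (\<Sum>i<n. 1 / (1 - 2 * s * d i)) + (\<Sum>i<n. (\<mu> $ i)\<^sup>2 / (1 - 2 * s * d i)\<^sup>2)"
proof -
  note E = spectral_decomp_entries[OF dec]
  have P: "P \<in> carrier_mat n n" and PPt: "P * transpose_mat P = 1\<^sub>m n"
    using dec by (auto simp: ordered_spectral_decomp_def)
  define g where "g x = 1 / (1 - 2 * s * x)" for x :: real
  define v where "v j = g (d j) * \<mu> $ j" for j
  have nzl: "1 - 2 * s * lam i \<noteq> 0" if "i < n" for i
  proof -
    have "lam i \<in> d ` {..<n}" using spectral_decomp_range[OF dec] that by blast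
    then show ?thesis using nz by auto
  qed
  have "1\<^sub>m n - (2 * s) \<cdot>\<^sub>m mat_diag n lam = mat_diag n (\<lambda>i. 1 - 2 * s * lam i)"
    by (rule eq_matI) (auto simp: mat_diag_def)
  then have D: "the (mat_inverse (1\<^sub>m n - (2 * s) \<cdot>\<^sub>m mat_diag n lam)) = mat_diag n (\<lambda>i. g (lam i))"
    using mat_inverse_mat_diag[of n "\<lambda>i. 1 - 2 * s * lam i"] nzl by (simp add: g_def)
  have H: "P * 1\<^sub>m n * transpose_mat P = 1\<^sub>m n" using P PPt by simp
  have \<nu>: "P *\<^sub>v \<mu> \<in> carrier_vec n" using P \<mu> by simp
  have \<nu>i: "(P *\<^sub>v \<mu>) $ i = (\<Sum>j<n. P $$ (i, j) * \<mu> $ j)" if "i < n" for i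
    using that P \<mu> by (simp add: scalar_prod_def atLeast0LessThan)
  have gP: "g (lam i) * P $$ (i, j) = g (d j) * P $$ (i, j)" if "i < n" "j < n" for i j
    using E(1)[OF that] by (cases "P $$ (i, j) = 0") auto
  have "saddlepoint_J n (1\<^sub>m n) \<mu> P lam s = sum_list (diag_mat (mat_diag n (\<lambda>i. g (lam i)) * 1\<^sub>m n))
      + quad_form (mat_diag n (\<lambda>i. g (lam i)) * 1\<^sub>m n * mat_diag n (\<lambda>i. g (lam i))) (P *\<^sub>v \<mu>)"
    unfolding saddlepoint_J_def Let_def D H quad_form_def ..
  also have "\<dots> = sum_list (diag_mat (mat_diag n (\<lambda>i. g (lam i)))) + quad_form (mat_diag n (\<lambda>i. g (lam i) * g (lam i))) (P *\<^sub>v \<mu>)"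
    by (simp add: right_mult_one_mat[of _ n n])
  also have "sum_list (diag_mat (mat_diag n (\<lambda>i. g (lam i)))) = (\<Sum>i<n. g (lam i))"
    by (simp add: diag_mat_def mat_diag_def sum_list_sum_nth atLeast0LessThan)
  also have "(\<Sum>i<n. g (lam i)) = (\<Sum>i<n. g (d i))"
  proof -
    have "(\<Sum>i<n. g (lam i)) = (\<Sum>i<n. g (lam i) * (\<Sum>j<n. P $$ (i, j) * P $$ (i, j)))"
      by (rule sum.cong) (auto simp: E(2))
    also have "\<dots> = (\<Sum>i<n. \<Sum>j<n. g (d j) * (P $$ (i, j) * P $$ (i, j)))"
      unfolding sum_distrib_left by (intro sum.cong refl) (simp add: gP mult.assoc[symmetric])
    also have "\<dots> = (\<Sum>j<n. g (d j) * (\<Sum>i<n. P $$ (i, j) * P $$ (i, j)))"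
      unfolding sum_distrib_left by (rule sum.swap)
    also have "\<dots> = (\<Sum>j<n. g (d j))" by (rule sum.cong) (auto simp: E(3))
    finally show ?thesis .
  qed
  also have "quad_form (mat_diag n (\<lambda>i. g (lam i) * g (lam i))) (P *\<^sub>v \<mu>) = (\<Sum>i<n. (g (lam i) * (P *\<^sub>v \<mu>) $ i)\<^sup>2)"
    by (simp add: quad_form_mat_diag[OF \<nu>] power2_eq_square mult_ac)
  \<comment> \<open>The scaled vector is \<open>P\<close> applied to \<open>v\<close>, so the sum of
    squares is the squared norm of \<open>v\<close>.\<close>
  also have "\<dots> = (\<Sum>i<n. (\<Sum>j<n. P $$ (i, j) * v j)\<^sup>2)"
  proof (intro sum.cong refl arg_cong[where f="\<lambda>x. x\<^sup>2"])
    fix i assume "i \<in> {..<n}"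
    then show "g (lam i) * (P *\<^sub>v \<mu>) $ i = (\<Sum>j<n. P $$ (i, j) * v j)"
      by (simp only: \<nu>i lessThan_iff sum_distrib_left v_def mult.assoc[symmetric] gP cong: sum.cong)
         (simp add: gP mult_ac)
  qed
  also have "\<dots> = (\<Sum>i<n. \<Sum>j<n. \<Sum>k<n. (P $$ (i, j) * P $$ (i, k)) * (v j * v k))"
    unfolding power2_eq_square sum_product by (simp add: mult_ac)
  also have "\<dots> = (\<Sum>j<n. \<Sum>i<n. \<Sum>k<n. (P $$ (i, j) * P $$ (i, k)) * (v j * v k))"
    by (rule sum.swap)
  also have "\<dots> = (\<Sum>j<n. \<Sum>k<n. (\<Sum>i<n. P $$ (i, j) * P $$ (i, k)) * (v j * v k))"
    unfolding sum_distrib_right by (intro sum.cong refl sum.swap)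
  also have "\<dots> = (\<Sum>j<n. \<Sum>k<n. if j = k then v j * v k else 0)"
    by (intro sum.cong refl) (auto simp: E(3))
  also have "\<dots> = (\<Sum>j<n. (v j)\<^sup>2)" by (simp add: power2_eq_square)
  finally show ?thesis by (simp add: g_def v_def power_divide)
qed

text \<open>Each gamma term contributes \<open>(1 - 2 * c) powr (- (a + j))\<close>, so the Poisson
  mean \<open>\<theta> / 2\<close> becomes \<open>?q\<close> and the series is exponential. The
  exponent is \<open>?q - \<theta> / 2 = \<theta> * c / (1 - 2 * c)\<close>.\<close>

lemma nn_integral_exp_ncchi2:
  assumes a: "0 < a" and th: "0 \<le> \<theta>" and c: "c < 1 / 2"
  shows "(\<integral>\<^sup>+x. ennreal (exp (c * x)) * ncchi2 a \<theta> x \<partial>lborel) = ennreal ((1 - 2 * c) powr (- a) * exp (\<theta> * c / (1 - 2 * c)))"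
proof -
  let ?q = "\<theta> / 2 / (1 - 2 * c)"
  have "(\<integral>\<^sup>+x. ennreal (exp (c * x)) * ncchi2 a \<theta> x \<partial>lborel)
     = (\<integral>\<^sup>+x. (\<Sum>j. ennreal (pois_weight \<theta> j) * (ennreal (exp (c * x)) * ennreal (gamma_dens (a + real j) x))) \<partial>lborel)"
    by (intro nn_integral_cong) (simp only: ncchi2_def ennreal_suminf_cmult[symmetric] mult.left_commute[of "ennreal (exp (c * _))"])
  also have "\<dots> = (\<Sum>j. ennreal (pois_weight \<theta> j) * ennreal ((1 - 2 * c) powr (- (a + real j))))"
    using a c by (simp add: nn_integral_suminf nn_integral_cmult nn_integral_exp_gamma_dens)
  also have "\<dots> = (\<Sum>j. ennreal ((1 - 2 * c) powr (- a) * exp (- \<theta> / 2) * (?q ^ j /\<^sub>R fact j)))"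
  proof (rule arg_cong[where f=suminf], rule ext)
    fix j
    have e: "(1 - 2 * c) powr (- (a + real j)) = (1 - 2 * c) powr (- a) / (1 - 2 * c) ^ j"
      using c by (simp add: powr_diff powr_realpow)
    have alg: "x * y / f * (A / B) = A * x * ((y / B) /\<^sub>R f)" for x y f A B :: real
      by (simp add: divide_inverse mult_ac)
    have "pois_weight \<theta> j * (1 - 2 * c) powr (- (a + real j)) = (1 - 2 * c) powr (- a) * exp (- \<theta> / 2) * (?q ^ j /\<^sub>R fact j)"
      unfolding pois_weight_def e power_divide[of "\<theta> / 2" "1 - 2 * c"] by (rule alg)
    then show "ennreal (pois_weight \<theta> j) * ennreal ((1 - 2 * c) powr (- (a + real j))) = ennreal ((1 - 2 * c) powr (- a) * exp (- \<theta> / 2) * (?q ^ j /\<^sub>R fact j))"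
      using th by (simp add: ennreal_mult[symmetric] pois_weight_nonneg)
  qed
  also have "\<dots> = ennreal ((1 - 2 * c) powr (- a) * exp (- \<theta> / 2) * exp ?q)"
  proof (rule suminf_ennreal_eq)
    show "(\<lambda>j. (1 - 2 * c) powr (- a) * exp (- \<theta> / 2) * (?q ^ j /\<^sub>R fact j)) sums ((1 - 2 * c) powr (- a) * exp (- \<theta> / 2) * exp ?q)"
      by (intro sums_mult exp_converges)
    show "0 \<le> (1 - 2 * c) powr (- a) * exp (- \<theta> / 2) * (?q ^ j /\<^sub>R fact j)" for j
      using th c by simp
  qed
  also have "(1 - 2 * c) powr (- a) * exp (- \<theta> / 2) * exp ?q = (1 - 2 * c) powr (- a) * exp (\<theta> * c / (1 - 2 * c))"
  proof -
    have "exp (- \<theta> / 2) * exp ?q = exp (\<theta> * c / (1 - 2 * c))"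
      unfolding exp_add[symmetric] using c by (intro arg_cong[where f=exp]) (simp add: divide_simps, simp add: algebra_simps)
    then show ?thesis by simp
  qed
  finally show ?thesis .
qed

lemma (in prob_space) mgf_ncchi2_pair:
  assumes X: "distributed M lborel X (ncchi2 a \<theta>)" and Y: "distributed M lborel Y (ncchi2 b \<delta>)"
    and ind: "indep_var borel X borel Y"
    and pos: "0 < a" "0 < b" "0 \<le> \<theta>" "0 \<le> \<delta>"
    and r: "0 < r" "r < 1" and s: "s \<in> cgf_dom r"
  shows "(\<integral>\<omega>. exp (s * ((1 - r) * X \<omega> - r * Y \<omega>)) \<partial>M) = exp (qf_cgf a b \<theta> \<delta> r s)"
proof -
  have [measurable]: "X \<in> borel_measurable M" "Y \<in> borel_measurable M"
    using distributed_measurable[OF X] distributed_measurable[OF Y] by simp_all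
  define c1 c2 where "c1 = s * (1 - r)" and "c2 = - (s * r)"
  have c: "c1 < 1 / 2" "c2 < 1 / 2" using s r by (auto simp: cgf_dom_iff c1_def c2_def)
  have "(\<integral>\<^sup>+\<omega>. ennreal (exp (s * ((1 - r) * X \<omega> - r * Y \<omega>))) \<partial>M)
      = (\<integral>\<^sup>+\<omega>. (\<lambda>(u, v). ennreal (exp (c1 * u)) * ennreal (exp (c2 * v))) (X \<omega>, Y \<omega>) \<partial>M)"
    by (intro nn_integral_cong) (simp add: c1_def c2_def ennreal_mult[symmetric] exp_add[symmetric] algebra_simps)
  also have "\<dots> = (\<integral>\<^sup>+u. \<integral>\<^sup>+v. (\<lambda>(u, v). ennreal (exp (c1 * u)) * ennreal (exp (c2 * v))) (u, v) * (ncchi2 a \<theta> u * ncchi2 b \<delta> v) \<partial>lborel \<partial>lborel)"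
    by (rule indep_nn_integral_pair[OF X Y ind]) measurable
  also have "\<dots> = (\<integral>\<^sup>+u. (ennreal (exp (c1 * u)) * ncchi2 a \<theta> u) * (\<integral>\<^sup>+v. ennreal (exp (c2 * v)) * ncchi2 b \<delta> v \<partial>lborel) \<partial>lborel)"
    by (subst nn_integral_cmult[symmetric]) (auto simp: mult_ac)
  also have "\<dots> = ennreal ((1 - 2 * c1) powr (- a) * exp (\<theta> * c1 / (1 - 2 * c1))) * ennreal ((1 - 2 * c2) powr (- b) * exp (\<delta> * c2 / (1 - 2 * c2)))"
    using pos c by (subst nn_integral_multc) (auto simp: nn_integral_exp_ncchi2)
  also have "\<dots> = ennreal (((1 - 2 * c1) powr (- a) * exp (\<theta> * c1 / (1 - 2 * c1))) * ((1 - 2 * c2) powr (- b) * exp (\<delta> * c2 / (1 - 2 * c2))))"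
    by (rule ennreal_mult[symmetric]) auto
  also have "((1 - 2 * c1) powr (- a) * exp (\<theta> * c1 / (1 - 2 * c1))) * ((1 - 2 * c2) powr (- b) * exp (\<delta> * c2 / (1 - 2 * c2))) = exp (qf_cgf a b \<theta> \<delta> r s)"
  proof -
    have "qf_cgf a b \<theta> \<delta> r s = (- a * ln (1 - 2 * c1) + \<theta> * c1 / (1 - 2 * c1)) + (- b * ln (1 - 2 * c2) + \<delta> * c2 / (1 - 2 * c2))"
      by (simp add: qf_cgf_def c1_def c2_def mult_ac)
    moreover have "(1 - 2 * c1) powr (- a) = exp (- a * ln (1 - 2 * c1))" "(1 - 2 * c2) powr (- b) = exp (- b * ln (1 - 2 * c2))"
      using c by (simp_all add: powr_def)
    ultimately show ?thesis by (simp only: exp_add)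
  qed
  finally show ?thesis
    by (subst integral_eq_nn_integral) auto
qed

text \<open>Domination by \<open>x \<le> 4 * exp (x / 4)\<close>; the exponent 1/4 lies below 1/2,
  where the m.g.f. is finite.\<close>

lemma (in prob_space) ncchi2_integrable:
  assumes X: "distributed M lborel X (ncchi2 a \<theta>)" and pos: "0 < a" "0 \<le> \<theta>" and nn: "\<And>\<omega>. 0 \<le> X \<omega>"
  shows "integrable M X"
proof -
  have [measurable]: "X \<in> borel_measurable M" using distributed_measurable[OF X] by simp
  have "(\<integral>\<^sup>+\<omega>. ennreal (exp (1 / 4 * X \<omega>)) \<partial>M) = (\<integral>\<^sup>+x. ncchi2 a \<theta> x * ennreal (exp (1 / 4 * x)) \<partial>lborel)"
    by (rule distributed_nn_integral[OF X, symmetric]) measurable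
  also have "\<dots> < \<infinity>"
    using nn_integral_exp_ncchi2[of a \<theta> "1/4"] pos by (simp add: mult.commute)
  finally have "integrable M (\<lambda>\<omega>. exp (1 / 4 * X \<omega>))"
    by (intro integrableI_nonneg) auto
  then have "integrable M (\<lambda>\<omega>. 4 * exp (1 / 4 * X \<omega>))" by simp
  then show ?thesis
  proof (rule Bochner_Integration.integrable_bound)
    show "AE \<omega> in M. norm (X \<omega>) \<le> norm (4 * exp (1 / 4 * X \<omega>))"
    proof (rule AE_I2)
      fix \<omega>
      show "norm (X \<omega>) \<le> norm (4 * exp (1 / 4 * X \<omega>))"
      proof -
        have "X \<omega> \<le> 4 * exp (1 / 4 * X \<omega>)" using exp_ge_add_one_self[of "1 / 4 * X \<omega>"] by linarith
        then show ?thesis using nn[of \<omega>] by simp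
      qed
    qed
  qed simp
qed

text \<open>A nonnegative variable of mean 0 would be almost surely 0, which a law with a density
  excludes. Applied to \<open>V\<close>, this settles which branch of the Lugannani-Rice definition
  is active near \<open>r = 1\<close>.\<close>

lemma (in prob_space) ncchi2_expectation_pos:
  assumes X: "distributed M lborel X (ncchi2 a \<theta>)" and pos: "0 < a" "0 \<le> \<theta>" and nn: "\<And>\<omega>. 0 \<le> X \<omega>"
  shows "0 < expectation X"
proof (rule ccontr)
  have [measurable]: "X \<in> borel_measurable M" using distributed_measurable[OF X] by simp
  assume "\<not> 0 < expectation X"
  moreover have "0 \<le> expectation X" by (rule Bochner_Integration.integral_nonneg) (rule nn)
  ultimately have "expectation X = 0" by simp
  then have ae: "AE \<omega> in M. X \<omega> = 0"
    using integral_nonneg_eq_0_iff_AE[OF ncchi2_integrable[OF X pos nn]] nn by simp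
  have "emeasure M (X -` {0} \<inter> space M) = (\<integral>\<^sup>+x. ncchi2 a \<theta> x * indicator {0} x \<partial>lborel)"
    by (rule distributed_emeasure[OF X]) simp
  also have "\<dots> = 0"
    by (simp add: ncchi2_def gamma_dens_def)
  finally have "X -` {0} \<inter> space M \<in> null_sets M" by auto
  then have "AE \<omega> in M. \<omega> \<notin> X -` {0} \<inter> space M" by (rule AE_not_in)
  with ae have "AE \<omega> in M. False" using AE_space by eventually_elim auto
  then show False by simp
qed

text \<open>The set of disagreement is open, and a nonempty open set is not negligible. This
  upgrades uniqueness of densities from almost everywhere to every point.\<close>

lemma continuous_AE_eq_on_open:
  fixes f g :: "real \<Rightarrow> real"
  assumes ae: "AE x in lborel. x \<in> A \<longrightarrow> f x = g x" and A: "open A"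
    and cont: "continuous_on A f" "continuous_on A g" and x: "x \<in> A"
  shows "f x = g x"
proof (rule ccontr)
  assume ne: "f x \<noteq> g x"
  have "continuous_on A (\<lambda>x. f x - g x)" using cont by (intro continuous_intros)
  then have op: "open (A \<inter> (\<lambda>x. f x - g x) -` (- {0}))"
    using A by (intro continuous_open_preimage) auto
  let ?S = "A \<inter> (\<lambda>x. f x - g x) -` (- {0})"
  obtain N where N: "\<And>x. x \<in> space lborel - N \<Longrightarrow> x \<in> A \<longrightarrow> f x = g x" "N \<in> null_sets lborel"
    by (rule AE_E3[OF ae], rule that)
  have "?S \<subseteq> N"
  proof
    fix y assume "y \<in> ?S"
    then have "y \<in> A" "f y \<noteq> g y" by auto
    then show "y \<in> N" using N(1)[of y] by auto
  qed
  then have "?S \<in> null_sets lborel"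
    using op by (intro null_sets_subset[OF N(2)]) auto
  then have "negligible ?S"
    by (simp add: negligible_iff_null_sets null_sets_completionI)
  moreover have "?S \<noteq> {}" using ne x by auto
  ultimately show False using open_not_negligible[OF op] by blast
qed

section \<open>The limiting ratio\<close>

text \<open>Existence and uniqueness of the root make the definite description in
  \<open>saddlepoint\<close> meaningful.\<close>

lemma saddlepoint_properties:
  assumes K: "\<And>s. s \<in> cgf_dom r \<Longrightarrow> cgf M X s = qf_cgf a b \<theta> \<delta> r s"
    and r: "0 < r" "r < 1" and pos: "0 < a" "0 \<le> b" "0 \<le> \<theta>" "0 \<le> \<delta>"
    and lam: "lam 0 = - r" "lam (n - 1) = 1 - r"
    and ex: "\<exists>s\<in>cgf_dom r. qf_cgf1 a b \<theta> \<delta> r s = 0"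
  shows "saddlepoint M X n lam \<in> cgf_dom r" "qf_cgf1 a b \<theta> \<delta> r (saddlepoint M X n lam) = 0"
proof -
  let ?Q = "\<lambda>s. 1 / (2 * lam 0) < s \<and> s < 1 / (2 * lam (n - 1)) \<and> deriv (cgf M X) s = 0"
  have Q: "?Q s \<longleftrightarrow> s \<in> cgf_dom r \<and> qf_cgf1 a b \<theta> \<delta> r s = 0" for s
    using deriv_qf_cgf[OF K r] unfolding lam by (auto simp: cgf_dom_def)
  have "\<exists>!s. ?Q s"
    unfolding Q using ex qf_cgf1_root_unique[OF r pos] by blast
  then have "?Q (saddlepoint M X n lam)"
    unfolding saddlepoint_def by (rule theI')
  then show "saddlepoint M X n lam \<in> cgf_dom r" "qf_cgf1 a b \<theta> \<delta> r (saddlepoint M X n lam) = 0"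
    unfolding Q by auto
qed

theorem theorem15:
  fixes M :: "'a measure" and \<epsilon> :: "'a \<Rightarrow> real vec" and \<mu> :: "real vec"
    and m n :: nat and A B :: "real mat" and R :: "'a \<Rightarrow> real"
    and X :: "real \<Rightarrow> 'a \<Rightarrow> real" and P :: "real \<Rightarrow> real mat" and lam :: "real \<Rightarrow> nat \<Rightarrow> real"
    and \<theta> t0 u0 \<eta>2 L :: real
  assumes "prob_space M"
    and "m \<ge> 1" and "n - m \<ge> 1"
    and "std_cov_normal_vec M n \<mu> \<epsilon>"
    and A_def: "A = four_block_mat (1\<^sub>m m) (0\<^sub>m m (n - m)) (0\<^sub>m (n - m) m) (0\<^sub>m (n - m) (n - m))"
    and B_def: "B = 1\<^sub>m n"
    and R_def: "R = (\<lambda>\<omega>. quad_form A (\<epsilon> \<omega>) / quad_form B (\<epsilon> \<omega>))"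
    and X_def: "X = (\<lambda>r \<omega>. quad_form (A - r \<cdot>\<^sub>m B) (\<epsilon> \<omega>))"
    and "\<And>r. 0 < r \<Longrightarrow> r < 1 \<Longrightarrow> ordered_spectral_decomp n (A - r \<cdot>\<^sub>m B) (P r) (lam r)"
    and \<theta>_def: "\<theta> = (\<Sum>i<m. (\<mu> $ i)\<^sup>2)"
    and t0_def: "t0 = 1 / 2 + 1 / (4 * real n) *
        ((\<theta> - real m) - sqrt ((\<theta> - real m)\<^sup>2 + 4 * \<theta> * real n))"
    and u0_def: "u0 = sqrt ((real n - real m) / 2 +
        2 * t0\<^sup>2 * (real m / (1 - 2 * t0)\<^sup>2 + 2 * \<theta> / (1 - 2 * t0) ^ 3))"
    and \<eta>2_def: "\<eta>2 = \<theta> / (2 * (1 - 2 * t0))"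
    and L_def: "L = sqrt (2 * pi) * (1 - 2 * t0) powr (real m / 2) *
        (2 * t0) powr ((real n - real m) / 2) * u0 * exp (- \<eta>2) /
        (Beta (real m / 2) ((real n - real m) / 2) * ((real n - real m) / 2)) *
        hyp1F1 (real n / 2) (real m / 2) (\<theta> / 2)"
  shows "((\<lambda>r. measure M {\<omega> \<in> space M. R \<omega> > r} / (1 - lugannani_rice1 M (X r) n (lam r)))
            \<longlongrightarrow> L) (at_left 1) \<and>
         (\<forall>f :: real \<Rightarrow> real.
            (\<forall>x. 0 \<le> f x) \<and> distributed M lborel R (\<lambda>x. ennreal (f x)) \<and> continuous_on {0<..<1} f \<longrightarrow>
            ((\<lambda>r. f r / saddlepoint_density1 M (X r) n B \<mu> (P r) (lam r)) \<longlongrightarrow> L) (at_left 1))"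
proof -
  interpret prob_space M by fact
  \<comment> \<open>Subtraction on the naturals is truncated, so \<open>n - m \<ge> 1\<close>
    already gives \<open>m < n\<close>.\<close>
  have mn: "0 < m" "m < n" using assms(2,3) by auto
  define a b where "a = real m / 2" and "b = (real n - real m) / 2"
  define \<delta> where "\<delta> = (\<Sum>i\<in>{m..<n}. (\<mu> $ i)\<^sup>2)"
  have ab: "0 < a" "0 < b" using mn by (auto simp: a_def b_def)
  have nc: "0 \<le> \<theta>" "0 \<le> \<delta>" by (auto simp: \<theta>_def \<delta>_def intro: sum_nonneg)
  have \<mu>: "\<mu> \<in> carrier_vec n" and \<epsilon>: "\<And>\<omega>. \<omega> \<in> space M \<Longrightarrow> \<epsilon> \<omega> \<in> carrier_vec n"
    and ind: "indep_vars (\<lambda>_. borel) (\<lambda>i \<omega>. \<epsilon> \<omega> $ i) {..<n}"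
    and normal: "\<And>i. i < n \<Longrightarrow> distributed M lborel (\<lambda>\<omega>. \<epsilon> \<omega> $ i) (normal_density (\<mu> $ i) 1)"
    using assms(4) by (auto simp: std_cov_normal_vec_def)
  define d where "d r i = (if i < m then 1 - r else - r)" for r :: real and i :: nat
  have AB: "A - r \<cdot>\<^sub>m B = mat_diag n (d r)" for r
    unfolding A_def B_def using mn by (intro eq_matI) (auto simp: mat_diag_def d_def)
  have Ad: "A = mat_diag n (\<lambda>i. if i < m then 1 else 0)"
    unfolding A_def using mn by (intro eq_matI) (auto simp: mat_diag_def)
  have Bd: "B = mat_diag n (\<lambda>i. 1)" unfolding B_def by simp
  have split: "{..<n} = {..<m} \<union> {m..<n}" "{..<m} \<inter> {m..<n} = {}" using mn by auto
  have sum_split: "sum g {..<n} = sum g {..<m} + sum g {m..<n}" for g :: "nat \<Rightarrow> real"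
    unfolding split(1) using split(2) by (intro sum.union_disjoint) auto
  define U V where "U \<omega> = (\<Sum>i<m. (\<epsilon> \<omega> $ i)\<^sup>2)" and "V \<omega> = (\<Sum>i\<in>{m..<n}. (\<epsilon> \<omega> $ i)\<^sup>2)" for \<omega>
  have UV0: "0 \<le> U \<omega>" "0 \<le> V \<omega>" for \<omega> by (auto simp: U_def V_def intro: sum_nonneg)
  have X_eq: "X r \<omega> = (1 - r) * U \<omega> - r * V \<omega>" if "\<omega> \<in> space M" for r \<omega>
    unfolding X_def AB quad_form_mat_diag[OF \<epsilon>[OF that]] sum_split U_def V_def sum_distrib_left
    by (simp add: d_def sum_negf)
  have R_eq: "R \<omega> = U \<omega> / (U \<omega> + V \<omega>)" if "\<omega> \<in> space M" for \<omega>
    unfolding R_def Ad Bd quad_form_mat_diag[OF \<epsilon>[OF that]] sum_split U_def V_def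
    by simp
  have block: "distributed M lborel (\<lambda>\<omega>. \<Sum>i\<in>I. (\<epsilon> \<omega> $ i)\<^sup>2) (ncchi2 (real (card I) / 2) (\<Sum>i\<in>I. (\<mu> $ i)\<^sup>2))"
    if I: "I \<subseteq> {..<n}" "I \<noteq> {}" for I
  proof (rule sum_normal_square_ncchi2)
    show "finite I" using I(1) by (rule finite_subset) simp
    show "indep_vars (\<lambda>_. borel) (\<lambda>i \<omega>. \<epsilon> \<omega> $ i) I" by (rule indep_vars_subset[OF ind I(1)])
    show "distributed M lborel (\<lambda>\<omega>. \<epsilon> \<omega> $ i) (normal_density (\<mu> $ i) 1)" if "i \<in> I" for i
      using that I(1) by (intro normal) auto
  qed (rule I(2))
  have dU: "distributed M lborel U (ncchi2 a \<theta>)"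
    using block[of "{..<m}"] mn unfolding U_def[abs_def] \<theta>_def a_def by (simp add: lessThan_empty_iff)
  have dV: "distributed M lborel V (ncchi2 b \<delta>)"
    using block[of "{m..<n}"] mn unfolding V_def[abs_def] \<delta>_def b_def by (simp add: of_nat_diff subset_iff)
  have "indep_vars (\<lambda>_. borel) (\<lambda>i \<omega>. (\<epsilon> \<omega> $ i)\<^sup>2) {..<n}"
    by (rule indep_vars_compose2[OF ind, where Y="\<lambda>_ x. x\<^sup>2"]) auto
  then have indUV: "indep_var borel U borel V"
    unfolding U_def[abs_def] V_def[abs_def] using mn by (intro indep_var_sums) auto
  have dR: "distributed M lborel (\<lambda>\<omega>. U \<omega> / (U \<omega> + V \<omega>)) (\<lambda>x. ennreal (ncbeta_dens a b \<theta> \<delta> x))"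
    by (rule ratio_distributed[OF dU dV indUV ab nc])
  have mgf_eq: "mgf M (X r) s = exp (qf_cgf a b \<theta> \<delta> r s)" if "0 < r" "r < 1" "s \<in> cgf_dom r" for r s
    unfolding mgf_def mgf_ncchi2_pair[OF dU dV indUV ab nc that, symmetric]
    by (rule Bochner_Integration.integral_cong) (auto simp: X_eq)
  then have cgf_eq: "cgf M (X r) s = qf_cgf a b \<theta> \<delta> r s" if "0 < r" "r < 1" "s \<in> cgf_dom r" for r s
    using that by (simp add: cgf_def)
  have dec: "ordered_spectral_decomp n (mat_diag n (d r)) (P r) (lam r)" if "0 < r" "r < 1" for r
    using assms(9)[OF that] by (simp add: AB)
  have dimg: "d r ` {..<n} = {1 - r, - r}" for r
  proof
    have "1 - r = d r 0" "- r = d r m" "0 \<in> {..<n}" "m \<in> {..<n}" using mn by (auto simp: d_def)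
    then show "{1 - r, - r} \<subseteq> d r ` {..<n}" by blast
  qed (auto simp: d_def)
  have lam: "lam r 0 = - r" "lam r (n - 1) = 1 - r" if "0 < r" "r < 1" for r
    using spectral_decomp_extreme[OF dec[OF that]] mn unfolding dimg by auto
  define s where "s r = saddlepoint M (X r) n (lam r)" for r
  interpret saddle_family a b \<theta> \<delta> s
  proof
    have near: "eventually (\<lambda>r. 0 < r \<and> r < (1::real)) (at_left 1)"
      using eventually_at_left_1[of "\<lambda>r. 0 < r \<and> r < 1"] by simp
    \<comment> \<open>The tolerance is immaterial here, as only the existence of a root is
      used.\<close>
    have "0 < (1::real)" by simp
    from saddlepoint_near_limit[OF ab nc this] near
    show "eventually (\<lambda>r. s r \<in> cgf_dom r \<and> qf_cgf1 a b \<theta> \<delta> r (s r) = 0) (at_left 1)"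
    proof eventually_elim
      case (elim r)
      then have r: "0 < r" "r < 1" and ex: "\<exists>s\<in>cgf_dom r. qf_cgf1 a b \<theta> \<delta> r s = 0" by blast+
      show ?case unfolding s_def
        using saddlepoint_properties[OF cgf_eq[OF r] r ab(1) less_imp_le[OF ab(2)] nc lam[OF r] ex] by blast
    qed
  qed (use ab nc in auto)
  have t0: "t0 = saddle_limit a b \<theta>"
    unfolding t0_def saddle_limit_def by (simp add: a_def b_def field_simps)
  have u0: "u0 = saddle_u a b \<theta> t0"
    unfolding u0_def saddle_u_def by (simp add: a_def b_def)
  note tp = t0_props[folded t0]
  define c where "c = ncbeta_series a b \<theta> \<delta> 1"
  have c0: "0 \<le> c" unfolding c_def using ab nc by (intro ncbeta_series_nonneg) auto
  have L: "c / b / (saddle_mgf a b \<theta> \<delta> t0 / (sqrt (2 * pi) * saddle_u a b \<theta> t0)) = L"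
  proof -
    \<comment> \<open>Rests on
      \<open>\<theta> * t0 / (1 - 2 * t0) - \<eta>2 = - \<theta> / 2\<close>. The exponential of the
      saddlepoint m.g.f. then cancels, and with it \<open>\<delta>\<close>.\<close>
    have e: "exp (- \<theta> / 2) * exp (- \<delta> / 2) = exp (\<theta> * t0 / (1 - 2 * t0) - \<delta> / 2) * exp (- \<eta>2)"
      unfolding exp_add[symmetric] \<eta>2_def using tp
      by (intro arg_cong[where f=exp]) (simp add: divide_simps, simp add: algebra_simps)
    have n2: "real n / 2 = a + b" "(real n - real m) / 2 = b" "real m / 2 = a" by (auto simp: a_def b_def field_simps)
    have "c / b / (saddle_mgf a b \<theta> \<delta> t0 / (sqrt (2 * pi) * saddle_u a b \<theta> t0))
      = (exp (\<theta> * t0 / (1 - 2 * t0) - \<delta> / 2) * exp (- \<eta>2)) / Beta a b * hyp1F1 (a + b) a (\<theta> / 2) / b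
        / ((1 - 2 * t0) powr (- a) * (2 * t0) powr (- b) * exp (\<theta> * t0 / (1 - 2 * t0) - \<delta> / 2) / (sqrt (2 * pi) * u0))"
      unfolding c_def ncbeta_series_1[OF ab nc] saddle_mgf_def e u0 ..
    also have "\<dots> = L"
      unfolding L_def n2 using tp by (simp add: powr_minus field_simps)
    finally show ?thesis .
  qed
  define fhat where "fhat r = saddlepoint_density1 M (X r) n B \<mu> (P r) (lam r)" for r
  define lr where "lr r = lugannani_rice1 M (X r) n (lam r)" for r
  have lim_lr: "((\<lambda>r. (1 - lr r) / (1 - r) powr b) \<longlongrightarrow> saddle_mgf a b \<theta> \<delta> t0 / (sqrt (2 * pi) * saddle_u a b \<theta> t0)) (at_left 1)"
  proof -
    \<comment> \<open>The mean of \<open>X r\<close> tends to \<open>- expectation V\<close>, which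
      is negative, so near 1 the generic branch of the approximation applies.\<close>
    have EU: "integrable M U" "integrable M V" "0 < expectation V"
      using ncchi2_integrable[OF dU ab(1) nc(1)] ncchi2_integrable[OF dV ab(2) nc(2)] ncchi2_expectation_pos[OF dV ab(2) nc(2)] UV0
      by auto
    have EX: "(\<integral>\<omega>. X r \<omega> \<partial>M) = (1 - r) * expectation U - r * expectation V" for r
    proof -
      have "(\<integral>\<omega>. X r \<omega> \<partial>M) = (\<integral>\<omega>. (1 - r) * U \<omega> - r * V \<omega> \<partial>M)"
        by (rule Bochner_Integration.integral_cong) (auto simp: X_eq)
      then show ?thesis using EU by simp
    qed
    have "((\<lambda>r. (1 - r) * expectation U - r * expectation V) \<longlongrightarrow> (1 - 1) * expectation U - 1 * expectation V) (at_left 1)"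
      by (intro tendsto_intros)
    then have "eventually (\<lambda>r. (1 - r) * expectation U - r * expectation V < 0) (at_left 1)"
      using EU(3) by (intro order_tendstoD(2)) auto
    then have "eventually (\<lambda>r. (1 - (cdf std_normal_distribution (sgn (s r) * sqrt (- 2 * qf_cgf a b \<theta> \<delta> r (s r))) +
        std_normal_density (sgn (s r) * sqrt (- 2 * qf_cgf a b \<theta> \<delta> r (s r))) *
          (inverse (sgn (s r) * sqrt (- 2 * qf_cgf a b \<theta> \<delta> r (s r))) - inverse (s r * sqrt (qf_cgf2 a b \<theta> \<delta> r (s r)))))) / (1 - r) powr b
       = (1 - lr r) / (1 - r) powr b) (at_left 1)"
      using root near_1
    proof eventually_elim
      case (elim r)
      then have r: "0 < r" "r < 1" and sd: "s r \<in> cgf_dom r" by auto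
      have "(\<integral>\<omega>. X r \<omega> \<partial>M) \<noteq> 0" using elim EX by simp
      then show ?case
        unfolding lr_def lugannani_rice1_def Let_def s_def[symmetric]
        using cgf_eq[OF r sd] deriv2_qf_cgf[OF cgf_eq[OF r] r sd] by simp
    qed
    from Lim_transform_eventually[OF lugannani_rice_limit this] show ?thesis by (simp add: t0)
  qed
  have lim_fhat: "((\<lambda>r. fhat r / (1 - r) powr (b - 1)) \<longlongrightarrow> b * saddle_mgf a b \<theta> \<delta> t0 / (sqrt (2 * pi) * saddle_u a b \<theta> t0)) (at_left 1)"
  proof -
    let ?J = "\<lambda>r. 2 * a / (1 - 2 * s r * (1 - r)) + 2 * b / (1 + 2 * s r * r)
      + \<theta> / (1 - 2 * s r * (1 - r))\<^sup>2 + \<delta> / (1 + 2 * s r * r)\<^sup>2"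
    \<comment> \<open>The factors \<open>s r\<close> and \<open>1 - r\<close> are inserted so that
      every part converges: \<open>s r\<close> pairs with the square root of the second derivative,
      and \<open>1 - r\<close> lowers the power from \<open>b\<close> to
      \<open>b - 1\<close>.\<close>
    let ?G = "\<lambda>r. ((1 - r) * s r * ?J r) * (exp (qf_cgf a b \<theta> \<delta> r (s r)) / (1 - r) powr b) / (sqrt (2 * pi) * (s r * sqrt (qf_cgf2 a b \<theta> \<delta> r (s r))))"
    have "(?G \<longlongrightarrow> b * saddle_mgf a b \<theta> \<delta> t0 / (sqrt (2 * pi) * saddle_u a b \<theta> t0)) (at_left 1)"
      using saddle_u_pos unfolding t0 by (intro tendsto_intros jacobian_limit mgf_limit curvature_limit) auto
    moreover have "eventually (\<lambda>r. ?G r = fhat r / (1 - r) powr (b - 1)) (at_left 1)"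
      using root near_1 saddle_pos
    proof eventually_elim
      case (elim r)
      then have r: "0 < r" "r < 1" and sd: "s r \<in> cgf_dom r" and sp: "0 < s r" by auto
      have PQ: "0 < 1 - 2 * s r * (1 - r)" "0 < 1 + 2 * s r * r" using sd cgf_dom_iff[OF r] by auto
      have nz: "1 - 2 * s r * d r i \<noteq> 0" if "i < n" for i
        using PQ by (auto simp: d_def)
      have J: "saddlepoint_J n B \<mu> (P r) (lam r) (s r) = ?J r"
      proof -
        have "saddlepoint_J n B \<mu> (P r) (lam r) (s r)
           = (\<Sum>i<n. 1 / (1 - 2 * s r * d r i)) + (\<Sum>i<n. (\<mu> $ i)\<^sup>2 / (1 - 2 * s r * d r i)\<^sup>2)"
          unfolding B_def by (rule saddlepoint_J_mat_diag[OF dec[OF r] \<mu> nz])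
        also have "(\<Sum>i<n. 1 / (1 - 2 * s r * d r i)) = 2 * a / (1 - 2 * s r * (1 - r)) + 2 * b / (1 + 2 * s r * r)"
        proof -
          have "(\<Sum>i<m. 1 / (1 - 2 * s r * d r i)) = (\<Sum>i<m. 1 / (1 - 2 * s r * (1 - r)))"
            "(\<Sum>i\<in>{m..<n}. 1 / (1 - 2 * s r * d r i)) = (\<Sum>i\<in>{m..<n}. 1 / (1 + 2 * s r * r))"
            by (intro sum.cong refl; simp add: d_def)+
          moreover have "2 * a = real m" "2 * b = real n - real m" by (simp_all add: a_def b_def)
          ultimately show ?thesis using mn by (simp add: sum_split of_nat_diff)
        qed
        also have "(\<Sum>i<n. (\<mu> $ i)\<^sup>2 / (1 - 2 * s r * d r i)\<^sup>2) = \<theta> / (1 - 2 * s r * (1 - r))\<^sup>2 + \<delta> / (1 + 2 * s r * r)\<^sup>2"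
        proof -
          have "(\<Sum>i<m. (\<mu> $ i)\<^sup>2 / (1 - 2 * s r * d r i)\<^sup>2) = (\<Sum>i<m. (\<mu> $ i)\<^sup>2 / (1 - 2 * s r * (1 - r))\<^sup>2)"
            "(\<Sum>i\<in>{m..<n}. (\<mu> $ i)\<^sup>2 / (1 - 2 * s r * d r i)\<^sup>2) = (\<Sum>i\<in>{m..<n}. (\<mu> $ i)\<^sup>2 / (1 + 2 * s r * r)\<^sup>2)"
            by (intro sum.cong refl; simp add: d_def)+
          then show ?thesis unfolding sum_split \<theta>_def \<delta>_def by (simp add: sum_divide_distrib)
        qed
        finally show ?thesis by simp
      qed
      have fh: "fhat r = ?J r / sqrt (2 * pi * qf_cgf2 a b \<theta> \<delta> r (s r)) * exp (qf_cgf a b \<theta> \<delta> r (s r))"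
        unfolding fhat_def saddlepoint_density1_def Let_def s_def[symmetric]
        using J mgf_eq[OF r sd] deriv2_qf_cgf[OF cgf_eq[OF r] r sd] by simp
      have pw: "(1 - r) powr b = (1 - r) * (1 - r) powr (b - 1)"
        using r by (simp add: powr_mult_base)
      have alg: "(e * x * J) * (E / (e * y)) / (p * (x * q)) = J / (p * q) * E / y" if "e \<noteq> 0" "x \<noteq> 0" for e x J E y p q :: real
        using that by (simp add: divide_simps)
      show ?case unfolding fh pw real_sqrt_mult[of "2 * pi"] using r sp by (intro alg) auto
    qed
    ultimately show ?thesis by (rule Lim_transform_eventually)
  qed
  define q where "q x = x powr (a - 1) * ncbeta_series a b \<theta> \<delta> x" for x
  have q_lim: "(q \<longlongrightarrow> c) (at_left 1)"
  proof -
    have "(ncbeta_series a b \<theta> \<delta> \<longlongrightarrow> c) (at 1 within {0..1})"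
      using continuous_ncbeta_series[OF ab nc] by (auto simp: continuous_on_def c_def)
    then have "(ncbeta_series a b \<theta> \<delta> \<longlongrightarrow> c) (at_left 1)"
      by (simp add: at_within_Icc_at_left)
    then have "(q \<longlongrightarrow> 1 powr (a - 1) * c) (at_left 1)"
      unfolding q_def by (intro tendsto_intros) auto
    then show ?thesis by simp
  qed
  have dens_q: "ncbeta_dens a b \<theta> \<delta> x = (1 - x) powr (b - 1) * q x" if "0 < x" "x < 1" for x
    using that by (simp add: ncbeta_dens_def q_def)
  have tail: "((\<lambda>r. measure M {\<omega> \<in> space M. R \<omega> > r} / (1 - r) powr b) \<longlongrightarrow> c / b) (at_left 1)"
  proof -
    have "((\<lambda>r. measure M {\<omega> \<in> space M. U \<omega> / (U \<omega> + V \<omega>) > r} / (1 - r) powr b) \<longlongrightarrow> c / b) (at_left 1)"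
      by (rule tail_limit[OF dR dens_q _ q_lim c0 ab(2)]) (auto simp: ncbeta_dens_def)
    moreover have "{\<omega> \<in> space M. U \<omega> / (U \<omega> + V \<omega>) > r} = {\<omega> \<in> space M. R \<omega> > r}" for r
      using R_eq by auto
    ultimately show ?thesis by simp
  qed
  have den_nz: "saddle_mgf a b \<theta> \<delta> t0 / (sqrt (2 * pi) * saddle_u a b \<theta> t0) \<noteq> 0"
    using saddle_u_pos saddle_mgf_pos unfolding t0 by simp
  show ?thesis
  proof (intro conjI allI impI)
    have "((\<lambda>r. (measure M {\<omega> \<in> space M. R \<omega> > r} / (1 - r) powr b) / ((1 - lr r) / (1 - r) powr b)) \<longlongrightarrow> L) (at_left 1)"
      unfolding L[symmetric] by (rule tendsto_divide[OF tail lim_lr den_nz])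
    then show "((\<lambda>r. measure M {\<omega> \<in> space M. R \<omega> > r} / (1 - lugannani_rice1 M (X r) n (lam r))) \<longlongrightarrow> L) (at_left 1)"
      unfolding lr_def[symmetric]
      by (rule Lim_transform_eventually) (rule eventually_mono[OF near_1], simp)
  next
    fix f :: "real \<Rightarrow> real"
    assume f: "(\<forall>x. 0 \<le> f x) \<and> distributed M lborel R (\<lambda>x. ennreal (f x)) \<and> continuous_on {0<..<1} f"
    have "distributed M lborel R (\<lambda>x. ennreal (ncbeta_dens a b \<theta> \<delta> x))"
    proof -
      have "distr M lborel R = distr M lborel (\<lambda>\<omega>. U \<omega> / (U \<omega> + V \<omega>))"
        by (rule distr_cong) (auto simp: R_eq)
      then show ?thesis using dR f by (auto simp: distributed_def)
    qed
    then have "AE x in lborel. ennreal (f x) = ennreal (ncbeta_dens a b \<theta> \<delta> x)"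
      using f by (intro distributed_unique) auto
    then have ae: "AE x in lborel. x \<in> {0<..<1} \<longrightarrow> f x = ncbeta_dens a b \<theta> \<delta> x"
      using f ncbeta_dens_nonneg[OF ab nc] by (auto elim!: eventually_mono)
    have cont: "continuous_on {0<..<1} (ncbeta_dens a b \<theta> \<delta>)"
    proof -
      have "continuous_on {0<..<1} (\<lambda>x. x powr (a - 1) * (1 - x) powr (b - 1) * ncbeta_series a b \<theta> \<delta> x)"
        by (intro continuous_intros continuous_on_subset[OF continuous_ncbeta_series[OF ab nc]]) auto
      then show ?thesis by (rule continuous_on_cong[THEN iffD1, rotated 2]) (auto simp: ncbeta_dens_def)
    qed
    \<comment> \<open>Any admissible \<open>f\<close> agrees with \<open>ncbeta_dens\<close> almost
      everywhere, and both are continuous on the open interval, so they agree at each of its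
      points.\<close>
    have f_eq: "f x = (1 - x) powr (b - 1) * q x" if "0 < x" "x < 1" for x
      using continuous_AE_eq_on_open[OF ae _ _ cont, of x] f that by (simp add: dens_q)
    \<comment> \<open>The factor \<open>b\<close> in this denominator is the Jacobian limit. It
      takes the place of the \<open>1 / b\<close> from integrating the tail, so the limit is again
      \<open>L\<close>.\<close>
    have "((\<lambda>r. q r / (fhat r / (1 - r) powr (b - 1))) \<longlongrightarrow> c / (b * saddle_mgf a b \<theta> \<delta> t0 / (sqrt (2 * pi) * saddle_u a b \<theta> t0))) (at_left 1)"
      using den_nz ab by (intro tendsto_divide q_lim lim_fhat) auto
    also have "c / (b * saddle_mgf a b \<theta> \<delta> t0 / (sqrt (2 * pi) * saddle_u a b \<theta> t0)) = L"
      unfolding L[symmetric] by simp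
    finally have lim: "((\<lambda>r. q r / (fhat r / (1 - r) powr (b - 1))) \<longlongrightarrow> L) (at_left 1)" .
    have "eventually (\<lambda>r. q r / (fhat r / (1 - r) powr (b - 1)) = f r / fhat r) (at_left 1)"
      using near_1 by eventually_elim (simp add: f_eq mult.commute)
    with lim show "((\<lambda>r. f r / saddlepoint_density1 M (X r) n B \<mu> (P r) (lam r)) \<longlongrightarrow> L) (at_left 1)"
      unfolding fhat_def[symmetric] by (rule Lim_transform_eventually)
  qed
qed

end
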